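(* Let $\delta>0$ be a sufficiently small constant independent of $n$. Then there exists $N\in\mathbb{N}$ such that for every $n\ge N$ and every $\omega\in\mathbb{R}\setminus\mathbb{Q}$ with $$|\omega|<n^{-\frac a2-\delta},$$ the exact area-preserving monotone twist map generated by $h_n$ does not admit any invariant circle with rotation number $\omega$.
   Context: Generating functions. A function $h:\mathbb{R}^2\to\mathbb{R}$ generates an exact area-preserving monotone twist map $f$ of $\mathbb{T}\times\mathbb{R}$ ($\mathbb{T}=\mathbb{R}/\mathbb{Z}$) if the lift $F:\mathbb{R}^2\to\mathbb{R}^2$ of $f$ is given by $F(x,y)=(x',y')$ if and only if $y=-\partial_1h(x,x')$ and $y'=\partial_2h(x,x')$. An invariant circle of $f$ is a homotopically non-trivial $f$-invariant simple closed curve in $\mathbb{T}\times\mathbb{R}$; its rotation number is the rotation number $\lim_{m\to\infty}(x_m-x_0)/m$ of the $F$-orbits $(x_m,y_m)=F^m(x_0,y_0)$ on its lift. The family $h_n$. Fix a constant $a>0$ and a positive integer $k$, both independent of $n$. For $n\in\mathbb{N}$, $n\geq 1$, let $h_0(x,x')=\frac12(x-x')^2$, $u_n(x)=\frac1{n^a}(1-\cos(2\pi x))$, and let $v_n:\mathbb{R}\to\mathbb{R}$ be a non-negative function, of class $C^k$ (and regular enough for the generated map to be defined), such that $v_n(x+1)=v_n(x)$; $\operatorname{supp}v_n\cap[0,1]\subset[\frac12-\frac1{n^a},\frac12+\frac1{n^a}]$; $\max v_n=n^{-s}$; $\|v_n\|_{C^k}=O(n^{-s'})$ as $n\to\infty$,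 where $s,s'>0$ are constants independent of $n$ with $s'>a$ (for this it is enough to take $s=(k+2)a$). Set $$h_n(x,x')=h_0(x,x')+u_n(x')+v_n(x').$$ *)

theory Defs
  imports "HOL-Analysis.Analysis" "HOL-Library.Landau_Symbols"
begin

(* The circle R/Z is realised as the unit circle in the complex plane, via x \<mapsto> exp(2 pi i x);
   values of self-maps of the annulus outside this set are irrelevant. *)

definition annulus :: "(complex \<times> real) set" where
  "annulus = sphere 0 1 \<times> UNIV"

definition ann_proj :: "real \<times> real \<Rightarrow> complex \<times> real" where
  "ann_proj z = (cis (2 * pi * fst z), snd z)"

definition is_lift_of ::
    "(real \<times> real \<Rightarrow> real \<times> real) \<Rightarrow> (complex \<times> real \<Rightarrow> complex \<times> real) \<Rightarrow> bool" where
  "is_lift_of F f \<longleftrightarrow> continuous_on UNIV F \<and> (\<forall>z. f (ann_proj z) = ann_proj (F z))"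

(* F(x,y) = (x',y') iff y = - d_1 h(x,x') and y' = d_2 h(x,x'), the existence of the
   two partial derivatives being part of the right-hand side. *)

definition generates_lift :: "(real \<Rightarrow> real \<Rightarrow> real) \<Rightarrow> (real \<times> real \<Rightarrow> real \<times> real) \<Rightarrow> bool" where
  "generates_lift h F \<longleftrightarrow>
     (\<forall>x y x' y'. F (x, y) = (x', y') \<longleftrightarrow>
        ((\<lambda>t. h t x') has_real_derivative - y) (at x) \<and>
        ((\<lambda>t. h x t) has_real_derivative y') (at x'))"

definition generates ::
    "(real \<Rightarrow> real \<Rightarrow> real) \<Rightarrow> (complex \<times> real \<Rightarrow> complex \<times> real)
      \<Rightarrow> (real \<times> real \<Rightarrow> real \<times> real) \<Rightarrow> bool" where
  "generates h f F \<longleftrightarrow> generates_lift h F \<and> is_lift_of F f"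

definition essential_simple_closed_curve :: "(complex \<times> real) set \<Rightarrow> bool" where
  "essential_simple_closed_curve C \<longleftrightarrow>
     (\<exists>g. simple_path g \<and> pathfinish g = pathstart g \<and> path_image g = C \<and> C \<subseteq> annulus \<and>
          \<not> (\<exists>c. homotopic_loops annulus g (linepath c c)))"

definition invariant_circle ::
    "(complex \<times> real \<Rightarrow> complex \<times> real) \<Rightarrow> (complex \<times> real) set \<Rightarrow> bool" where
  "invariant_circle f C \<longleftrightarrow> essential_simple_closed_curve C \<and> f ` C = C"

definition has_rotation_number ::
    "(real \<times> real \<Rightarrow> real \<times> real) \<Rightarrow> (complex \<times> real) set \<Rightarrow> real \<Rightarrow> bool" where
  "has_rotation_number F C \<omega> \<longleftrightarrow>
     (\<forall>z. ann_proj z \<in> C \<longrightarrow>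
        (\<lambda>m. (fst ((F ^^ m) z) - fst z) / real m) \<longlonglongrightarrow> \<omega>)"

definition class_C :: "nat \<Rightarrow> (real \<Rightarrow> real) \<Rightarrow> bool" where
  "class_C k w \<longleftrightarrow>
     (\<forall>i<k. \<forall>x. (deriv ^^ i) w differentiable (at x)) \<and> continuous_on UNIV ((deriv ^^ k) w)"

(* Meaningful when the derivatives up to order k are bounded, as they are for periodic
   functions of class C^k. *)

definition C_norm :: "nat \<Rightarrow> (real \<Rightarrow> real) \<Rightarrow> real" where
  "C_norm k w = (MAX i\<in>{..k}. SUP x. \<bar>(deriv ^^ i) w x\<bar>)"

definition support :: "(real \<Rightarrow> real) \<Rightarrow> real set" where
  "support w = closure {x. w x \<noteq> 0}"

definition h0 :: "real \<Rightarrow> real \<Rightarrow> real" where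
  "h0 x x' = (1/2) * (x - x')^2"

definition u_pot :: "real \<Rightarrow> nat \<Rightarrow> real \<Rightarrow> real" where
  "u_pot a n x = (1 / real n powr a) * (1 - cos (2 * pi * x))"

definition h_fam :: "real \<Rightarrow> (nat \<Rightarrow> real \<Rightarrow> real) \<Rightarrow> nat \<Rightarrow> real \<Rightarrow> real \<Rightarrow> real" where
  "h_fam a v n x x' = h0 x x' + u_pot a n x' + v n x'"

lemma ann_proj_eqD:
  assumes "ann_proj z = ann_proj w"
  obtains m :: int where "fst z = fst w + of_int m" "snd z = snd w"
proof -
  have "cis (2 * pi * fst z) = cis (2 * pi * fst w)" and s: "snd z = snd w"
    using assms by (auto simp: ann_proj_def)
  then have "sin (2 * pi * fst z) = sin (2 * pi * fst w) \<and> cos (2 * pi * fst z) = cos (2 * pi * fst w)"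
    by (auto simp: complex_eq_iff)
  then obtain m :: int where "2 * pi * fst z = 2 * pi * fst w + 2 * pi * of_int m"
    unfolding sin_cos_eq_iff by auto
  then have "2 * pi * fst z = 2 * pi * (fst w + of_int m)"
    by (simp add: algebra_simps)
  then have "fst z = fst w + of_int m"
    by simp
  with s show ?thesis using that by blast
qed

lemma ann_proj_shift: "ann_proj (x + of_int m, y) = ann_proj (x, y)"
proof -
  have "cis (2 * pi * of_int m) = 1"
    by (metis cis_multiple_2pi Ints_of_int)
  then show ?thesis
    by (simp add: ann_proj_def distrib_left flip: cis_mult)
qed

(* The functions h_fam a v n do generate a map of the annulus, which is unique there. *)

lemma generates_lift_unique:
  assumes "generates_lift h F" "generates_lift h G"
  shows "F = G"
proof
  fix z
  obtain x y :: real where z: "z = (x, y)" by (cases z)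
  obtain x' y' where "F (x, y) = (x', y')" by (cases "F (x, y)")
  then show "F z = G z"
    using assms z unfolding generates_lift_def by (metis (no_types, lifting))
qed

lemma generates_h_fam_exists:
  assumes C: "class_C k (v n)" and k: "k \<ge> 1" and per: "\<And>x. v n (x + 1) = v n x"
  shows "\<exists>f F. generates (h_fam a v n) f F"
proof -
  have diff: "v n differentiable (at x)" for x
    using C k unfolding class_C_def by (metis funpow_0 less_le_trans zero_less_one)
  define d where "d = deriv (v n)"
  have dv: "(v n has_real_derivative d x) (at x)" for x
    using diff[of x] unfolding d_def by (metis DERIV_imp_deriv real_differentiable_def)
  have cont_d: "continuous_on UNIV d"
  proof (cases "k = 1")
    case True
    then show ?thesis using C by (simp add: class_C_def d_def)
  next
    case False
    with k have "1 < k" by simp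
    then have "\<forall>x. (deriv ^^ 1) (v n) differentiable (at x)"
      using C unfolding class_C_def by blast
    then have "\<forall>x. d differentiable (at x)" by (simp add: d_def)
    then show ?thesis
      by (simp add: continuous_at_imp_continuous_on differentiable_imp_continuous_within)
  qed
  define c where "c = 1 / real n powr a"
  define g where "g = (\<lambda>x. c * (2 * pi * sin (2 * pi * x)) + d x)"
  define F where "F = (\<lambda>z::real\<times>real. (fst z + snd z, snd z + g (fst z + snd z)))"
  have D1: "((\<lambda>t. h_fam a v n t x') has_real_derivative x - x') (at x)" for x x'
    unfolding h_fam_def h0_def by (auto intro!: derivative_eq_intros)
  have D2: "((\<lambda>t. h_fam a v n x t) has_real_derivative (x' - x) + g x') (at x')" for x x'
    unfolding h_fam_def h0_def u_pot_def g_def c_def[symmetric]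
    by (auto intro!: derivative_eq_intros dv)
  have gen: "generates_lift (h_fam a v n) F"
    unfolding generates_lift_def
  proof (intro allI iffI)
    fix x y x' y' assume "F (x, y) = (x', y')"
    then have "x' = x + y" "y' = y + g x'" by (auto simp: F_def)
    then show "((\<lambda>t. h_fam a v n t x') has_real_derivative - y) (at x) \<and>
        ((\<lambda>t. h_fam a v n x t) has_real_derivative y') (at x')"
      using D1[of x' x] D2[of x x'] by simp
  next
    fix x y x' y'
    assume "((\<lambda>t. h_fam a v n t x') has_real_derivative - y) (at x) \<and>
        ((\<lambda>t. h_fam a v n x t) has_real_derivative y') (at x')"
    then have "- y = x - x'" "y' = (x' - x) + g x'"
      using D1[of x' x] D2[of x x'] DERIV_unique by blast+
    then have "x' = x + y" "y' = y + g x'" by auto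
    then show "F (x, y) = (x', y')" by (simp add: F_def)
  qed
  have vm: "v n (x + of_int m) = v n x" for x and m :: int
  proof -
    have nat_case: "v n (x + of_nat j) = v n x" for x and j :: nat
      by (induction j) (use per in \<open>auto simp: add.assoc[symmetric] add.commute[of 1]\<close>)
    show ?thesis
      by (cases m rule: int_cases2)
        (use nat_case[of x] nat_case[of "x - of_nat _"] in
          \<open>auto, metis add.commute diff_add_cancel uminus_add_conv_diff\<close>)
  qed
  have gm: "g (x + of_int m) = g x" for x and m :: int
  proof -
    have "((\<lambda>t. v n (t + of_int m)) has_real_derivative d (x + of_int m)) (at x)"
      using dv[of "x + of_int m"] by (simp add: DERIV_shift add.commute)
    then have "d (x + of_int m) = d x"
      using dv[of x] DERIV_unique by (simp add: vm)
    moreover have "sin (2 * pi * (x + of_int m)) = sin (2 * pi * x)"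
      by (metis (no_types, opaque_lifting) distrib_left sin_cos_eq_iff)
    ultimately show ?thesis by (simp add: g_def)
  qed
  have Fp: "ann_proj (F z) = ann_proj (F w)" if eq: "ann_proj z = ann_proj w" for z w
  proof -
    obtain m :: int where m: "fst z = fst w + of_int m" "snd z = snd w"
      using ann_proj_eqD[OF eq] .
    have 1: "fst w + of_int m + snd w = (fst w + snd w) + of_int m" by simp
    have "F z = (fst w + snd w + of_int m, snd (F w))"
      unfolding F_def m 1 gm by simp
    then show ?thesis
      by (simp only: ann_proj_shift) (simp add: F_def)
  qed
  define f where "f = (\<lambda>q. ann_proj (F (SOME w. ann_proj w = q)))"
  have "f (ann_proj z) = ann_proj (F z)" for z
    unfolding f_def by (rule Fp) (rule someI[where x = z], simp)
  moreover have "continuous_on UNIV F"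
  proof -
    have "continuous_on UNIV (\<lambda>z::real\<times>real. d (fst z + snd z))"
      by (rule continuous_on_compose2[OF cont_d]) (auto intro!: continuous_intros)
    then show ?thesis
      unfolding F_def g_def by (auto intro!: continuous_intros)
  qed
  ultimately show ?thesis
    using gen unfolding generates_def is_lift_of_def by blast
qed

end

theory Submission
  imports Defs "HOL-Complex_Analysis.Winding_Numbers" "HOL-Computational_Algebra.Polynomial"
begin

text \<open>
  Orbits of the generated map are the bi-infinite sequences with
  \<open>x (m + 1) - 2 * x m + x (m - 1) = W (x m)\<close>, where \<open>W\<close> is the derivative of the total potential.
  Write \<open>\<epsilon> = n powr (- a / 2)\<close>. Without the bump the recurrence is a discretised pendulum of step
  \<open>\<epsilon>\<close>. The unstable separatrix of its saddle 0 and the stable separatrix of the saddle 1 agree to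
  every finite order in \<open>\<epsilon>\<close>, whereas the bump changes the velocity of an orbit that meets it at
  \<open>\<zeta>\<close> by the derivative of the bump at \<open>\<zeta>\<close>, and for a suitable \<open>\<zeta>\<close> this kick is at least
  \<open>n powr (- s)\<close>, a fixed power of \<open>\<epsilon>\<close>. An orbit that rotates slowly has to arrive at the bump no
  slower than along the unstable separatrix, and it may leave the bump no faster than along the
  stable one. So the kick leaves no room for slow rotation.

  An invariant circle lifts to a curve in the plane, possibly folded, on which the map acts as an
  increasing homeomorphism \<open>G\<close> of the parameter line. The running maximum of the first coordinate
  along this curve turns the orbits on the circle into monotone subsolutions of the recurrence, one through
  each prescribed position \<open>\<zeta>\<close>, and these inherit from \<open>G\<close> the rotation number and the order
  (\<open>invariant_circle_subsolution\<close>). The comparison with the separatrices below is one-sided and applies to subsolutions.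

  To compare with the separatrices one needs them with an error smaller than \<open>n powr (- s)\<close>. They are
  approximated by orbits of the time-\<open>\<epsilon>\<close> map of a field \<open>sin (\<pi> x) * q (sin (\<pi> x)\<^sup>2)\<close> on the unit interval. The
  condition that this map solves the recurrence is an identity between power series in
  \<open>\<eta> = \<epsilon>\<^sup>2\<close> with polynomial coefficients. It can be solved order by order, because the linearised
  equation is \<open>w + t * w' = R\<close>, which is solvable for all polynomials \<open>R\<close>
  (\<open>formal_solution\<close>). Perturbing the solution by \<open>\<mp> \<eta> ^ K\<close> gives the remaining error a sign on the
  left and on the right of the bump (\<open>approximate_separatrices\<close>), so that errors do not accumulate
  however long an orbit stays near a saddle.

  Finally, let a subsolution pass through \<open>\<zeta>\<close>. If it arrived slower than the unstable separatrix, it would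
  lag behind it at all earlier times and never get below 0, which contradicts rotation. After the
  kick it is therefore ahead of the stable separatrix by at least \<open>n powr (- s) / 2\<close>; then it crosses the saddle 1
  and reaches \<open>\<zeta> + 1\<close> in \<open>O (ln n / \<epsilon>)\<close> steps (\<open>no_slow_subsolution\<close>). This is less than
  \<open>1 / \<bar>\<omega>\<bar>\<close>, the number of steps that a rotation by \<open>\<omega>\<close> needs for one turn.
\<close>

section \<open>Lifts of essential curves and of the circle map\<close>

lemma winding_number_annulus_lift:
  fixes \<theta> y :: "real \<Rightarrow> real"
  assumes "continuous_on {0..1} \<theta>" "continuous_on {0..1} y"
  shows "winding_number (\<lambda>t. cis (2 * pi * \<theta> t) * of_real (exp (y t))) 0
    = of_real (\<theta> 1 - \<theta> 0) + of_real (y 1 - y 0) / (2 * of_real pi * \<i>)"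
proof -
  let ?p = "\<lambda>t. Complex (y t) (2 * pi * \<theta> t)"
  have "path ?p"
    unfolding path_def Complex_eq by (intro continuous_intros assms)
  then have "winding_number (exp \<circ> ?p) 0 = (pathfinish ?p - pathstart ?p) / (2 * of_real pi * \<i>)"
    by (rule winding_number_compose_exp)
  moreover have "exp \<circ> ?p = (\<lambda>t. cis (2 * pi * \<theta> t) * of_real (exp (y t)))"
    by (auto simp: fun_eq_iff exp_eq_polar)
  moreover have "(pathfinish ?p - pathstart ?p) / (2 * of_real pi * \<i>) =
      of_real (\<theta> 1 - \<theta> 0) + of_real (y 1 - y 0) / (2 * of_real pi * \<i>)"
    by (simp add: pathfinish_def pathstart_def Complex_eq field_simps)
  ultimately show ?thesis by simp
qed

text \<open>
  Continuity at an integer is the only issue; there the two neighbouring unit intervals, on each of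
  which the extension is a translate of \<open>g\<close>, are glued together.
\<close>

lemma periodic_extension_continuous:
  fixes g :: "real \<Rightarrow> 'a::real_normed_vector"
  assumes g: "continuous_on {0..1} g" and e: "g 1 = g 0 + e"
  shows "continuous_on UNIV (\<lambda>s. g (frac s) + of_int \<lfloor>s\<rfloor> *\<^sub>R e)"
proof -
  let ?h = "\<lambda>s. g (frac s) + of_int \<lfloor>s\<rfloor> *\<^sub>R e"
  have piece: "continuous_on {of_int n..of_int n + 1} ?h" for n :: int
  proof -
    have "continuous_on {of_int n..of_int n + 1} (\<lambda>s. g (s - of_int n) + of_int n *\<^sub>R e)"
      by (intro continuous_intros continuous_on_compose2[OF g]) auto
    moreover have "?h s = g (s - of_int n) + of_int n *\<^sub>R e"
      if "s \<in> {of_int n..of_int n + 1}" for s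
    proof (cases "s = of_int n + 1")
      case True
      have "frac s = 0" "\<lfloor>s\<rfloor> = n + 1" "s - of_int n = 1"
        unfolding True by (simp_all add: frac_def)
      then have "g (frac s) + of_int \<lfloor>s\<rfloor> *\<^sub>R e = g 0 + of_int (n + 1) *\<^sub>R e"
        and "g (s - of_int n) + of_int n *\<^sub>R e = g 1 + of_int n *\<^sub>R e" by (simp_all only:)
      moreover have "g 0 + of_int (n + 1) *\<^sub>R e = g 1 + of_int n *\<^sub>R e"
        unfolding e by (simp add: scaleR_left_distrib)
      ultimately show ?thesis by (simp only:)
    next
      case False
      then have "\<lfloor>s\<rfloor> = n" using that by (auto simp: floor_eq_iff)
      then show ?thesis by (simp add: frac_def)
    qed
    ultimately show ?thesis
      by (metis (no_types, lifting) continuous_on_cong)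
  qed
  have "isCont ?h s" for s
  proof -
    define n where "n = \<lfloor>s\<rfloor>"
    have "continuous_on ({of_int (n-1)..of_int (n-1) + 1} \<union> {of_int n..of_int n + 1}) ?h"
      by (rule continuous_on_closed_Un[OF closed_real_atLeastAtMost closed_real_atLeastAtMost piece piece])
    then have cont: "continuous_on {of_int n - 1<..<of_int n + 1} ?h"
      by (rule continuous_on_subset) auto
    have "of_int n - 1 < s" "s < of_int n + 1"
      unfolding n_def by linarith+
    then have "s \<in> interior {of_int n - 1<..<of_int n + 1}" by (simp add: interior_open)
    then show ?thesis by (rule continuous_on_interior[OF cont])
  qed
  then show ?thesis by (simp add: continuous_at_imp_continuous_on)
qed

lemma ann_proj_mem: "ann_proj z \<in> annulus"
  by (auto simp: ann_proj_def annulus_def)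

lemma continuous_on_ann_proj: "continuous_on S ann_proj"
  unfolding ann_proj_def by (intro continuous_intros)

lemma ann_proj_surj: assumes "q \<in> annulus" obtains z where "q = ann_proj z"
proof -
  have "norm (fst q) = 1" using assms by (auto simp: annulus_def)
  then have c: "cis (Arg (fst q)) = fst q"
    using cis_Arg[of "fst q"] by (cases "fst q = 0") (auto simp: sgn_eq)
  have "2 * pi * (Arg (fst q) / (2 * pi)) = Arg (fst q)" by simp
  then have "ann_proj (Arg (fst q) / (2 * pi), snd q) = (cis (Arg (fst q)), snd q)"
    by (simp only: ann_proj_def fst_conv snd_conv)
  then have "q = ann_proj (Arg (fst q) / (2 * pi), snd q)"
    using c by simp
  then show ?thesis using that by blast
qed

text \<open>
  The universal cover of the annulus unrolls a loop to a curve that advances by its degree. Degree 0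
  would make the loop contractible, and simplicity forces the degree to be \<open>\<plusminus> 1\<close>, because the annulus
  embeds in the punctured plane, where a simple loop winds at most once around the origin. The
  orientation is chosen so that the degree is 1. Only with this degree is the whole preimage of
  the curve a single line.
\<close>

lemma essential_curve_lift:
  assumes "essential_simple_closed_curve C"
  obtains \<gamma> :: "real \<Rightarrow> real \<times> real" where
    "continuous_on UNIV \<gamma>" "inj \<gamma>" "\<And>s. \<gamma> (s + 1) = \<gamma> s + (1, 0)"
    "range \<gamma> = {z. ann_proj z \<in> C}"
proof -
  obtain g where g: "simple_path g" "pathfinish g = pathstart g" "path_image g = C" "C \<subseteq> annulus"
    and ess: "\<not> (\<exists>c. homotopic_loops annulus g (linepath c c))"
    using assms unfolding essential_simple_closed_curve_def by blast
  have gc: "continuous_on {0..1} g"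
    using g(1) by (simp add: simple_path_def path_def)
  have gann: "g t \<in> annulus" if "t \<in> {0..1}" for t
    using g(3,4) that by (auto simp: path_image_def)
  obtain L where L: "continuous_on {0..1} L" "\<And>t. t \<in> {0..1} \<Longrightarrow> fst (g t) = exp (L t)"
  proof (rule continuous_logarithm_on_contractible[of "{0..1::real}" "\<lambda>t. fst (g t)"])
    show "continuous_on {0..1} (\<lambda>t. fst (g t))" by (intro continuous_intros gc)
    show "fst (g t) \<noteq> 0" if "t \<in> {0..1}" for t
      using gann[OF that] by (auto simp: annulus_def)
  qed (auto intro: convex_imp_contractible)
  define y where "y t = snd (g t)" for t
  define \<theta> where "\<theta> t = Im (L t) / (2 * pi)" for t
  have \<theta>c: "continuous_on {0..1} \<theta>" and yc: "continuous_on {0..1} y"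
    unfolding \<theta>_def y_def by (intro continuous_intros L gc; simp)+
  have lift: "ann_proj (\<theta> t, y t) = g t" if t: "t \<in> {0..1}" for t
  proof -
    have "norm (exp (L t)) = 1"
      using gann[OF t] L(2)[OF t] by (auto simp: annulus_def)
    then have "Re (L t) = 0" by simp
    then have "exp (L t) = cis (2 * pi * \<theta> t)"
      by (simp add: exp_eq_polar \<theta>_def)
    then show ?thesis
      using L(2)[OF t] by (simp add: ann_proj_def y_def prod_eq_iff)
  qed
  have g01: "g 1 = g 0" using g(2) by (simp add: pathfinish_def pathstart_def)
  then have y01: "y 1 = y 0" by (simp add: y_def)
  obtain d :: int where d: "\<theta> 1 = \<theta> 0 + of_int d"
    using ann_proj_eqD[of "(\<theta> 1, y 1)" "(\<theta> 0, y 0)"] lift[of 0] lift[of 1] g01 by auto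
  have "d \<in> {-1, 0, 1}"
  proof -
    let ?e = "\<lambda>q::complex \<times> real. fst q * of_real (exp (snd q))"
    have inj: "inj_on ?e annulus"
    proof (rule inj_onI)
      fix p q assume p: "p \<in> annulus" and q: "q \<in> annulus" and e: "?e p = ?e q"
      then have "norm (?e p) = norm (?e q)" by simp
      then have "snd p = snd q"
        using p q by (auto simp: annulus_def norm_mult)
      then show "p = q" using e by (auto simp: prod_eq_iff)
    qed
    have sp: "simple_path (?e \<circ> g)"
      by (rule simple_path_continuous_image[OF g(1)])
        (use inj g in \<open>auto intro!: continuous_intros intro: inj_on_subset\<close>)
    have "winding_number (?e \<circ> g) 0 \<in> {-1, 0, 1}"
    proof (rule simple_closed_path_winding_number_cases[OF sp])
      show "pathfinish (?e \<circ> g) = pathstart (?e \<circ> g)"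
        using g01 by (simp add: pathfinish_def pathstart_def)
      show "0 \<notin> path_image (?e \<circ> g)"
        using gann by (force simp: path_image_def annulus_def)
    qed
    moreover have "winding_number (?e \<circ> g) 0 =
        winding_number (\<lambda>t. cis (2 * pi * \<theta> t) * of_real (exp (y t))) 0"
    proof (rule winding_number_cong)
      fix t :: real assume "0 \<le> t" "t \<le> 1"
      then have "g t = ann_proj (\<theta> t, y t)" using lift[of t] by simp
      then show "(?e \<circ> g) t = cis (2 * pi * \<theta> t) * of_real (exp (y t))"
        by (simp add: ann_proj_def)
    qed
    moreover have "\<dots> = of_int d"
      by (simp only: winding_number_annulus_lift[OF \<theta>c yc] d y01) simp
    ultimately have "(of_int d :: complex) \<in> {of_int (-1), of_int 0, of_int 1}" by simp
    then show ?thesis by (simp only: insert_iff of_int_eq_iff) auto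
  qed
  moreover have "d \<noteq> 0"
  proof
    assume "d = 0"
    let ?l = "\<lambda>t. (\<theta> t, y t)" and ?p = "(\<theta> 0, y 0)"
    have "homotopic_loops UNIV ?l (linepath ?p ?p)"
      by (rule homotopic_loops_linear)
        (use \<open>d = 0\<close> d y01 in \<open>auto simp: path_def pathfinish_def pathstart_def intro!: continuous_intros \<theta>c yc\<close>)
    then have "homotopic_loops annulus (ann_proj \<circ> ?l) (ann_proj \<circ> linepath ?p ?p)"
      by (rule homotopic_loops_continuous_image) (auto simp: continuous_on_ann_proj ann_proj_mem)
    moreover have "ann_proj \<circ> linepath ?p ?p = linepath (ann_proj ?p) (ann_proj ?p)"
      by (auto simp: fun_eq_iff linepath_def algebra_simps simp flip: scaleR_left_distrib)
    moreover have "homotopic_loops annulus g (ann_proj \<circ> ?l)"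
      by (rule homotopic_loops_eq) (use g lift gc in \<open>auto simp: path_def pathfinish_def pathstart_def\<close>)
    ultimately show False
      using ess homotopic_loops_trans by metis
  qed
  ultimately have d1: "d = 1 \<or> d = -1" by auto
  \<comment> \<open>Traverse the curve backwards if its degree is negative.\<close>
  define k where "k t = (if d = 1 then (\<theta> t, y t) else (\<theta> (1 - t), y (1 - t)))" for t
  define r :: "real \<Rightarrow> real" where "r t = (if d = 1 then t else 1 - t)" for t
  have kc: "continuous_on {0..1} k"
  proof -
    have "continuous_on {0..1} (\<lambda>t. (\<theta> (1 - t), y (1 - t)))"
      by (intro continuous_intros continuous_on_compose2[OF \<theta>c] continuous_on_compose2[OF yc]) auto
    moreover have "continuous_on {0..1} (\<lambda>t. (\<theta> t, y t))"
      by (intro continuous_intros \<theta>c yc)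
    ultimately show ?thesis unfolding k_def by (cases "d = 1") auto
  qed
  have k1: "k 1 = k 0 + (1, 0)"
    using d1 d y01 by (auto simp: k_def)
  have klift: "ann_proj (k t) = g (r t)" if "t \<in> {0..1}" for t
    using lift[of t] lift[of "1 - t"] that by (auto simp: k_def r_def)
  define \<gamma> where "\<gamma> s = k (frac s) + of_int \<lfloor>s\<rfloor> *\<^sub>R (1, 0)" for s
  have cont: "continuous_on UNIV \<gamma>"
    unfolding \<gamma>_def by (rule periodic_extension_continuous[OF kc k1])
  have per: "\<gamma> (s + 1) = \<gamma> s + (1, 0)" for s
    by (simp add: \<gamma>_def frac_def algebra_simps)
  have peri: "\<gamma> (s + of_int m) = \<gamma> s + (of_int m, 0)" for s and m :: int
    by (simp add: \<gamma>_def frac_def algebra_simps)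
  have frac01: "frac s \<in> {0..1}" for s :: real
    using frac_lt_1[of s] by (simp add: less_imp_le)
  have proj: "ann_proj (\<gamma> s) = g (r (frac s))" for s
    using ann_proj_shift[of "fst (k (frac s))" "\<lfloor>s\<rfloor>" "snd (k (frac s))"] klift[OF frac01[of s]]
    by (simp add: \<gamma>_def plus_prod_def)
  have "inj \<gamma>"
  proof (rule injI)
    fix s t assume eq: "\<gamma> s = \<gamma> t"
    then have ge: "g (r (frac s)) = g (r (frac t))" using proj by metis
    have "r (frac s) \<in> {0..1}" "r (frac t) \<in> {0..1}"
      using frac01[of s] frac01[of t] by (auto simp: r_def)
    then have "r (frac s) = r (frac t) \<or> r (frac s) = 0 \<and> r (frac t) = 1 \<or> r (frac s) = 1 \<and> r (frac t) = 0"
      using g(1) ge unfolding simple_path_def loop_free_def by blast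
    then have fr: "frac s = frac t"
      using frac_lt_1[of s] frac_lt_1[of t] by (auto simp: r_def split: if_splits)
    then have "real_of_int \<lfloor>s\<rfloor> = real_of_int \<lfloor>t\<rfloor>"
      using eq by (simp add: \<gamma>_def)
    then show "s = t" using fr by (simp add: frac_def)
  qed
  moreover have "range \<gamma> = {z. ann_proj z \<in> C}"
  proof (intro equalityI subsetI)
    fix z assume "z \<in> range \<gamma>"
    then obtain s where "z = \<gamma> s" by blast
    then show "z \<in> {z. ann_proj z \<in> C}"
      using proj[of s] frac01[of s] g(3) by (auto simp: path_image_def r_def)
  next
    fix z assume "z \<in> {z. ann_proj z \<in> C}"
    then obtain t where t: "t \<in> {0..1}" "ann_proj z = g t"
      using g(3) by (auto simp: path_image_def)
    have "ann_proj z = ann_proj (k (r t))"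
      using klift[of "r t"] t by (auto simp: r_def)
    then obtain m :: int where m: "fst z = fst (k (r t)) + of_int m" "snd z = snd (k (r t))"
      using ann_proj_eqD by blast
    have "\<gamma> (r t) = k (r t)"
    proof (cases "r t = 1")
      case True
      have "frac (1::real) = 0" "\<lfloor>1::real\<rfloor> = 1" by (simp_all add: frac_def)
      then show ?thesis using k1 True by (simp add: \<gamma>_def)
    next
      case False
      then have "\<lfloor>r t\<rfloor> = 0" using t by (auto simp: r_def floor_eq_iff)
      then show ?thesis by (simp add: \<gamma>_def frac_def zero_prod_def)
    qed
    then have "z = \<gamma> (r t + of_int m)"
      using peri[of "r t" m] m by (auto simp: prod_eq_iff)
    then show "z \<in> range \<gamma>" by blast
  qed
  ultimately show ?thesis using that cont per by blast
qed

lemma periodic_shift_int: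
  fixes p :: "real \<Rightarrow> 'a"
  assumes per: "\<And>x. p (x + 1) = p x"
  shows "p (x + of_int m) = p x"
proof -
  have nat_case: "p (x + of_nat j) = p x" for x and j :: nat
    by (induction j) (use per in \<open>auto simp: add.assoc[symmetric] add.commute[of 1]\<close>)
  show ?thesis
    using nat_case[of x "nat m"] nat_case[of "x + of_int m" "nat (- m)"]
    by (cases "m \<ge> 0") auto
qed

lemma periodic_continuous_bounded:
  fixes p :: "real \<Rightarrow> real"
  assumes c: "continuous_on UNIV p" and per: "\<And>x. p (x + 1) = p x"
  obtains B where "B \<ge> 0" "\<And>x. \<bar>p x\<bar> \<le> B"
proof -
  have "compact (p ` {0..1})"
    by (intro compact_continuous_image continuous_on_subset[OF c]) auto
  then have "bounded (p ` {0..1})" by (rule compact_imp_bounded)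
  then obtain B where "\<forall>y\<in>p ` {0..1}. norm y \<le> B" unfolding bounded_iff ..
  then have B: "\<bar>p x\<bar> \<le> B" if "x \<in> {0..1}" for x using that by auto
  have "\<bar>p x\<bar> \<le> B" for x
  proof -
    have "p x = p (frac x)" using periodic_shift_int[of p "frac x" "\<lfloor>x\<rfloor>"] per by (simp add: frac_def)
    then show ?thesis using B[of "frac x"] frac_lt_1[of x] by (simp add: less_imp_le)
  qed
  moreover have "B \<ge> 0" using B[of 0] by simp
  ultimately show ?thesis using that by blast
qed

lemma funpow_commutes_add1:
  fixes H :: "real \<Rightarrow> real"
  assumes "\<And>s. H (s + 1) = H s + 1"
  shows "(H ^^ m) (s + real j) = (H ^^ m) s + real j"
proof -
  have j: "H (s + real j) = H s + real j" for s
    by (induction j) (use assms in \<open>auto simp: add.assoc[symmetric] add.commute[of 1]\<close>)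
  show ?thesis by (induction m) (use j in auto)
qed

text \<open>
  The lift \<open>\<gamma>\<close> is an injective proper curve onto the preimage of the circle, and \<open>F\<close> maps this
  preimage bijectively to itself. So \<open>F\<close> is conjugate on it to a homeomorphism \<open>G\<close> of the line,
  which is increasing since it commutes with the translation by 1. The parameter and the first
  coordinate differ by a bounded amount, hence \<open>G\<close> has the same rotation number as the orbits.
\<close>

lemma circle_dynamics_lift:
  fixes F :: "real \<times> real \<Rightarrow> real \<times> real"
  assumes F: "\<And>x y. F (x, y) = (x + y, y + W (x + y))" and Wper: "\<And>x. W (x + 1) = W x"
    and lift: "is_lift_of F f" and inv: "invariant_circle f C"
    and rot: "has_rotation_number F C \<omega>"
  obtains \<gamma> :: "real \<Rightarrow> real \<times> real" and G :: "real \<Rightarrow> real" and B :: real where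
    "continuous_on UNIV (\<lambda>s. fst (\<gamma> s))" "\<And>s. fst (\<gamma> (s + 1)) = fst (\<gamma> s) + 1"
    "\<And>s. \<bar>fst (\<gamma> s) - s\<bar> \<le> B" "\<And>s. \<gamma> (G s) = F (\<gamma> s)"
    "strict_mono G" "bij G" "\<And>s. G (s + 1) = G s + 1"
    "\<And>s. (\<lambda>m. ((G ^^ m) s - s) / real m) \<longlonglongrightarrow> \<omega>"
proof -
  have contF: "continuous_on UNIV F" and proj: "\<And>z. f (ann_proj z) = ann_proj (F z)"
    using lift unfolding is_lift_of_def by auto
  obtain \<gamma> :: "real \<Rightarrow> real \<times> real" where \<gamma>: "continuous_on UNIV \<gamma>" "inj \<gamma>" "\<And>s. \<gamma> (s + 1) = \<gamma> s + (1, 0)"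
    "range \<gamma> = {z. ann_proj z \<in> C}"
    using essential_curve_lift inv unfolding invariant_circle_def by blast
  have fC: "f ` C = C" and Cann: "C \<subseteq> annulus"
    using inv unfolding invariant_circle_def essential_simple_closed_curve_def by auto
  have Fshift: "F (x + of_int m, y) = F (x, y) + (of_int m, 0)" for x y and m :: int
    using periodic_shift_int[of W "x + y" m] Wper by (simp add: F algebra_simps)
  have injF: "z = w" if "F z = F w" for z w
    using that by (cases z; cases w) (auto simp: F)
  define G where "G s = inv \<gamma> (F (\<gamma> s))" for s
  have "F (\<gamma> s) \<in> range \<gamma>" for s
  proof -
    have "ann_proj (\<gamma> s) \<in> C" using \<gamma>(4) by blast
    then have "ann_proj (F (\<gamma> s)) \<in> C" using proj fC by (metis imageI)
    then show ?thesis using \<gamma>(4) by blast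
  qed
  then have G: "\<gamma> (G s) = F (\<gamma> s)" for s
    unfolding G_def by (simp add: f_inv_into_f)
  have injG: "inj G"
    by (rule injI) (metis G injF \<gamma>(2) injD)
  have surjG: "surj G"
    unfolding surj_def
  proof
    fix t
    have "ann_proj (\<gamma> t) \<in> C" using \<gamma>(4) by blast
    then obtain q where q: "q \<in> C" "f q = ann_proj (\<gamma> t)" using fC by (metis imageE)
    obtain w where w: "q = ann_proj w" using q Cann ann_proj_surj by blast
    then have "ann_proj (F w) = ann_proj (\<gamma> t)" using q proj by simp
    then obtain m :: int where m: "fst (F w) = fst (\<gamma> t) + of_int m" "snd (F w) = snd (\<gamma> t)"
      by (rule ann_proj_eqD)
    let ?w = "(fst w + of_int (- m), snd w)"
    have "F ?w = F w + (of_int (- m), 0)" by (simp only: Fshift) simp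
    then have Fw: "F ?w = \<gamma> t" using m by (simp add: prod_eq_iff)
    have "ann_proj ?w = q" using w by (simp only: ann_proj_shift) simp
    then have "?w \<in> range \<gamma>" unfolding \<gamma>(4) using q by simp
    then obtain s where "\<gamma> s = ?w" by (metis imageE)
    then have "\<gamma> (G s) = \<gamma> t" using G Fw by simp
    then show "\<exists>s. t = G s" using \<gamma>(2) by (metis injD)
  qed
  have G1: "G (s + 1) = G s + 1" for s
  proof -
    have "\<gamma> (G (s + 1)) = F (\<gamma> s + (1, 0))" using G \<gamma>(3) by simp
    also have "\<dots> = F (\<gamma> s) + (1, 0)"
      using Fshift[of "fst (\<gamma> s)" 1 "snd (\<gamma> s)"] by (simp add: plus_prod_def)
    also have "\<dots> = \<gamma> (G s + 1)" using G \<gamma>(3) by simp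
    finally show ?thesis using \<gamma>(2) by (blast dest: injD)
  qed
  have xcont: "continuous_on UNIV (\<lambda>s. fst (\<gamma> s))" by (intro continuous_intros \<gamma>)
  obtain B where B: "B \<ge> 0" "\<And>s. \<bar>fst (\<gamma> s) - s\<bar> \<le> B"
    by (rule periodic_continuous_bounded[of "\<lambda>s. fst (\<gamma> s) - s"])
      (use \<gamma>(3) xcont in \<open>auto intro!: continuous_intros\<close>)
  have contG: "isCont G s" for s
  proof -
    define I where "I = {s - 1..s + 1}"
    have FI: "continuous_on I (\<lambda>t. F (\<gamma> t))"
      by (intro continuous_on_compose2[OF contF] continuous_on_subset[OF \<gamma>(1)]) auto
    have "compact ((\<lambda>t. fst (F (\<gamma> t))) ` I)"
      by (intro compact_continuous_image continuous_intros FI) (simp add: I_def)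
    then have "bounded ((\<lambda>t. fst (F (\<gamma> t))) ` I)" by (rule compact_imp_bounded)
    then obtain R where "\<forall>y\<in>(\<lambda>t. fst (F (\<gamma> t))) ` I. norm y \<le> R" unfolding bounded_iff ..
    then have R: "\<bar>fst (F (\<gamma> t))\<bar> \<le> R" if "t \<in> I" for t using that by auto
    define J where "J = {- R - B..R + B}"
    have "G t \<in> J" if "t \<in> I" for t
      using R[OF that] B(2)[of "G t"] unfolding G J_def by (auto simp: abs_le_iff)
    then have sub: "(\<lambda>t. F (\<gamma> t)) ` I \<subseteq> \<gamma> ` J"
      using G by (metis image_subsetI image_eqI)
    \<comment> \<open>The inverse of an injective curve is continuous on the image of a compact interval.\<close>
    have "continuous_on (\<gamma> ` J) (inv \<gamma>)"
      by (rule continuous_on_inv)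
        (use \<gamma> in \<open>auto simp: J_def intro: continuous_on_subset inv_f_f\<close>)
    then have "continuous_on I G"
      unfolding G_def using FI sub by (rule continuous_on_compose2)
    moreover have "s \<in> interior I" by (simp add: I_def)
    ultimately show ?thesis by (rule continuous_on_interior)
  qed
  have monoG: "strict_mono G"
  proof (rule strict_monoI)
    fix s t :: real assume st: "s < t"
    obtain j :: nat where j: "t < s + real j"
      using reals_Archimedean2[of "t - s"] by (auto simp: algebra_simps)
    have "(G s < G t \<and> G t < G (s + real j)) \<or> (G (s + real j) < G t \<and> G t < G s)"
      by (rule continuous_inj_imp_mono[OF st j])
        (use contG injG in \<open>auto intro: continuous_at_imp_continuous_on inj_on_subset\<close>)
    moreover have "G (s + real j) = G s + real j"
      using funpow_commutes_add1[of G 1 s j] G1 by simp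
    ultimately show "G s < G t" by auto
  qed
  have Gm: "\<gamma> ((G ^^ m) s) = (F ^^ m) (\<gamma> s)" for m s
    by (induction m) (use G in auto)
  have rotG: "(\<lambda>m. ((G ^^ m) s - s) / real m) \<longlonglongrightarrow> \<omega>" for s
  proof -
    have "ann_proj (\<gamma> s) \<in> C" using \<gamma>(4) by blast
    then have lim: "(\<lambda>m. (fst (\<gamma> ((G ^^ m) s)) - fst (\<gamma> s)) / real m) \<longlonglongrightarrow> \<omega>"
      using rot unfolding has_rotation_number_def Gm by blast
    have "(\<lambda>m. (2 * B) / real m) \<longlonglongrightarrow> 0"
      by (rule lim_const_over_n)
    then have "(\<lambda>m. ((G ^^ m) s - s) / real m - (fst (\<gamma> ((G ^^ m) s)) - fst (\<gamma> s)) / real m) \<longlonglongrightarrow> 0"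
    proof (rule Lim_null_comparison[rotated], intro always_eventually allI)
      fix m
      have "\<bar>((G ^^ m) s - s) - (fst (\<gamma> ((G ^^ m) s)) - fst (\<gamma> s))\<bar> \<le> 2 * B"
        using B(2)[of s] B(2)[of "(G ^^ m) s"] by linarith
      then show "norm (((G ^^ m) s - s) / real m - (fst (\<gamma> ((G ^^ m) s)) - fst (\<gamma> s)) / real m) \<le> 2 * B / real m"
        by (simp add: diff_divide_distrib[symmetric] divide_right_mono)
    qed
    from tendsto_add[OF this lim] show ?thesis by simp
  qed
  have "bij G" using injG surjG by (rule bijI)
  then show ?thesis
    using that[of \<gamma> B G] xcont \<gamma>(3) B G monoG G1 rotG by auto
qed

section \<open>From an invariant circle to an ordered subsolution\<close>

definition int_orbit :: "('a \<Rightarrow> 'a) \<Rightarrow> 'a \<Rightarrow> int \<Rightarrow> 'a" where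
  "int_orbit H s m = (if m \<ge> 0 then (H ^^ nat m) s else (inv H ^^ nat (- m)) s)"

lemma int_orbit_step:
  assumes "bij H"
  shows "int_orbit H s (m + 1) = H (int_orbit H s m)"
proof (cases "m \<ge> 0")
  case True
  then have "nat (m + 1) = Suc (nat m)" by simp
  then show ?thesis using True by (simp add: int_orbit_def)
next
  case False
  then have "nat (- m) = Suc (nat (- (m + 1)))" by simp
  then have "int_orbit H s m = inv H (int_orbit H s (m + 1))"
    using False by (cases "m = -1") (auto simp: int_orbit_def)
  then show ?thesis using assms by (simp add: bij_is_surj surj_f_inv_f)
qed

text \<open>
  The supremum of a family of solutions is a subsolution: where the supremum is attained the
  recurrence holds with equality, and the neighbouring terms can only be larger. Taking the
  supremum over all parameters up to \<open>s\<close> respects the dynamics because \<open>H\<close> is increasing, and it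
  gives a function that is monotone in \<open>s\<close>, even if the curve folds over itself. The position \<open>\<zeta>\<close>
  is attained at the first parameter where the curve reaches it.
\<close>

lemma monotone_subsolution:
  fixes x H :: "real \<Rightarrow> real"
  assumes xc: "continuous_on UNIV x" and x1: "\<And>s. x (s + 1) = x s + 1"
    and xB: "\<And>s. \<bar>x s - s\<bar> \<le> B"
    and H: "strict_mono H" "bij H" "\<And>s. H (s + 1) = H s + 1" "\<And>s. s < H s"
    and eq: "\<And>s. x (H s) + x (inv H s) - 2 * x s = W (x s)"
    and slow: "\<And>T s. real T * r < 1 \<Longrightarrow> (H ^^ T) s < s + 1"
  obtains a :: "int \<Rightarrow> real" where "a 0 = \<zeta>" "mono a"
    "\<And>m. a (m + 1) + a (m - 1) - 2 * a m \<ge> W (a m)" "\<And>L. \<exists>m. a m < L"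
    "\<And>T. real T * r < 1 \<Longrightarrow> a (int T) \<le> \<zeta> + 1"
proof -
  define \<alpha> where "\<alpha> s = (SUP t\<in>{..s}. x t)" for s
  have att: "\<exists>t\<le>s. \<alpha> s = x t \<and> (\<forall>t'\<le>s. x t' \<le> x t)" for s
  proof -
    have B0: "B \<ge> 0" using xB[of 0] by linarith
    obtain t where t: "t \<in> {s - 2 * B..s}" "\<And>t'. t' \<in> {s - 2 * B..s} \<Longrightarrow> x t' \<le> x t"
      using continuous_attains_sup[of "{s - 2 * B..s}" x] continuous_on_subset[OF xc subset_UNIV] B0
      by auto
    have "x t' \<le> x t" if "t' \<le> s" for t'
    proof (cases "t' \<ge> s - 2 * B")
      case False
      then have "x t' \<le> x s" using xB[of t'] xB[of s] by linarith
      moreover have "x s \<le> x t" using t B0 by auto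
      ultimately show ?thesis by simp
    qed (use t that in auto)
    moreover from this have "\<alpha> s = x t"
      unfolding \<alpha>_def by (intro cSup_eq_maximum) (use t in auto)
    ultimately show ?thesis using t by auto
  qed
  have \<alpha>ge: "x t \<le> \<alpha> s" if "t \<le> s" for t s
    using att[of s] that by force
  have \<alpha>mono: "\<alpha> s \<le> \<alpha> t" if "s \<le> t" for s t
    using att[of s] \<alpha>ge[of _ t] that by (metis order_trans)
  have \<alpha>1: "\<alpha> (s + 1) = \<alpha> s + 1" for s
  proof (rule antisym)
    obtain t where t: "t \<le> s + 1" "\<alpha> (s + 1) = x t" using att by blast
    then show "\<alpha> (s + 1) \<le> \<alpha> s + 1" using \<alpha>ge[of "t - 1" s] x1[of "t - 1"] by simp
    obtain t where t: "t \<le> s" "\<alpha> s = x t" using att by blast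
    then show "\<alpha> s + 1 \<le> \<alpha> (s + 1)" using \<alpha>ge[of "t + 1" "s + 1"] x1[of t] by simp
  qed
  have \<alpha>B: "\<alpha> s \<le> s + B" for s
  proof -
    obtain t where t: "t \<le> s" "\<alpha> s = x t" using att by blast
    then show ?thesis using xB[of t] by linarith
  qed
  have iH: "H (inv H s) = s" "inv H (H s) = s" for s
    using H(2) by (simp_all add: bij_is_surj surj_f_inv_f bij_is_inj)
  have iHmono: "inv H s \<le> inv H t" if "s \<le> t" for s t
    using that iH H(1) by (metis strict_mono_less_eq)
  have sub: "\<alpha> (H s) + \<alpha> (inv H s) - 2 * \<alpha> s \<ge> W (\<alpha> s)" for s
  proof -
    obtain t where t: "t \<le> s" "\<alpha> s = x t" using att by blast
    then have "x (H t) \<le> \<alpha> (H s)" "x (inv H t) \<le> \<alpha> (inv H s)"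
      using iHmono H(1) by (auto intro!: \<alpha>ge simp: strict_mono_less_eq)
    then show ?thesis using eq[of t] t by simp
  qed
  obtain s0 where s0: "\<alpha> s0 = \<zeta>"
  proof -
    let ?S = "{t. x t \<ge> \<zeta>}"
    have "closed ?S" by (intro closed_Collect_le continuous_intros xc)
    moreover have "\<zeta> + B \<in> ?S" using xB[of "\<zeta> + B"] by auto
    moreover have bdd: "bdd_below ?S"
    proof (rule bdd_belowI)
      fix t assume "t \<in> ?S" then show "\<zeta> - B \<le> t" using xB[of t] by auto
    qed
    \<comment> \<open>The first parameter at which the curve is at least at \<open>\<zeta>\<close>.\<close>
    ultimately have m: "Inf ?S \<in> ?S" by (intro closed_contains_Inf) auto
    have low: "x t < \<zeta>" if "t < Inf ?S" for t
      using that cInf_lower[OF _ bdd, of t] by force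
    have "x (Inf ?S) \<le> \<zeta>"
    proof (rule ccontr)
      assume "\<not> ?thesis"
      then have gt: "\<zeta> < x (Inf ?S)" by simp
      let ?l = "\<zeta> - B - 1"
      have l: "x ?l < \<zeta>" using xB[of ?l] by linarith
      have "?l \<le> Inf ?S" using l m low xB[of "Inf ?S"] gt by linarith
      then obtain t where "?l \<le> t" "t \<le> Inf ?S" "x t = \<zeta>"
        using IVT'[of x ?l \<zeta> "Inf ?S"] l gt continuous_on_subset[OF xc] by auto
      then show False using low[of t] gt by (cases "t = Inf ?S") auto
    qed
    then have e: "x (Inf ?S) = \<zeta>" using m by simp
    obtain t where "t \<le> Inf ?S" "\<alpha> (Inf ?S) = x t" using att by blast
    then have "\<alpha> (Inf ?S) \<le> \<zeta>" using low[of t] e by (cases "t = Inf ?S") auto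
    moreover have "\<alpha> (Inf ?S) \<ge> \<zeta>" using \<alpha>ge[of "Inf ?S" "Inf ?S"] e by simp
    ultimately show ?thesis using that by force
  qed
  define orb where "orb = int_orbit H s0"
  have step: "orb (m + 1) = H (orb m)" for m
    unfolding orb_def by (rule int_orbit_step[OF H(2)])
  have prev: "orb (m - 1) = inv H (orb m)" for m
    using step[of "m - 1"] iH by simp
  have omono: "mono orb"
  proof (rule monoI)
    fix m n :: int assume "m \<le> n"
    then show "orb m \<le> orb n"
      by (induction n rule: int_ge_induct) (use step H(4) in \<open>auto intro: order_trans[OF _ less_imp_le]\<close>)
  qed
  \<comment> \<open>A lower bound would make the infimum \<open>p\<close> of the orbit satisfy \<open>H p \<le> p\<close>.\<close>
  have unb: "\<exists>m. orb m < L" for L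
  proof (rule ccontr)
    assume "\<not> ?thesis"
    then have L: "\<And>m. orb m \<ge> L" by (meson not_le)
    then have bdd: "bdd_below (range orb)" by (intro bdd_belowI[of _ L]) auto
    define p where "p = Inf (range orb)"
    obtain m where "orb m < H p"
      using cInf_lessD[of "range orb" "H p"] H(4)[of p] unfolding p_def by auto
    then have "H (orb (m - 1)) < H p" using step[of "m - 1"] by simp
    then have "orb (m - 1) < p" using H(1) by (simp add: strict_mono_less)
    moreover have "p \<le> orb (m - 1)" unfolding p_def by (intro cInf_lower bdd) auto
    ultimately show False by simp
  qed
  show ?thesis
  proof (rule that[of "\<lambda>m. \<alpha> (orb m)"])
    show "\<alpha> (orb 0) = \<zeta>" using s0 by (simp add: orb_def int_orbit_def)
    show "mono (\<lambda>m. \<alpha> (orb m))" using omono \<alpha>mono by (auto simp: mono_def)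
    show "\<alpha> (orb (m + 1)) + \<alpha> (orb (m - 1)) - 2 * \<alpha> (orb m) \<ge> W (\<alpha> (orb m))" for m
      using sub[of "orb m"] by (simp add: step prev)
    show "\<exists>m. \<alpha> (orb m) < L" for L
    proof -
      obtain m where "orb m < L - B" using unb by blast
      then show ?thesis using \<alpha>B[of "orb m"] by (intro exI[of _ m]) simp
    qed
    show "\<alpha> (orb (int T)) \<le> \<zeta> + 1" if "real T * r < 1" for T
    proof -
      have "orb (int T) \<le> s0 + 1"
        using slow[OF that, of s0] by (simp add: orb_def int_orbit_def)
      then show ?thesis using \<alpha>mono \<alpha>1[of s0] s0 by fastforce
    qed
  qed
qed

lemma funpow_ge_iterate:
  fixes G :: "real \<Rightarrow> real"
  assumes "mono G" "\<And>s. G (s + 1) = G s + 1" "(G ^^ T) s \<ge> s + c" "c = 1 \<or> c = 0 \<or> c = -1"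
  shows "(G ^^ (T * j)) s \<ge> s + c * real j"
proof (induction j)
  case (Suc j)
  have mono: "mono (G ^^ m)" for m using assms(1) by (rule mono_pow)
  have shift: "(G ^^ m) (t + c * real j) = (G ^^ m) t + c * real j" for m t
    using funpow_commutes_add1[of G m t j] funpow_commutes_add1[of G m "t - real j" j] assms(2,4)
    by auto
  have "s + c * real (Suc j) \<le> (G ^^ T) s + c * real j"
    using assms(3) by (simp add: algebra_simps)
  also have "\<dots> = (G ^^ T) (s + c * real j)" using shift by simp
  also have "\<dots> \<le> (G ^^ T) ((G ^^ (T * j)) s)" using mono Suc by (rule monoD)
  also have "\<dots> = (G ^^ (T * Suc j)) s" by (simp add: funpow_add algebra_simps)
  finally show ?case .
qed simp

lemma funpow_le_iterate:
  fixes G :: "real \<Rightarrow> real"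
  assumes "mono G" "\<And>s. G (s + 1) = G s + 1" "(G ^^ T) s \<le> s + c" "c = 1 \<or> c = 0 \<or> c = -1"
  shows "(G ^^ (T * j)) s \<le> s + c * real j"
proof (induction j)
  case (Suc j)
  have mono: "mono (G ^^ m)" for m using assms(1) by (rule mono_pow)
  have shift: "(G ^^ m) (t + c * real j) = (G ^^ m) t + c * real j" for m t
    using funpow_commutes_add1[of G m t j] funpow_commutes_add1[of G m "t - real j" j] assms(2,4)
    by auto
  have "(G ^^ (T * Suc j)) s = (G ^^ T) ((G ^^ (T * j)) s)" by (simp add: funpow_add algebra_simps)
  also have "\<dots> \<le> (G ^^ T) (s + c * real j)" using mono Suc by (rule monoD)
  also have "\<dots> = (G ^^ T) s + c * real j" using shift by simp
  also have "\<dots> \<le> s + c * real (Suc j)" using assms(3) by (simp add: algebra_simps)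
  finally show ?case .
qed simp

text \<open>
  A displacement by \<open>c\<close> in \<open>T\<close> steps at a single point already bounds the rotation number, since it
  can be iterated along the orbit of that point. It matters that \<open>c\<close> is an integer, because \<open>G\<close>
  commutes with integral translations only.
\<close>

lemma rotation_number_bounds:
  fixes G :: "real \<Rightarrow> real"
  assumes m: "mono G" and one: "\<And>s. G (s + 1) = G s + 1"
    and rot: "(\<lambda>m. ((G ^^ m) s - s) / real m) \<longlonglongrightarrow> \<omega>" and T: "T > 0"
    and c: "c = 1 \<or> c = 0 \<or> c = -1"
  shows "(G ^^ T) s \<ge> s + c \<Longrightarrow> \<omega> \<ge> c / real T" "(G ^^ T) s \<le> s + c \<Longrightarrow> \<omega> \<le> c / real T"
proof -
  have lim: "(\<lambda>j. ((G ^^ (T * Suc j)) s - s) / real (T * Suc j)) \<longlonglongrightarrow> \<omega>"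
    by (rule filterlim_compose[OF rot]) (intro filterlim_subseq strict_monoI, use T in simp)
  have e: "c / real T = c * real (Suc j) / real (T * Suc j)" for j
    by (simp only: of_nat_mult nonzero_mult_divide_mult_cancel_right[OF of_nat_neq_0])
  show "\<omega> \<ge> c / real T" if "(G ^^ T) s \<ge> s + c"
  proof (rule LIMSEQ_le_const[OF lim], intro exI allI impI)
    fix j
    show "c / real T \<le> ((G ^^ (T * Suc j)) s - s) / real (T * Suc j)"
      unfolding e[of j] using funpow_ge_iterate[OF m one that c, of "Suc j"] by (intro divide_right_mono) auto
  qed
  show "\<omega> \<le> c / real T" if "(G ^^ T) s \<le> s + c"
  proof (rule LIMSEQ_le_const2[OF lim], intro exI allI impI)
    fix j
    show "c / real T \<ge> ((G ^^ (T * Suc j)) s - s) / real (T * Suc j)"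
      unfolding e[of j] using funpow_le_iterate[OF m one that c, of "Suc j"] by (intro divide_right_mono) auto
  qed
qed

text \<open>
  For \<open>\<omega> > 0\<close> the lifted dynamics moves every parameter forward. For \<open>\<omega> < 0\<close> the inverse dynamics
  does, and it generates the same sequences read backwards, which satisfy the same recurrence.
  The last property of the sequence expresses slowness: one turn takes at least
  \<open>1 / \<bar>\<omega>\<bar>\<close> steps.
\<close>

lemma invariant_circle_subsolution:
  fixes F :: "real \<times> real \<Rightarrow> real \<times> real"
  assumes F: "\<And>x y. F (x, y) = (x + y, y + W (x + y))" and Wper: "\<And>x. W (x + 1) = W x"
    and lift: "is_lift_of F f" and inv: "invariant_circle f C"
    and rot: "has_rotation_number F C \<omega>" and \<omega>0: "\<omega> \<noteq> 0"
  obtains a :: "int \<Rightarrow> real" where "a 0 = \<zeta>" "mono a"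
    "\<And>m. a (m + 1) + a (m - 1) - 2 * a m \<ge> W (a m)" "\<And>L. \<exists>m. a m < L"
    "\<And>T. real T * \<bar>\<omega>\<bar> < 1 \<Longrightarrow> a (int T) \<le> \<zeta> + 1"
proof -
  obtain \<gamma> :: "real \<Rightarrow> real \<times> real" and G :: "real \<Rightarrow> real" and B :: real where \<gamma>: "continuous_on UNIV (\<lambda>s. fst (\<gamma> s))" "\<And>s. fst (\<gamma> (s + 1)) = fst (\<gamma> s) + 1"
      "\<And>s. \<bar>fst (\<gamma> s) - s\<bar> \<le> B" and G: "\<And>s. \<gamma> (G s) = F (\<gamma> s)"
      "strict_mono G" "bij G" "\<And>s. G (s + 1) = G s + 1"
    and rotG: "\<And>s. (\<lambda>m. ((G ^^ m) s - s) / real m) \<longlonglongrightarrow> \<omega>"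
    by (rule circle_dynamics_lift[OF F Wper lift inv rot]) (rule that; assumption)
  have mG: "mono G" using G(2) by (rule strict_mono_mono)
  have iG: "G (inv G s) = s" "inv G (G s) = s" for s
    using G(3) by (simp_all add: bij_is_surj surj_f_inv_f bij_is_inj)
  have eq: "fst (\<gamma> (G s)) + fst (\<gamma> (inv G s)) - 2 * fst (\<gamma> s) = W (fst (\<gamma> s))" for s
  proof -
    obtain x y where xy: "\<gamma> s = (x, y)" by (cases "\<gamma> s")
    obtain x0 y0 where xy0: "\<gamma> (inv G s) = (x0, y0)" by (cases "\<gamma> (inv G s)")
    have "(x, y) = F (x0, y0)"
      using G(1)[of "inv G s"] by (simp only: iG(1) xy xy0)
    then have "x = x0 + y0" "y = y0 + W x" by (simp_all add: F)
    moreover have e: "fst (\<gamma> (G s)) = x + y" by (simp add: G(1) xy F)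
    moreover have e': "fst (\<gamma> s) = x" "fst (\<gamma> (inv G s)) = x0" by (simp_all add: xy xy0)
    ultimately show ?thesis unfolding e e' by linarith
  qed
  note bnd = rotation_number_bounds[OF mG G(4) rotG]
  show ?thesis
  proof (cases "\<omega> > 0")
    case True
    have pos: "s < G s" for s
    proof -
      have "\<not> (G ^^ 1) s \<le> s + 0" using bnd(2)[of 1 0 s] True by linarith
      then show ?thesis by simp
    qed
    have slow: "(G ^^ T) s < s + 1" if "real T * \<bar>\<omega>\<bar> < 1" for T s
    proof (cases "T = 0")
      case False
      have "\<not> (G ^^ T) s \<ge> s + 1"
      proof
        assume "(G ^^ T) s \<ge> s + 1"
        then have "\<omega> \<ge> 1 / real T" using bnd(1)[of T 1 s] False by simp
        then show False using that True False by (simp add: field_simps)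
      qed
      then show ?thesis by simp
    qed simp
    show ?thesis
      by (rule monotone_subsolution[where \<zeta> = \<zeta> and r = "\<bar>\<omega>\<bar>", OF \<gamma> G(2,3,4) pos eq slow]) (assumption, rule that, assumption+)
  next
    case False
    then have neg: "\<omega> < 0" using \<omega>0 by simp
    have dec: "G s < s" for s
    proof -
      have "\<not> (G ^^ 1) s \<ge> s + 0" using bnd(1)[of 1 0 s] neg by linarith
      then show ?thesis by simp
    qed
    have H: "strict_mono (inv G)"
    proof (rule strict_monoI)
      fix s t :: real assume "s < t"
      then have "G (inv G s) < G (inv G t)" by (simp add: iG)
      then show "inv G s < inv G t" using G(2) by (simp add: strict_mono_less)
    qed
    have bij: "bij (inv G)" using G(3) by (rule bij_imp_bij_inv)
    have H1: "inv G (s + 1) = inv G s + 1" for s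
      using G(4)[of "inv G s"] iG(2)[of "inv G s + 1"] by (simp add: iG(1))
    have pos: "s < inv G s" for s using dec[of "inv G s"] iG by simp
    have slow: "(inv G ^^ T) s < s + 1" if T: "real T * \<bar>\<omega>\<bar> < 1" for T s
    proof (cases "T = 0")
      case False
      have canc: "(G ^^ T) ((inv G ^^ T) s) = s" for T s
      proof (induction T)
        case (Suc T)
        have "(G ^^ Suc T) ((inv G ^^ Suc T) s) = (G ^^ T) (G (inv G ((inv G ^^ T) s)))"
          by (simp only: funpow_Suc_right[of T G] funpow.simps(2)[of T "inv G"] comp_apply)
        then show ?case using Suc by (simp add: iG)
      qed simp
      show ?thesis
      proof (rule ccontr)
        assume "\<not> ?thesis"
        then have "(G ^^ T) ((inv G ^^ T) s) \<le> (inv G ^^ T) s + (-1)" by (simp add: canc)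
        then have "\<omega> \<le> -1 / real T" using bnd(2)[of T "-1" "(inv G ^^ T) s"] False by simp
        then show False using T neg False by (simp add: field_simps)
      qed
    qed simp
    have eq': "fst (\<gamma> (inv G s)) + fst (\<gamma> (inv (inv G) s)) - 2 * fst (\<gamma> s) = W (fst (\<gamma> s))" for s
      using eq[of s] G(3) by (simp add: inv_inv_eq)
    show ?thesis
      by (rule monotone_subsolution[where \<zeta> = \<zeta> and r = "\<bar>\<omega>\<bar>", OF \<gamma> H bij H1 pos eq' slow]) (assumption, rule that, assumption+)
  qed
qed

section \<open>The formal separatrix field\<close>

text \<open>
  The ring \<open>real poly poly\<close> is used for polynomials in two variables: the outer variable \<open>tvar\<close> stands
  for \<open>sin (\<pi> x)\<^sup>2\<close>, so that the usual \<open>pderiv\<close> differentiates with respect to it, and the inner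
  variable \<open>eta\<close> stands for the square of the step \<open>\<epsilon>\<close>. Orders in \<open>\<epsilon>\<close> become divisibility by powers
  of \<open>eta\<close>.
\<close>

definition cst :: "real \<Rightarrow> real poly poly" where
  "cst r = [:[:r:]:]"

definition eta :: "real poly poly" where
  "eta = [:[:0, 1:]:]"

definition tvar :: "real poly poly" where
  "tvar = [:0, 1:]"

definition ev :: "real poly poly \<Rightarrow> real \<Rightarrow> real \<Rightarrow> real" where
  "ev P \<eta> t = poly (poly P [:t:]) \<eta>"

lemma ev_simps [simp]:
  "ev (P + Q) \<eta> t = ev P \<eta> t + ev Q \<eta> t"
  "ev (P - Q) \<eta> t = ev P \<eta> t - ev Q \<eta> t"
  "ev (P * Q) \<eta> t = ev P \<eta> t * ev Q \<eta> t"
  "ev (P ^ n) \<eta> t = ev P \<eta> t ^ n"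
  "ev (- P) \<eta> t = - ev P \<eta> t"
  "ev (cst r) \<eta> t = r" "ev eta \<eta> t = \<eta>" "ev tvar \<eta> t = t" "ev 1 \<eta> t = 1" "ev 0 \<eta> t = 0"
  by (simp_all add: ev_def cst_def eta_def tvar_def)

lemma ev_sum [simp]: "ev (sum P A) \<eta> t = (\<Sum>i\<in>A. ev (P i) \<eta> t)"
  by (induction A rule: infinite_finite_induct) auto

lemma ev_pCons: "ev (pCons a P) \<eta> t = poly a \<eta> + t * ev P \<eta> t"
  by (simp add: ev_def)

lemma ev_has_derivative_t: "((\<lambda>t. ev P \<eta> t) has_real_derivative ev (pderiv P) \<eta> t) (at t)"
proof (induction P)
  case 0
  then show ?case by simp
next
  case (pCons a P)
  show ?case
    unfolding ev_pCons pderiv_pCons ev_simps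
    by (rule derivative_eq_intros pCons.IH refl)+ simp
qed

lemma ev_bounded:
  obtains C where "C \<ge> 0" "\<And>\<eta> t. 0 \<le> \<eta> \<Longrightarrow> \<eta> \<le> 1 \<Longrightarrow> 0 \<le> t \<Longrightarrow> t \<le> 1 \<Longrightarrow> \<bar>ev P \<eta> t\<bar> \<le> C"
proof (induction P arbitrary: thesis)
  case 0
  then show ?case by force
next
  case (pCons a P)
  obtain C where C: "C \<ge> 0" "\<And>\<eta> t. 0 \<le> \<eta> \<Longrightarrow> \<eta> \<le> 1 \<Longrightarrow> 0 \<le> t \<Longrightarrow> t \<le> 1 \<Longrightarrow> \<bar>ev P \<eta> t\<bar> \<le> C"
    using pCons.IH by blast
  have "bounded (poly a ` {0..1})"
    by (intro compact_imp_bounded compact_continuous_image continuous_intros compact_Icc)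
  then obtain D where D: "\<forall>y\<in>poly a ` {0..1}. norm y \<le> D" unfolding bounded_iff ..
  have "\<bar>ev (pCons a P) \<eta> t\<bar> \<le> \<bar>D\<bar> + C" if "0 \<le> \<eta>" "\<eta> \<le> 1" "0 \<le> t" "t \<le> 1" for \<eta> t
  proof -
    have "\<bar>poly a \<eta>\<bar> \<le> \<bar>D\<bar>" using D that by force
    moreover have "\<bar>t * ev P \<eta> t\<bar> \<le> 1 * C"
      unfolding abs_mult using that C by (intro mult_mono) auto
    ultimately show ?thesis unfolding ev_pCons by linarith
  qed
  then show ?case using pCons.prems[of "\<bar>D\<bar> + C"] C(1) by auto
qed

lemma cst_mult: "cst (a * b) = cst a * cst b"
  and cst_minus: "cst (- a) = - cst a"
  and cst_one: "cst 1 = 1"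
  by (simp_all add: cst_def one_pCons)

lemma cst_numeral: "cst (numeral n) = numeral n"
  by (simp add: cst_def numeral_poly)

lemma pderiv_cst [simp]: "pderiv (cst r) = 0"
  by (simp add: cst_def pderiv_pCons)

lemma pderiv_eta_power [simp]: "pderiv (eta ^ j) = 0"
proof (induction j)
  case (Suc j)
  have "pderiv eta = 0" by (simp add: eta_def pderiv_pCons)
  then show ?case using Suc by (simp add: pderiv_mult)
qed simp

lemma eta_power_dvd_pderiv: "eta ^ j dvd P \<Longrightarrow> eta ^ j dvd pderiv P"
  by (auto simp: dvd_def pderiv_mult)

text \<open>
  Let \<open>A\<close> be the derivation of the field \<open>s * q (s\<^sup>2)\<close>, where \<open>s = sin (\<pi> x)\<close> and \<open>c = cos (\<pi> x)\<close>.
  The polynomial \<open>iter_field q i\<close> is the coefficient of \<open>A ^ (i + 1) x\<close>, which has the form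
  \<open>s * P (s\<^sup>2)\<close> for even \<open>i\<close> and \<open>s * c * P (s\<^sup>2)\<close> for odd \<open>i\<close>. The two cases of the recursion are
  the product rule together with \<open>c\<^sup>2 = 1 - s\<^sup>2\<close>.
\<close>

fun iter_field :: "real poly poly \<Rightarrow> nat \<Rightarrow> real poly poly" where
  "iter_field q 0 = q"
| "iter_field q (Suc i) = cst pi * q *
    (if even i then iter_field q i + 2 * tvar * pderiv (iter_field q i)
     else (1 - 2 * tvar) * iter_field q i + 2 * tvar * (1 - tvar) * pderiv (iter_field q i))"

text \<open>
  Along an orbit \<open>X\<close> of the field, \<open>X (t + \<epsilon>) + X (t - \<epsilon>) - 2 * X t\<close> is the sum of the even Taylor terms
  \<open>2 * \<epsilon> ^ (2 * k + 2) / fact (2 * k + 2) * A ^ (2 * k + 2) x\<close>, and the pendulum force is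
  \<open>\<epsilon>\<^sup>2 * 4 * \<pi> * s * c\<close>. The defect is the difference of the two after division by \<open>\<epsilon>\<^sup>2 * s * c\<close>,
  with \<open>N\<close> Taylor terms.
\<close>

definition defect :: "nat \<Rightarrow> real poly poly \<Rightarrow> real poly poly" where
  "defect N q = (\<Sum>k<N. cst (2 / fact (2 * k + 2)) * eta ^ k * iter_field q (2 * k + 1)) - cst (4 * pi)"

lemma dvd_mult_diff:
  fixes a b a' b' d :: "'a::comm_ring_1"
  assumes "d dvd a' - a" "d dvd b' - b"
  shows "d dvd a' * b' - a * b"
proof -
  have "a' * b' - a * b = a' * (b' - b) + (a' - a) * b" by (simp add: algebra_simps)
  then show ?thesis using assms by (metis dvd_add dvd_mult dvd_mult2)
qed

lemma iter_field_cong: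
  assumes "eta ^ j dvd q' - q"
  shows "eta ^ j dvd iter_field q' i - iter_field q i"
proof (induction i)
  case 0
  then show ?case using assms by simp
next
  case (Suc i)
  let ?a = "iter_field q i" and ?b = "iter_field q' i"
  have d: "eta ^ j dvd pderiv ?b - pderiv ?a"
    using eta_power_dvd_pderiv[OF Suc] by (simp add: pderiv_diff)
  have A: "eta ^ j dvd (?b + 2 * tvar * pderiv ?b) - (?a + 2 * tvar * pderiv ?a)"
    using dvd_add[OF Suc dvd_mult[OF d, of "2 * tvar"]] by (simp add: algebra_simps)
  have B: "eta ^ j dvd ((1 - 2 * tvar) * ?b + 2 * tvar * (1 - tvar) * pderiv ?b)
      - ((1 - 2 * tvar) * ?a + 2 * tvar * (1 - tvar) * pderiv ?a)"
    using dvd_add[OF dvd_mult[OF Suc, of "1 - 2 * tvar"] dvd_mult[OF d, of "2 * tvar * (1 - tvar)"]]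
    by (simp add: algebra_simps)
  have C: "eta ^ j dvd cst pi * q' - cst pi * q"
    using dvd_mult[OF assms, of "cst pi"] by (simp add: algebra_simps)
  show ?case
    using dvd_mult_diff[OF C A] dvd_mult_diff[OF C B]
    by (cases "even i") (simp_all only: iter_field.simps if_True if_False simp_thms)
qed

text \<open>
  Linearisation of the defect at a field with leading coefficient \<open>q = 2\<close>, the separatrix field of the
  pendulum. Terms with \<open>k \<ge> 1\<close> carry an additional factor \<open>eta\<close>, and so only
  \<open>\<pi> * q * (q + 2 * t * q')\<close> contributes at the lowest order.
\<close>

lemma defect_shift:
  assumes \<delta>: "eta ^ j dvd \<delta>" and j: "j \<ge> 1" and q: "eta dvd q - cst 2"
  shows "eta ^ Suc j dvd defect (Suc N) (q + \<delta>) - defect (Suc N) q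
     - cst (4 * pi) * (\<delta> + tvar * pderiv \<delta>)"
proof -
  let ?d = "\<lambda>k. cst (2 / fact (2 * k + 2)) * eta ^ k * (iter_field (q + \<delta>) (2 * k + 1) - iter_field q (2 * k + 1))"
  have "defect (Suc N) (q + \<delta>) - defect (Suc N) q = (\<Sum>k<Suc N. ?d k)"
    by (simp only: defect_def sum_subtractf right_diff_distrib diff_diff_eq2 diff_add_cancel)
  also have "\<dots> = ?d 0 + (\<Sum>k<N. ?d (Suc k))"
    by (rule sum.lessThan_Suc_shift)
  finally have split: "defect (Suc N) (q + \<delta>) - defect (Suc N) q = ?d 0 + (\<Sum>k<N. ?d (Suc k))" .
  have cong: "eta ^ j dvd iter_field (q + \<delta>) i - iter_field q i" for i
    by (rule iter_field_cong) (use \<delta> in simp)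
  have "eta ^ Suc j dvd ?d (Suc k)" for k
  proof -
    have "eta ^ 1 * eta ^ j dvd (cst (2 / fact (2 * Suc k + 2)) * eta ^ Suc k)
        * (iter_field (q + \<delta>) (2 * Suc k + 1) - iter_field q (2 * Suc k + 1))"
      by (intro mult_dvd_mono cong dvd_mult le_imp_power_dvd) simp
    then show ?thesis by simp
  qed
  then have rest: "eta ^ Suc j dvd (\<Sum>k<N. ?d (Suc k))" by (intro dvd_sum)
  let ?D = "pderiv \<delta>"
  have D: "eta ^ j dvd ?D" by (rule eta_power_dvd_pderiv[OF \<delta>])
  have dq: "eta dvd pderiv q"
    using eta_power_dvd_pderiv[of 1 "q - cst 2"] q by (simp add: pderiv_diff)
  have \<delta>1: "eta dvd \<delta>" using \<delta> j by (metis dvd_trans power_one_right le_imp_power_dvd)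
  have c1: "cst (2 / fact (2 * 0 + 2)) = 1" by (simp add: cst_one)
  have "?d 0 = cst pi * ((q + \<delta>) * (q + \<delta> + 2 * tvar * (pderiv q + ?D)) - q * (q + 2 * tvar * pderiv q))"
    unfolding c1 by (simp add: pderiv_add algebra_simps)
  moreover have "cst (4 * pi) = cst pi * 4" by (simp add: cst_mult cst_numeral mult.commute)
  ultimately have "?d 0 - cst (4 * pi) * (\<delta> + tvar * ?D) =
     cst pi * (\<delta> * (q - 2) + (\<delta> * pderiv q) * (2 * tvar) + (\<delta> + 2 * tvar * ?D) * (q - 2)
       + (\<delta> + 2 * tvar * ?D) * \<delta>)"
    by (simp add: algebra_simps)
  moreover have "eta ^ j * eta dvd \<dots>"
  proof -
    have q2: "eta dvd q - 2" using q by (simp add: cst_numeral)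
    have "eta ^ j dvd \<delta> + 2 * tvar * ?D" using \<delta> D by (intro dvd_add dvd_mult)
    then have "eta ^ j * eta dvd (\<delta> + 2 * tvar * ?D) * (q - 2)" "eta ^ j * eta dvd (\<delta> + 2 * tvar * ?D) * \<delta>"
      using q2 \<delta>1 by (auto intro: mult_dvd_mono)
    moreover have "eta ^ j * eta dvd \<delta> * (q - 2)" "eta ^ j * eta dvd \<delta> * pderiv q"
      using \<delta> q2 dq by (auto intro: mult_dvd_mono)
    ultimately show ?thesis
      by (intro dvd_mult[of _ _ "cst pi"] dvd_add dvd_mult2[of _ "\<delta> * pderiv q"])
  qed
  ultimately have "eta ^ Suc j dvd ?d 0 - cst (4 * pi) * (\<delta> + tvar * ?D)"
    by (simp add: mult.commute)
  from dvd_add[OF this rest] show ?thesis unfolding split by (simp add: algebra_simps)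
qed

text \<open>
  On the monomial \<open>t ^ i\<close> the operator is multiplication by \<open>c + i\<close>, which is nonzero. The constant \<open>c\<close> has
  to be general for the induction on \<open>R\<close>, as passing to the next coefficient increases it by 1.
\<close>

lemma euler_operator_surj:
  assumes "c > 0"
  shows "\<exists>w. smult [:c:] w + tvar * pderiv w = (R :: real poly poly)"
  using assms
proof (induction R arbitrary: c)
  case 0
  then show ?case by (intro exI[of _ 0]) simp
next
  case (pCons a R)
  obtain w where w: "smult [:c + 1:] w + tvar * pderiv w = R"
    using pCons.IH[of "c + 1"] pCons.prems by auto
  have "smult [:c:] (pCons (smult (1 / c) a) w) + tvar * pderiv (pCons (smult (1 / c) a) w)
      = pCons a (smult [:c:] w + w + tvar * pderiv w)"
    using pCons.prems by (simp add: tvar_def pderiv_pCons)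
  also have "smult [:c:] w + w + tvar * pderiv w = R"
  proof -
    have "smult [:c + 1:] w = smult ([:c:] + 1) w" by (simp add: one_pCons)
    then show ?thesis using w by (simp only: smult_add_left smult_1_left)
  qed
  finally show ?case by blast
qed

text \<open>
  Newton-like iteration: the lowest-order part of the defect is removed by a correction of the same
  order, which exists because the linearised operator is onto. The value \<open>q = 2\<close> solves the equation
  at order 0, as \<open>\<pi> * 2 * 2 = 4 * \<pi>\<close>.
\<close>

lemma formal_solution:
  "\<exists>q. eta dvd q - cst 2 \<and> eta ^ Suc j dvd defect (Suc N) q"
proof (induction j)
  case 0
  let ?d = "\<lambda>k. cst (2 / fact (2 * k + 2)) * eta ^ k * iter_field (cst 2) (2 * k + 1)"
  have "defect (Suc N) (cst 2) = (?d 0 - cst (4 * pi)) + (\<Sum>k<N. ?d (Suc k))"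
    unfolding defect_def sum.lessThan_Suc_shift by simp
  also have "?d 0 = cst (4 * pi)"
  proof -
    have "?d 0 = cst 1 * (cst pi * cst 2 * cst 2)" by simp
    also have "\<dots> = cst (4 * pi)" by (simp only: cst_mult[symmetric]) simp
    finally show ?thesis .
  qed
  finally have "defect (Suc N) (cst 2) = (\<Sum>k<N. ?d (Suc k))" by simp
  moreover have "eta dvd ?d (Suc k)" for k by (intro dvd_mult2 dvd_mult) simp
  ultimately have "eta dvd defect (Suc N) (cst 2)" by (auto intro: dvd_sum)
  then show ?case by (intro exI[of _ "cst 2"]) simp
next
  case (Suc j)
  then obtain q R where q: "eta dvd q - cst 2" and R: "defect (Suc N) q = eta ^ Suc j * R"
    by (auto simp: dvd_def simp del: power_Suc)
  obtain w where w: "w + tvar * pderiv w = R"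
    using euler_operator_surj[of 1 R] by (auto simp: one_pCons[symmetric])
  define \<delta> where "\<delta> = eta ^ Suc j * (cst (- 1 / (4 * pi)) * w)"
  have d: "eta ^ Suc j dvd \<delta>" unfolding \<delta>_def by simp
  have "\<delta> + tvar * pderiv \<delta> = eta ^ Suc j * cst (- 1 / (4 * pi)) * (w + tvar * pderiv w)"
    unfolding \<delta>_def pderiv_mult pderiv_eta_power pderiv_cst by (simp add: algebra_simps)
  then have "cst (4 * pi) * (\<delta> + tvar * pderiv \<delta>) = (cst (4 * pi) * cst (- 1 / (4 * pi))) * (eta ^ Suc j * R)"
    by (simp only: w ac_simps)
  also have "cst (4 * pi) * cst (- 1 / (4 * pi)) = cst (- 1)"
    unfolding cst_mult[symmetric] by simp
  finally have canc: "cst (4 * pi) * (\<delta> + tvar * pderiv \<delta>) = - defect (Suc N) q"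
    by (simp add: R cst_minus cst_one)
  have "eta ^ Suc (Suc j) dvd defect (Suc N) (q + \<delta>)"
    using defect_shift[OF d _ q, of N] unfolding canc by simp
  moreover have "eta dvd (q + \<delta>) - cst 2"
  proof -
    have "eta dvd \<delta>" unfolding \<delta>_def by simp
    from dvd_add[OF q this] show ?thesis by (simp add: algebra_simps)
  qed
  ultimately show ?case by blast
qed

text \<open>
  Adding \<open>\<sigma> * eta ^ K\<close> to a solution of higher order makes the defect \<open>4 * \<pi> * \<sigma> * eta ^ K\<close> to leading
  order, so that its sign can be prescribed.
\<close>

lemma formal_strict_solution:
  assumes K: "K \<ge> 1"
  obtains q R where "\<And>\<sigma>. eta dvd q \<sigma> - cst 2" "\<And>\<sigma> \<tau>. eta ^ K dvd q \<sigma> - q \<tau>"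
    "\<And>\<sigma>. defect (Suc N) (q \<sigma>) = eta ^ K * (cst (4 * pi * \<sigma>) + eta * R \<sigma>)"
proof -
  obtain q where q: "eta dvd q - cst 2" and q0: "eta ^ Suc K dvd defect (Suc N) q"
    using formal_solution by blast
  define p where "p \<sigma> = q + eta ^ K * cst \<sigma>" for \<sigma>
  have 1: "eta dvd p \<sigma> - cst 2" for \<sigma>
  proof -
    have "eta dvd eta ^ K * cst \<sigma>" using K by (simp add: dvd_power)
    from dvd_add[OF q this] show ?thesis by (simp add: p_def algebra_simps)
  qed
  have 2: "eta ^ K dvd p \<sigma> - p \<tau>" for \<sigma> \<tau>
    by (simp add: p_def right_diff_distrib[symmetric])
  have "eta ^ Suc K dvd defect (Suc N) (p \<sigma>) - eta ^ K * cst (4 * pi * \<sigma>)" for \<sigma>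
  proof -
    have "cst (4 * pi) * (eta ^ K * cst \<sigma> + tvar * pderiv (eta ^ K * cst \<sigma>)) = eta ^ K * cst (4 * pi * \<sigma>)"
      unfolding pderiv_mult by (simp add: cst_mult ac_simps)
    then have "eta ^ Suc K dvd defect (Suc N) (p \<sigma>) - defect (Suc N) q - eta ^ K * cst (4 * pi * \<sigma>)"
      using defect_shift[of K "eta ^ K * cst \<sigma>" q N] K q by (simp add: p_def)
    from dvd_add[OF this q0] show ?thesis by (simp add: algebra_simps)
  qed
  then have "\<forall>\<sigma>. \<exists>R. defect (Suc N) (p \<sigma>) - eta ^ K * cst (4 * pi * \<sigma>) = eta ^ Suc K * R"
    by (auto simp: dvd_def)
  then obtain R where R: "\<And>\<sigma>. defect (Suc N) (p \<sigma>) - eta ^ K * cst (4 * pi * \<sigma>) = eta ^ Suc K * R \<sigma>"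
    by metis
  have 3: "defect (Suc N) (p \<sigma>) = eta ^ K * (cst (4 * pi * \<sigma>) + eta * R \<sigma>)" for \<sigma>
    using R[of \<sigma>] by (simp add: algebra_simps)
  show ?thesis by (rule that[OF 1 2 3])
qed

section \<open>Flows of fields on the unit interval that vanish at the end points\<close>

text \<open>
  Separation of variables: the flow is the inverse of a primitive of \<open>1 / b\<close>. The upper bound on
  \<open>b\<close> makes this primitive onto.
\<close>

lemma autonomous_flow_exists:
  fixes b :: "real \<Rightarrow> real"
  assumes cont: "continuous_on UNIV b" and lo: "\<And>x. m \<le> b x" and hi: "\<And>x. b x \<le> M" and m: "m > 0"
  obtains Y where "\<And>t. (Y has_real_derivative b (Y t)) (at t)" "surj Y"
proof -
  have pos: "b x > 0" for x using lo[of x] m by linarith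
  have M: "M > 0" using pos[of 0] hi[of 0] by linarith
  have "\<exists>\<theta>. \<forall>x. -\<infinity> < ereal x \<longrightarrow> ereal x < \<infinity> \<longrightarrow> (\<theta> has_vector_derivative 1 / b x) (at x)"
  proof (rule einterval_antiderivative)
    fix x
    have "isCont b x" using cont by (simp add: continuous_on_eq_continuous_at)
    then show "isCont (\<lambda>x. 1 / b x) x"
      using pos[of x] by (intro continuous_intros) auto
  qed simp
  then obtain \<theta> where \<theta>: "(\<theta> has_real_derivative 1 / b x) (at x)" for x
    by (auto simp: has_real_derivative_iff_has_vector_derivative)
  have inc: "\<theta> y - \<theta> x \<ge> (y - x) / M" if "x \<le> y" for x y
  proof -
    have "\<theta> x - x / M \<le> \<theta> y - y / M"
    proof (rule DERIV_nonneg_imp_nondecreasing[OF that])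
      fix z
      have "((\<lambda>z. \<theta> z - z / M) has_real_derivative 1 / b z - 1 / M) (at z)"
        by (rule derivative_eq_intros \<theta> refl)+ (use M in auto)
      moreover have "1 / b z - 1 / M \<ge> 0" using hi[of z] pos[of z] by (simp add: frac_le)
      ultimately show "\<exists>y. ((\<lambda>z. \<theta> z - z / M) has_real_derivative y) (at z) \<and> 0 \<le> y" by blast
    qed
    then show ?thesis by (simp add: diff_divide_distrib)
  qed
  have cont\<theta>: "isCont \<theta> x" for x using \<theta> by (rule DERIV_isCont)
  have smono: "\<theta> x < \<theta> y" if "x < y" for x y
  proof -
    have "(y - x) / M > 0" using that M by simp
    then show ?thesis using inc[of x y] that by linarith
  qed
  have inj: "inj \<theta>" by (rule injI) (metis smono less_irrefl linorder_neqE_linordered_idom)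
  have surj: "\<exists>x. \<theta> x = t" for t
  proof -
    define R where "R = M * (\<bar>t\<bar> + \<bar>\<theta> 0\<bar>)"
    have R: "R \<ge> 0" "R / M = \<bar>t\<bar> + \<bar>\<theta> 0\<bar>" using M by (auto simp: R_def)
    have "\<theta> (- R) \<le> t" using inc[of "- R" 0] R by auto
    moreover have "t \<le> \<theta> R" using inc[of 0 R] R by auto
    ultimately show ?thesis
      using IVT'[of \<theta> "- R" t R] R cont\<theta> by (auto intro: continuous_at_imp_continuous_on)
  qed
  define Y where "Y = inv \<theta>"
  have Y: "\<theta> (Y t) = t" "Y (\<theta> x) = x" for t x
    unfolding Y_def using surj[of t] by (metis f_inv_into_f rangeI) (rule inv_f_f[OF inj])
  show ?thesis
  proof (rule that[of Y])
    fix t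
    have "isCont Y (\<theta> (Y t))"
      by (rule isCont_inverse_function[of 1]) (auto simp: Y cont\<theta>)
    then have c: "isCont Y t" by (simp add: Y)
    have "(Y has_real_derivative inverse (1 / b (Y t))) (at t)"
      by (rule DERIV_inverse_function[where f = \<theta> and a = "t - 1" and b = "t + 1"])
        (use \<theta> pos[of "Y t"] Y c in auto)
    then show "(Y has_real_derivative b (Y t)) (at t)" by simp
  next
    show "surj Y" by (rule surjI) (rule Y(2))
  qed
qed

text \<open>
  In the coordinate \<open>\<xi> = ln (tan (\<pi> x / 2))\<close>, which maps the unit interval onto the line, the field
  becomes \<open>\<pi> * p\<close>, which is bounded from above and away from 0. So its orbits run from one end point
  to the other in infinite time.
\<close>

lemma sine_field_flow_exists:
  fixes p :: "real \<Rightarrow> real"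
  assumes cont: "continuous_on UNIV p"
    and bnd: "\<And>t. 0 \<le> t \<Longrightarrow> t \<le> 1 \<Longrightarrow> 1 \<le> p t \<and> p t \<le> 3"
  obtains X where
    "\<And>t. (X has_real_derivative sin (pi * X t) * p ((sin (pi * X t))\<^sup>2)) (at t)"
    "\<And>t. 0 < X t" "\<And>t. X t < 1" "\<And>x. 0 < x \<Longrightarrow> x < 1 \<Longrightarrow> \<exists>t. X t = x"
proof -
  define b where "b \<xi> = pi * p ((sin (2 * arctan (exp \<xi>)))\<^sup>2)" for \<xi>
  have sq: "(sin z)\<^sup>2 \<le> (1::real)" for z by (simp add: abs_square_le_1)
  obtain Y where Y: "\<And>t. (Y has_real_derivative b (Y t)) (at t)" "surj Y"
  proof (rule autonomous_flow_exists[of b "pi * 1" "pi * 3"])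
    show "continuous_on UNIV b"
      unfolding b_def by (intro continuous_intros continuous_on_compose2[OF cont]) auto
    show "pi * 1 \<le> b x" "b x \<le> pi * 3" for x
      unfolding b_def using bnd[OF zero_le_power2 sq] by (intro mult_left_mono; simp)+
  qed auto
  define X where "X t = 2 / pi * arctan (exp (Y t))" for t
  have piX: "pi * X t = 2 * arctan (exp (Y t))" for t by (simp add: X_def)
  show ?thesis
  proof (rule that[of X])
    fix t
    let ?e = "exp (Y t)"
    have s: "sin (pi * X t) = 2 * (?e / (1 + ?e\<^sup>2))"
    proof -
      have "sqrt (1 + ?e\<^sup>2) * sqrt (1 + ?e\<^sup>2) = 1 + ?e\<^sup>2" by (simp add: add_nonneg_nonneg)
      then show ?thesis unfolding piX sin_double by (simp add: sin_arctan cos_arctan)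
    qed
    have "(X has_real_derivative 2 / pi * (inverse (1 + ?e\<^sup>2) * (?e * b (Y t)))) (at t)"
      unfolding X_def by (rule derivative_eq_intros DERIV_arctan Y refl)+ simp
    moreover have "2 / pi * (inverse (1 + ?e\<^sup>2) * (?e * b (Y t))) = sin (pi * X t) * p ((sin (pi * X t))\<^sup>2)"
      unfolding b_def piX[symmetric] s by (simp add: divide_inverse)
    ultimately show "(X has_real_derivative sin (pi * X t) * p ((sin (pi * X t))\<^sup>2)) (at t)" by simp
    show "0 < X t" by (simp add: X_def)
    show "X t < 1" using arctan_ubound[of ?e] by (simp add: X_def field_simps)
  next
    fix x :: real assume x: "0 < x" "x < 1"
    have lt: "pi * x / 2 < pi / 2" using x by simp
    have gt: "0 < pi * x / 2" using x by simp
    have "tan (pi * x / 2) > 0" using lt gt by (intro tan_gt_zero) auto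
    then obtain \<xi> where \<xi>: "exp \<xi> = tan (pi * x / 2)" by (metis exp_ln)
    obtain t where "Y t = \<xi>" using Y(2) by (metis surjD)
    moreover have at: "arctan (tan (pi * x / 2)) = pi * x / 2"
      using lt gt by (intro arctan_tan) linarith+
    ultimately have "X t = 2 / pi * (pi * x / 2)" by (simp only: X_def \<xi> at)
    then show "\<exists>t. X t = x" by (intro exI[of _ t]) simp
  qed
qed

lemma sin_pi_ge: assumes "0 \<le> y" "y \<le> 51/100" shows "sin (pi * y) \<ge> y / 2"
proof -
  define u where "u = pi * y"
  have u: "0 \<le> u" using assms by (simp add: u_def)
  have "pi * y \<le> 4 * (51/100)" using assms pi_less_4 by (intro mult_mono) auto
  then have u2: "u \<le> 21/10" by (simp add: u_def)
  have "\<bar>sin u - (\<Sum>m<3. sin_coeff m * u ^ m)\<bar> \<le> inverse (fact 3) * \<bar>u\<bar> ^ 3"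
    by (rule Maclaurin_sin_bound)
  moreover have "(\<Sum>m<3. sin_coeff m * u ^ m) = u"
    by (simp add: sin_coeff_def eval_nat_numeral)
  moreover have "inverse (fact 3) * \<bar>u\<bar> ^ 3 = u * (u * u) / 6"
    using u by (simp add: eval_nat_numeral)
  ultimately have "\<bar>sin u - u\<bar> \<le> u * (u * u) / 6" by simp
  moreover have "u * (u * u) \<le> u * (21/10 * (21/10))"
    using u u2 by (intro mult_left_mono mult_mono) auto
  moreover have "2 * y \<le> u" unfolding u_def using pi_ge_two assms by (intro mult_right_mono) auto
  ultimately show ?thesis unfolding u_def[symmetric] using u by linarith
qed

lemma sin_pi_mono: assumes "0 \<le> x" "x \<le> y" "y \<le> 1 - x" shows "sin (pi * x) \<le> sin (pi * y)"
proof (cases "y \<le> 1/2")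
  case True
  have "pi * x \<le> pi * y" "pi * y \<le> pi * (1/2)" using assms True by (intro mult_left_mono; simp)+
  then show ?thesis using assms by (intro sin_monotone_2pi_le) (auto intro: order_trans[of _ 0])
next
  case False
  have "pi * x \<le> pi * (1 - y)" "pi * (1 - y) \<le> pi * (1/2)" using assms False by (intro mult_left_mono; simp)+
  then have "sin (pi * x) \<le> sin (pi * (1 - y))"
    using assms by (intro sin_monotone_2pi_le) (auto intro: order_trans[of _ 0])
  also have "sin (pi * (1 - y)) = sin (pi * y)" by (simp add: right_diff_distrib sin_diff)
  finally show ?thesis .
qed

lemma sin_pi_near_half: assumes "\<bar>y - 1/2\<bar> \<le> 1/25" shows "sin (pi * y) \<ge> 95/100"
proof -
  let ?d = "pi * (y - 1/2)"
  have "sin (pi * y) = cos ?d" by (simp add: right_diff_distrib cos_diff)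
  also have "\<dots> = 1 - 2 * (sin (?d / 2))\<^sup>2" using cos_double_sin[of "?d / 2"] by simp
  finally have e: "sin (pi * y) = 1 - 2 * (sin (?d / 2))\<^sup>2" .
  have "\<bar>?d\<bar> \<le> 4 * (1/25)" unfolding abs_mult using assms pi_less_4 by (intro mult_mono) auto
  then have "\<bar>sin (?d / 2)\<bar> \<le> 8/100" using abs_sin_x_le_abs_x[of "?d / 2"] by linarith
  then have "(sin (?d / 2))\<^sup>2 \<le> (8/100)\<^sup>2" by (metis abs_ge_zero power2_abs power_mono)
  then show ?thesis using e by (simp add: power2_eq_square)
qed

text \<open>
  An orbit \<open>X\<close> of \<open>sin (\<pi> x) * p (sin (\<pi> x)\<^sup>2)\<close> with \<open>p\<close> close to 2, that is, a small perturbation of the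
  separatrix motion of the pendulum.
\<close>

locale sine_flow =
  fixes p p' X :: "real \<Rightarrow> real"
  assumes p_bounds: "0 \<le> t \<Longrightarrow> t \<le> 1 \<Longrightarrow> 19/10 \<le> p t \<and> p t \<le> 21/10"
    and p_deriv: "(p has_real_derivative p' t) (at t)"
    and p'_bound: "0 \<le> t \<Longrightarrow> t \<le> 1 \<Longrightarrow> \<bar>p' t\<bar> \<le> 1/10"
    and X_deriv: "(X has_real_derivative sin (pi * X t) * p ((sin (pi * X t))\<^sup>2)) (at t)"
    and X_pos: "0 < X t" and X_less: "X t < 1"
    and X_onto: "0 < x \<Longrightarrow> x < 1 \<Longrightarrow> \<exists>t. X t = x"
begin

definition speed :: "real \<Rightarrow> real" where
  "speed x = sin (pi * x) * p ((sin (pi * x))\<^sup>2)"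

text \<open>
  The time-\<open>e\<close> map of the flow.
\<close>

definition shift :: "real \<Rightarrow> real \<Rightarrow> real" where
  "shift e x = X (inv X x + e)"

lemma sin_X: "0 < sin (pi * X t)" "sin (pi * X t) \<le> 1"
  using X_pos[of t] X_less[of t] by (auto intro!: sin_gt_zero)

lemma sin_sq: "0 \<le> (sin z)\<^sup>2" "(sin z)\<^sup>2 \<le> (1::real)"
  by (auto simp: abs_square_le_1)

lemma X_speed: "(X has_real_derivative speed (X t)) (at t)"
  unfolding speed_def by (rule X_deriv)

lemma speed_bounds: "19/10 * sin (pi * X t) \<le> speed (X t)" "speed (X t) \<le> 21/10 * sin (pi * X t)"
  unfolding speed_def mult.commute[of "sin (pi * X t)"]
  using p_bounds[OF sin_sq, of "pi * X t"] less_imp_le[OF sin_X(1)[of t]] by (intro mult_right_mono; simp)+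

text \<open>
  As a function of \<open>s = sin (\<pi> x)\<close> the speed \<open>s * p (s\<^sup>2)\<close> has the derivative \<open>p + 2 * s\<^sup>2 * p'\<close>, which is
  positive as \<open>p'\<close> is small.
\<close>

lemma speed_mono_sin:
  assumes "0 \<le> sin (pi * x)" "sin (pi * x) \<le> sin (pi * y)"
  shows "speed x \<le> speed y"
proof -
  let ?a = "\<lambda>s. s * p (s\<^sup>2)"
  have "?a (sin (pi * x)) \<le> ?a (sin (pi * y))"
  proof (rule DERIV_nonneg_imp_nondecreasing[OF assms(2)])
    fix s assume "sin (pi * x) \<le> s" "s \<le> sin (pi * y)"
    then have s: "0 \<le> s" "s \<le> 1" using assms sin_le_one[of "pi * y"] by linarith+
    then have s2: "0 \<le> s\<^sup>2" "s\<^sup>2 \<le> 1" by (auto simp: power_le_one)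
    have "(?a has_real_derivative p (s\<^sup>2) + 2 * s\<^sup>2 * p' (s\<^sup>2)) (at s)"
    proof -
      have "((\<lambda>s. s\<^sup>2) has_real_derivative 2 * s) (at s)" by (auto intro!: derivative_eq_intros)
      then have "((\<lambda>s. p (s\<^sup>2)) has_real_derivative p' (s\<^sup>2) * (2 * s)) (at s)"
        by (rule DERIV_chain2[OF p_deriv])
      from DERIV_mult[OF DERIV_ident this] show ?thesis by (simp add: power2_eq_square algebra_simps)
    qed
    moreover have "\<bar>s\<^sup>2 * p' (s\<^sup>2)\<bar> \<le> 1 * (1/10)"
      unfolding abs_mult using s2 p'_bound[OF s2] by (intro mult_mono) auto
    then have "p (s\<^sup>2) + 2 * s\<^sup>2 * p' (s\<^sup>2) \<ge> 0"
      using p_bounds[OF s2] by linarith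
    ultimately show "\<exists>y. (?a has_real_derivative y) (at s) \<and> 0 \<le> y" by blast
  qed
  then show ?thesis by (simp add: speed_def)
qed

lemma X_mono: "s < t \<Longrightarrow> X s < X t"
proof (rule DERIV_pos_imp_increasing, assumption)
  fix z
  have "speed (X z) > 0" using speed_bounds(1)[of z] sin_X(1)[of z] by linarith
  then show "\<exists>y. (X has_real_derivative y) (at z) \<and> 0 < y" using X_speed by blast
qed

lemma inj_X: "inj X"
  by (rule injI) (metis X_mono less_irrefl linorder_neqE_linordered_idom)

lemma shift_X [simp]: "shift e (X t) = X (t + e)"
  by (simp add: shift_def inv_f_f[OF inj_X])

lemma shift_range: "0 < shift e x" "shift e x < 1"
  by (simp_all add: shift_def X_pos X_less)

lemma shift_shift:
  assumes "0 < x" "x < 1" shows "shift d (shift e x) = shift (d + e) x" "shift 0 x = x"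
proof -
  obtain t where "x = X t" using X_onto assms by metis
  then show "shift d (shift e x) = shift (d + e) x" "shift 0 x = x" by (simp_all add: ac_simps)
qed

lemma shift_strict_mono:
  assumes "0 < x" "x < y" "y < 1" shows "shift e x < shift e y"
proof -
  obtain s where s: "x = X s" using X_onto assms by (metis less_trans)
  obtain t where t: "y = X t" using X_onto assms by (metis less_trans)
  have "s < t" using assms s t X_mono by (metis less_asym linorder_neqE_linordered_idom less_irrefl)
  then show ?thesis using s t X_mono by simp
qed

lemma shift_mean_value:
  assumes "e > 0"
  obtains z where "t < z" "z < t + e" "X (t + e) - X t = e * speed (X z)"
  using MVT2[of t "t + e" X "\<lambda>t. speed (X t)"] X_speed assms by auto

lemma shift_upper:
  assumes "0 < x" "x < 1" "e > 0"
  shows "x < shift e x" "shift e x \<le> x + 21/10 * e"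
proof -
  obtain t where t: "x = X t" using X_onto assms by metis
  obtain z where z: "X (t + e) - X t = e * speed (X z)" using shift_mean_value[OF assms(3)] .
  have "speed (X z) \<le> 21/10" using speed_bounds(2)[of z] sin_X(2)[of z] by linarith
  then have "e * speed (X z) \<le> e * (21/10)" using assms by (intro mult_left_mono) auto
  then have "X (t + e) \<le> X t + 21/10 * e" using z by linarith
  then show "x < shift e x" "shift e x \<le> x + 21/10 * e" using t X_mono[of t "t + e"] assms by simp_all
qed

text \<open>
  The logarithmic derivative of \<open>sin (\<pi> X t)\<close> is bounded by 9. Errors at nearby times can
  therefore be measured by the distance of the base point from the saddles, uniformly up to the
  saddles.
\<close>

lemma sin_X_ratio:
  assumes "\<bar>\<tau>\<bar> \<le> 1/100"
  shows "sin (pi * X (t + \<tau>)) \<le> 2 * sin (pi * X t)"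
proof -
  let ?f = "\<lambda>t. sin (pi * X t)"
  let ?f' = "\<lambda>t. cos (pi * X t) * (pi * speed (X t))"
  have D: "(?f has_real_derivative ?f' t) (at t)" for t
    by (rule derivative_eq_intros X_speed refl)+ simp
  have f': "\<bar>?f' t\<bar> \<le> 9 * ?f t" for t
  proof -
    have "\<bar>cos (pi * X t)\<bar> * (pi * speed (X t)) \<le> 1 * (4 * (21/10 * ?f t))"
      using speed_bounds[of t] sin_X[of t] pi_less_4 by (intro mult_mono) (auto intro: order_trans[rotated])
    moreover have "\<bar>?f' t\<bar> = \<bar>cos (pi * X t)\<bar> * (pi * speed (X t))"
      using speed_bounds(1)[of t] sin_X[of t] by (simp add: abs_mult)
    ultimately show ?thesis using sin_X(1)[of t] by linarith
  qed
  have up: "?f y \<le> ?f x * exp (9 * (y - x))" if "x \<le> y" for x y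
  proof -
    have "?f y * exp (- 9 * y) \<le> ?f x * exp (- 9 * x)"
    proof (rule DERIV_nonpos_imp_nonincreasing[OF that])
      fix z
      have "((\<lambda>z. ?f z * exp (- 9 * z)) has_real_derivative (?f' z - 9 * ?f z) * exp (- 9 * z)) (at z)"
        by (rule derivative_eq_intros D refl)+ (simp add: algebra_simps)
      moreover have "(?f' z - 9 * ?f z) * exp (- 9 * z) \<le> 0"
        using f'[of z] by (intro mult_nonpos_nonneg) auto
      ultimately show "\<exists>y. ((\<lambda>z. ?f z * exp (- 9 * z)) has_real_derivative y) (at z) \<and> y \<le> 0" by blast
    qed
    then have "?f y * exp (- 9 * y) * exp (9 * y) \<le> ?f x * exp (- 9 * x) * exp (9 * y)"
      by (intro mult_right_mono) auto
    then show ?thesis by (simp add: mult.assoc right_diff_distrib flip: exp_add)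
  qed
  have down: "?f x \<le> ?f y * exp (9 * (y - x))" if "x \<le> y" for x y
  proof -
    have "?f x * exp (9 * x) \<le> ?f y * exp (9 * y)"
    proof (rule DERIV_nonneg_imp_nondecreasing[OF that])
      fix z
      have "((\<lambda>z. ?f z * exp (9 * z)) has_real_derivative (?f' z + 9 * ?f z) * exp (9 * z)) (at z)"
        by (rule derivative_eq_intros D refl)+ (simp add: algebra_simps)
      moreover have "(?f' z + 9 * ?f z) * exp (9 * z) \<ge> 0"
        using f'[of z] by (intro mult_nonneg_nonneg) auto
      ultimately show "\<exists>y. ((\<lambda>z. ?f z * exp (9 * z)) has_real_derivative y) (at z) \<and> 0 \<le> y" by blast
    qed
    then have "?f x * exp (9 * x) * exp (- 9 * x) \<le> ?f y * exp (9 * y) * exp (- 9 * x)"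
      by (intro mult_right_mono) auto
    then show ?thesis by (simp add: mult.assoc right_diff_distrib flip: exp_add)
  qed
  have "?f (t + \<tau>) \<le> ?f t * exp (9 * \<bar>\<tau>\<bar>)"
    using up[of t "t + \<tau>"] down[of "t + \<tau>" t] by (cases "\<tau> \<ge> 0") auto
  also have "\<dots> \<le> ?f t * 2"
    using exp_bound_half[of "9 * \<bar>\<tau>\<bar>"] assms sin_X(1)[of t] by (intro mult_left_mono) auto
  finally show ?thesis by simp
qed

context
  fixes e :: real
  assumes e: "0 < e" "e \<le> 1/100"
begin

text \<open>
  Around \<open>1/2\<close> the sine is close to 1 and the speed close to 2. One step is therefore longer than the
  bump, whose width is of order \<open>e\<^sup>2\<close>.
\<close>

lemma shift_near_half:
  assumes "1/2 - 5/4 * e \<le> x" "x \<le> 1/2 + e\<^sup>2"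
  shows "shift e x \<ge> x + 7/4 * e"
proof -
  have e2: "e\<^sup>2 \<le> e * (1/100)" using e by (simp add: power2_eq_square)
  have x: "0 < x" "x < 1" using assms e e2 by linarith+
  obtain t where t: "x = X t" using X_onto x by metis
  obtain z where z: "t < z" "z < t + e" "X (t + e) - X t = e * speed (X z)"
    using shift_mean_value[OF e(1)] .
  have "x < X z" "X z < X (t + e)" using z t X_mono by auto
  moreover have "X (t + e) \<le> x + 21/10 * e" using shift_upper(2)[OF x e(1)] t by simp
  ultimately have "\<bar>X z - 1/2\<bar> \<le> 1/25" using assms e e2 by (intro abs_leI) linarith+
  then have "speed (X z) \<ge> 19/10 * (95/100)"
    using sin_pi_near_half[of "X z"] speed_bounds(1)[of z] by linarith
  then have "speed (X z) \<ge> 7/4" by linarith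
  then have "e * speed (X z) \<ge> e * (7/4)" using e by (intro mult_left_mono) auto
  then have "X (t + e) \<ge> X t + 7/4 * e" using z by linarith
  then show ?thesis using t by simp
qed

text \<open>
  The difference \<open>X (z + e) - X z\<close> decreases in \<open>z\<close> because the speed does so from \<open>X z\<close> to \<open>X (z + e)\<close>:
  the two points either lie both to the right of \<open>1/2\<close>, or the second one is farther from \<open>1/2\<close>.
\<close>

lemma shift_contracts_right:
  assumes "1/2 - e\<^sup>2 \<le> x" "x \<le> y" "y < 1"
  shows "shift e y - shift e x \<le> y - x"
proof -
  have e2: "e\<^sup>2 \<le> e * (1/100)" using e by (simp add: power2_eq_square)
  have x: "0 < x" "x < 1" using assms e e2 by linarith+
  obtain s where s: "x = X s" using X_onto x by metis
  obtain t where t: "y = X t" using X_onto[of y] x assms by force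
  have st: "s \<le> t" using assms s t X_mono[of t s] by force
  have "X (t + e) - X t \<le> X (s + e) - X s"
  proof (rule DERIV_nonpos_imp_nonincreasing[OF st])
    fix z assume z: "s \<le> z" "z \<le> t"
    have "((\<lambda>z. X (z + e) - X z) has_real_derivative speed (X (z + e)) - speed (X z)) (at z)"
      by (intro DERIV_diff X_speed) (use X_speed[of "z + e"] in \<open>simp add: DERIV_shift\<close>)
    moreover have "speed (X (z + e)) \<le> speed (X z)"
    proof (rule speed_mono_sin[OF less_imp_le[OF sin_X(1)]])
      have zx: "x \<le> X z" using s z X_mono[of s z] by (cases "z = s") auto
      have up: "X z < X (z + e)" using X_mono e by simp
      have "1 - X z \<le> X (z + e)"
      proof (cases "X z \<le> 1/2 + e\<^sup>2")
        case True
        then have "X (z + e) \<ge> X z + 7/4 * e"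
          using shift_near_half[of "X z"] zx assms(1) e e2 by simp
        then show ?thesis using zx assms(1) e e2 by linarith
      qed (use up zx assms(1) e e2 in linarith)
      then have "sin (pi * (1 - X (z + e))) \<le> sin (pi * X z)"
        using up X_less[of "z + e"] by (intro sin_pi_mono) auto
      then show "sin (pi * X (z + e)) \<le> sin (pi * X z)"
        by (simp add: right_diff_distrib sin_diff)
    qed
    ultimately show "\<exists>y. ((\<lambda>z. X (z + e) - X z) has_real_derivative y) (at z) \<and> y \<le> 0" by force
  qed
  then show ?thesis by (simp add: s t)
qed

lemma shift_right_lower:
  assumes "1/2 - e\<^sup>2 \<le> x" "x < 1"
  shows "shift e x \<ge> x + e / 4 * (1 - x)"
proof -
  have e2: "e\<^sup>2 \<le> e * (1/100)" using e by (simp add: power2_eq_square)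
  have x: "0 < x" using assms e e2 by linarith
  obtain t where t: "x = X t" using X_onto x assms by metis
  obtain z where z: "t < z" "z < t + e" "X (t + e) - X t = e * speed (X z)"
    using shift_mean_value[OF e(1)] .
  have "sin (pi * X (z + (t - z))) \<le> 2 * sin (pi * X z)"
    by (rule sin_X_ratio) (use z e in auto)
  then have "sin (pi * x) \<le> 2 * sin (pi * X z)" by (simp add: t)
  moreover have "(1 - x) / 2 \<le> sin (pi * (1 - x))"
    by (rule sin_pi_ge) (use assms e e2 in auto)
  ultimately have "speed (X z) \<ge> (1 - x) / 4"
    using speed_bounds(1)[of z] sin_X(1)[of z] by (simp add: right_diff_distrib sin_diff)
  then have "e * speed (X z) \<ge> e * ((1 - x) / 4)" using e by (intro mult_left_mono) auto
  then have "X (t + e) \<ge> X t + e * ((1 - x) / 4)" using z by linarith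
  then show ?thesis using t by simp
qed

end

end

section \<open>Separatrices up to any power of the small parameter\<close>

lemma sum_even_odd_pairs:
  fixes f :: "nat \<Rightarrow> real"
  shows "(\<Sum>m<2 * M. f m) = (\<Sum>k<M. f (2 * k) + f (2 * k + 1))"
  by (induction M) simp_all

lemma sine_flow_for_small_eta:
  assumes "eta dvd q - cst 2"
  obtains \<eta>0 where "0 < \<eta>0" "\<eta>0 \<le> 1"
    "\<And>\<eta>. 0 < \<eta> \<Longrightarrow> \<eta> \<le> \<eta>0 \<Longrightarrow> \<exists>X. sine_flow (ev q \<eta>) (ev (pderiv q) \<eta>) X"
proof -
  obtain Q where "q - cst 2 = eta * Q" using assms by (auto simp: dvd_def)
  then have q: "q = cst 2 + eta * Q" by (simp add: algebra_simps)
  have q': "pderiv q = eta * pderiv Q"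
    using pderiv_eta_power[of 1] by (simp add: q pderiv_add pderiv_mult)
  obtain C1 where C1: "C1 \<ge> 0" "\<And>\<eta> t. 0 \<le> \<eta> \<Longrightarrow> \<eta> \<le> 1 \<Longrightarrow> 0 \<le> t \<Longrightarrow> t \<le> 1 \<Longrightarrow> \<bar>ev Q \<eta> t\<bar> \<le> C1"
    using ev_bounded[of Q] by blast
  obtain C2 where C2: "C2 \<ge> 0" "\<And>\<eta> t. 0 \<le> \<eta> \<Longrightarrow> \<eta> \<le> 1 \<Longrightarrow> 0 \<le> t \<Longrightarrow> t \<le> 1 \<Longrightarrow> \<bar>ev (pderiv Q) \<eta> t\<bar> \<le> C2"
    using ev_bounded[of "pderiv Q"] by blast
  define \<eta>0 where "\<eta>0 = 1 / (10 * (1 + C1 + C2))"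
  have \<eta>0: "0 < \<eta>0" "\<eta>0 \<le> 1" "\<eta>0 * C1 \<le> 1/10" "\<eta>0 * C2 \<le> 1/10"
    using C1(1) C2(1) by (auto simp: \<eta>0_def divide_simps)
  show ?thesis
  proof (rule that[OF \<eta>0(1,2)])
    fix \<eta> assume \<eta>: "0 < \<eta>" "\<eta> \<le> \<eta>0"
    have small: "\<bar>\<eta> * ev Q \<eta> t\<bar> \<le> 1/10" "\<bar>\<eta> * ev (pderiv Q) \<eta> t\<bar> \<le> 1/10" if t: "0 \<le> t" "t \<le> 1" for t
    proof -
      have "\<bar>\<eta>\<bar> * \<bar>ev Q \<eta> t\<bar> \<le> \<eta>0 * C1" "\<bar>\<eta>\<bar> * \<bar>ev (pderiv Q) \<eta> t\<bar> \<le> \<eta>0 * C2"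
        using \<eta> \<eta>0 C1(2)[of \<eta> t] C2(2)[of \<eta> t] t by (intro mult_mono; simp)+
      then show "\<bar>\<eta> * ev Q \<eta> t\<bar> \<le> 1/10" "\<bar>\<eta> * ev (pderiv Q) \<eta> t\<bar> \<le> 1/10"
        using \<eta>0 by (simp_all add: abs_mult)
    qed
    have bnd: "19/10 \<le> ev q \<eta> t \<and> ev q \<eta> t \<le> 21/10" if "0 \<le> t" "t \<le> 1" for t
      using small(1)[OF that] unfolding q ev_simps abs_le_iff by linarith
    have cont: "continuous_on UNIV (ev q \<eta>)"
      by (auto intro!: continuous_at_imp_continuous_on DERIV_isCont ev_has_derivative_t)
    have bnd': "1 \<le> ev q \<eta> t \<and> ev q \<eta> t \<le> 3" if "0 \<le> t" "t \<le> 1" for t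
      using bnd[OF that] by linarith
    obtain X where X: "\<And>t. (X has_real_derivative sin (pi * X t) * ev q \<eta> ((sin (pi * X t))\<^sup>2)) (at t)"
        "\<And>t. 0 < X t" "\<And>t. X t < 1" "\<And>x. 0 < x \<Longrightarrow> x < 1 \<Longrightarrow> \<exists>t. X t = x"
      by (rule sine_field_flow_exists[OF cont]) ((rule bnd'; assumption), (rule that; assumption))
    have bnd'': "\<bar>ev (pderiv q) \<eta> t\<bar> \<le> 1/10" if "0 \<le> t" "t \<le> 1" for t
      using small(2)[OF that] by (simp add: q')
    have "sine_flow (ev q \<eta>) (ev (pderiv q) \<eta>) X"
      by (rule sine_flow.intro) (fact bnd ev_has_derivative_t bnd'' X)+
    then show "\<exists>X. sine_flow (ev q \<eta>) (ev (pderiv q) \<eta>) X" by blast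
  qed
qed

text \<open>
  The value of the \<open>j\<close>-th power of the derivation applied to the coordinate function, see the
  description of \<open>iter_field\<close>; hence the \<open>j\<close>-th derivative of an orbit.
\<close>

definition iter_value :: "real poly poly \<Rightarrow> real \<Rightarrow> nat \<Rightarrow> real \<Rightarrow> real" where
  "iter_value q \<eta> j x = (if j = 0 then x else
     sin (pi * x) * (if even j then cos (pi * x) else 1) * ev (iter_field q (j - 1)) \<eta> ((sin (pi * x))\<^sup>2))"

lemma iter_value_derivative:
  assumes "sine_flow (ev q \<eta>) (ev (pderiv q) \<eta>) X"
  shows "((\<lambda>t. iter_value q \<eta> j (X t)) has_real_derivative iter_value q \<eta> (Suc j) (X t)) (at t)"
proof -
  interpret sine_flow "ev q \<eta>" "ev (pderiv q) \<eta>" X by (rule assms)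
  let ?s = "sin (pi * X t)" and ?c = "cos (pi * X t)"
  let ?q = "ev q \<eta> (?s\<^sup>2)"
  have Xd: "(X has_real_derivative ?s * ?q) (at t)" by (rule X_deriv)
  have sd: "((\<lambda>t. sin (pi * X t)) has_real_derivative ?c * (pi * (?s * ?q))) (at t)"
    by (rule derivative_eq_intros Xd refl)+ simp
  have cd: "((\<lambda>t. cos (pi * X t)) has_real_derivative - ?s * (pi * (?s * ?q))) (at t)"
    by (rule derivative_eq_intros Xd refl)+ simp
  have s2d: "((\<lambda>t. (sin (pi * X t))\<^sup>2) has_real_derivative 2 * ?s * (?c * (pi * (?s * ?q)))) (at t)"
    by (rule derivative_eq_intros sd refl)+ simp
  have Pd: "((\<lambda>t. ev P \<eta> ((sin (pi * X t))\<^sup>2)) has_real_derivative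
      ev (pderiv P) \<eta> (?s\<^sup>2) * (2 * ?s * (?c * (pi * (?s * ?q))))) (at t)" for P
    by (rule DERIV_chain2[OF ev_has_derivative_t s2d])
  have c2: "?c * ?c = 1 - ?s * ?s" using sin_cos_squared_add[of "pi * X t"] by (simp add: power2_eq_square)
  consider "j = 0" | i where "j = Suc i" "even i" | i where "j = Suc i" "odd i" by (cases j) auto
  then show ?thesis
  proof cases
    case 1
    then show ?thesis using Xd by (simp add: iter_value_def)
  next
    case (2 i)
    let ?P = "iter_field q i"
    have "((\<lambda>t. sin (pi * X t) * ev ?P \<eta> ((sin (pi * X t))\<^sup>2)) has_real_derivative
        ?c * (pi * (?s * ?q)) * ev ?P \<eta> (?s\<^sup>2) + ?s * (ev (pderiv ?P) \<eta> (?s\<^sup>2) * (2 * ?s * (?c * (pi * (?s * ?q)))))) (at t)"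
      by (rule derivative_eq_intros sd Pd refl)+ (simp add: algebra_simps)
    moreover have "?c * (pi * (?s * ?q)) * ev ?P \<eta> (?s\<^sup>2) + ?s * (ev (pderiv ?P) \<eta> (?s\<^sup>2) * (2 * ?s * (?c * (pi * (?s * ?q)))))
        = iter_value q \<eta> (Suc j) (X t)"
      using 2 by (simp add: iter_value_def ev_simps(6)[of 2, unfolded cst_numeral] power2_eq_square algebra_simps)
    ultimately show ?thesis using 2 by (simp add: iter_value_def)
  next
    case (3 i)
    let ?P = "iter_field q i"
    let ?dP = "ev (pderiv ?P) \<eta> (?s\<^sup>2)" and ?eP = "ev ?P \<eta> (?s\<^sup>2)"
    have "((\<lambda>t. sin (pi * X t) * cos (pi * X t) * ev ?P \<eta> ((sin (pi * X t))\<^sup>2)) has_real_derivative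
        (?c * (pi * (?s * ?q)) * ?c + ?s * (- ?s * (pi * (?s * ?q)))) * ?eP
          + ?s * ?c * (?dP * (2 * ?s * (?c * (pi * (?s * ?q)))))) (at t)"
      by (rule derivative_eq_intros sd cd Pd refl)+ (simp add: algebra_simps)
    moreover have "(?c * (pi * (?s * ?q)) * ?c + ?s * (- ?s * (pi * (?s * ?q)))) * ?eP
          + ?s * ?c * (?dP * (2 * ?s * (?c * (pi * (?s * ?q)))))
        = ?s * (pi * ?q * ((?c * ?c - ?s * ?s) * ?eP + 2 * (?s * ?s) * (?c * ?c) * ?dP))"
      by (simp add: algebra_simps)
    moreover have "\<dots> = iter_value q \<eta> (Suc j) (X t)"
      unfolding c2 using 3 by (simp add: iter_value_def ev_simps(6)[of 2, unfolded cst_numeral] power2_eq_square)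
    ultimately show ?thesis using 3 by (simp add: iter_value_def)
  qed
qed

text \<open>
  The factor \<open>sin (\<pi> x)\<close> in the remainder is essential. Near the saddles it makes the error small
  compared with the distance from the saddle.
\<close>

lemma shift_taylor:
  assumes flow: "sine_flow (ev q \<eta>) (ev (pderiv q) \<eta>) X" and x: "0 < x" "x < 1"
    and e: "\<bar>e\<bar> \<le> 1/100" and n: "n \<ge> 1"
    and C: "\<And>t. 0 \<le> t \<Longrightarrow> t \<le> 1 \<Longrightarrow> \<bar>ev (iter_field q (n - 1)) \<eta> t\<bar> \<le> C"
  shows "\<bar>sine_flow.shift X e x - (\<Sum>m<n. iter_value q \<eta> m x / fact m * e ^ m)\<bar>
    \<le> 2 * C * sin (pi * x) * \<bar>e\<bar> ^ n"
proof -
  interpret sine_flow "ev q \<eta>" "ev (pderiv q) \<eta>" X by (rule flow)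
  obtain t where t: "x = X t" using X_onto x by metis
  let ?D = "\<lambda>m h. iter_value q \<eta> m (X (h + t))"
  have "\<forall>m h. (?D m has_real_derivative ?D (Suc m) h) (at h)"
  proof (intro allI)
    fix m h
    show "(?D m has_real_derivative ?D (Suc m) h) (at h)"
      using iter_value_derivative[OF flow, of m "h + t"]
        DERIV_shift[of "\<lambda>t. iter_value q \<eta> m (X t)" "iter_value q \<eta> (Suc m) (X (h + t))" h t] by simp
  qed
  then obtain h where h: "\<bar>h\<bar> \<le> \<bar>e\<bar>"
    and eq: "?D 0 e = (\<Sum>m<n. ?D m 0 / fact m * e ^ m) + ?D n h / fact n * e ^ n"
    using Maclaurin_all_le[of ?D "?D 0" e n] by blast
  have s: "0 < sin (pi * X (h + t))" by (rule sin_X)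
  have "\<bar>?D n h\<bar> \<le> (sin (pi * X (h + t)) * 1) * C"
  proof -
    have "\<bar>?D n h\<bar> = (sin (pi * X (h + t)) * (if even n then \<bar>cos (pi * X (h + t))\<bar> else 1)) *
        \<bar>ev (iter_field q (n - 1)) \<eta> ((sin (pi * X (h + t)))\<^sup>2)\<bar>"
      using n s by (simp add: iter_value_def abs_mult)
    also have "\<dots> \<le> (sin (pi * X (h + t)) * 1) * C"
      using s C[OF sin_sq, of "pi * X (h + t)"] by (intro mult_mono) auto
    finally show ?thesis .
  qed
  also have "\<dots> \<le> (2 * sin (pi * x) * 1) * C"
  proof -
    have "0 \<le> C" using C[of 0] by linarith
    then show ?thesis
      using sin_X_ratio[of h t] h e by (intro mult_right_mono) (auto simp: t add.commute)
  qed
  finally have D: "\<bar>?D n h\<bar> \<le> 2 * C * sin (pi * x)" by (simp add: mult_ac)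
  have "\<bar>?D n h / fact n * e ^ n\<bar> \<le> \<bar>?D n h\<bar> * \<bar>e\<bar> ^ n"
  proof -
    have "\<bar>?D n h\<bar> / fact n \<le> \<bar>?D n h\<bar> / 1" by (intro divide_left_mono) (auto simp: fact_ge_1)
    then have "\<bar>?D n h\<bar> / fact n * \<bar>e\<bar> ^ n \<le> \<bar>?D n h\<bar> * \<bar>e\<bar> ^ n" by (intro mult_right_mono) auto
    moreover have "\<bar>?D n h / fact n * e ^ n\<bar> = \<bar>?D n h\<bar> / fact n * \<bar>e\<bar> ^ n" by (simp add: abs_mult power_abs)
    ultimately show ?thesis by (simp only:)
  qed
  also have "\<dots> \<le> 2 * C * sin (pi * x) * \<bar>e\<bar> ^ n" using D by (intro mult_right_mono) auto
  finally show ?thesis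
    using eq by (simp add: t iter_value_def add.commute)
qed

text \<open>
  With \<open>N = K + 1\<close> the Taylor remainder has the order \<open>\<epsilon> ^ (2 * K + 6)\<close>. It is then smaller by
  \<open>\<epsilon>\<^sup>2\<close> than the prescribed defect of order \<open>\<epsilon> ^ (2 * K + 2) * cos (\<pi> x)\<close> even at the edge of the bump,
  where the cosine is only of order \<open>\<epsilon>\<^sup>2\<close>.
\<close>

lemma shift_second_difference:
  assumes q: "defect (Suc N) q = eta ^ K * (cst (4 * pi * \<sigma>) + eta * R)" and N: "N = K + 1"
  obtains C where "C \<ge> 0"
    "\<And>\<epsilon> X x. 0 < \<epsilon> \<Longrightarrow> \<epsilon> \<le> 1/100 \<Longrightarrow> sine_flow (ev q (\<epsilon>\<^sup>2)) (ev (pderiv q) (\<epsilon>\<^sup>2)) X \<Longrightarrow> 0 < x \<Longrightarrow> x < 1 \<Longrightarrow>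
      \<bar>sine_flow.shift X \<epsilon> x + sine_flow.shift X (- \<epsilon>) x - 2 * x
        - 4 * pi * \<epsilon>\<^sup>2 * sin (pi * x) * cos (pi * x) * (1 + \<sigma> * \<epsilon> ^ (2 * K))\<bar>
      \<le> C * \<epsilon> ^ (2 * K + 4) * sin (pi * x) * (\<bar>cos (pi * x)\<bar> + \<epsilon>\<^sup>2)"
proof -
  define n where "n = 2 * (N + 2)"
  obtain C1 where C1: "C1 \<ge> 0" "\<And>\<eta> t. 0 \<le> \<eta> \<Longrightarrow> \<eta> \<le> 1 \<Longrightarrow> 0 \<le> t \<Longrightarrow> t \<le> 1 \<Longrightarrow> \<bar>ev R \<eta> t\<bar> \<le> C1"
    using ev_bounded[of R] by blast
  obtain C2 where C2: "C2 \<ge> 0" "\<And>\<eta> t. 0 \<le> \<eta> \<Longrightarrow> \<eta> \<le> 1 \<Longrightarrow> 0 \<le> t \<Longrightarrow> t \<le> 1 \<Longrightarrow> \<bar>ev (iter_field q (n - 1)) \<eta> t\<bar> \<le> C2"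
    using ev_bounded[of "iter_field q (n - 1)"] by blast
  show ?thesis
  proof (rule that[of "C1 + 4 * C2"])
    show "C1 + 4 * C2 \<ge> 0" using C1 C2 by simp
    fix \<epsilon> x :: real and X
    assume \<epsilon>: "0 < \<epsilon>" "\<epsilon> \<le> 1/100" and flow: "sine_flow (ev q (\<epsilon>\<^sup>2)) (ev (pderiv q) (\<epsilon>\<^sup>2)) X"
      and x: "0 < x" "x < 1"
    have \<eta>: "0 \<le> \<epsilon>\<^sup>2" "\<epsilon>\<^sup>2 \<le> 1" using \<epsilon> by (auto simp: power_le_one)
    define s c where "s = sin (pi * x)" and "c = cos (pi * x)"
    have s: "s > 0" unfolding s_def using x by (intro sin_gt_zero) auto
    have s2: "0 \<le> s\<^sup>2" "s\<^sup>2 \<le> 1" unfolding s_def by (auto simp: abs_square_le_1)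
    let ?v = "iter_value q (\<epsilon>\<^sup>2)"
    let ?T = "\<lambda>e. (\<Sum>m<n. ?v m x / fact m * e ^ m)"
    let ?p = "sine_flow.shift X \<epsilon> x" and ?m = "sine_flow.shift X (- \<epsilon>) x"
    have t1: "\<bar>?p - ?T \<epsilon>\<bar> \<le> 2 * C2 * s * \<epsilon> ^ n"
      using shift_taylor[OF flow x, of \<epsilon> n C2] \<epsilon> C2(2)[OF \<eta>] by (simp add: n_def s_def)
    have t2: "\<bar>?m - ?T (- \<epsilon>)\<bar> \<le> 2 * C2 * s * \<epsilon> ^ n"
      using shift_taylor[OF flow x, of "- \<epsilon>" n C2] \<epsilon> C2(2)[OF \<eta>] by (simp add: n_def s_def)
    have "?T \<epsilon> + ?T (- \<epsilon>) = (\<Sum>m<2 * (N + 2). ?v m x / fact m * (\<epsilon> ^ m + (- \<epsilon>) ^ m))"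
      by (simp add: n_def sum.distrib distrib_left)
    also have "\<dots> = (\<Sum>k<Suc (Suc N). 2 * (?v (2 * k) x / fact (2 * k) * \<epsilon> ^ (2 * k)))"
      unfolding sum_even_odd_pairs by (intro sum.cong) simp_all
    also have "\<dots> = 2 * x + (\<Sum>k<Suc N. 2 * (?v (2 * k + 2) x / fact (2 * k + 2) * \<epsilon> ^ (2 * k + 2)))"
      unfolding sum.lessThan_Suc_shift[of _ "Suc N"] by (simp add: iter_value_def)
    also have "(\<Sum>k<Suc N. 2 * (?v (2 * k + 2) x / fact (2 * k + 2) * \<epsilon> ^ (2 * k + 2)))
        = \<epsilon>\<^sup>2 * (s * c) * (\<Sum>k<Suc N. 2 / fact (2 * k + 2) * (\<epsilon>\<^sup>2) ^ k * ev (iter_field q (2 * k + 1)) (\<epsilon>\<^sup>2) (s\<^sup>2))"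
      unfolding sum_distrib_left
    proof (intro sum.cong refl)
      fix k
      have "?v (2 * k + 2) x = s * c * ev (iter_field q (2 * k + 1)) (\<epsilon>\<^sup>2) (s\<^sup>2)"
        by (simp add: iter_value_def s_def c_def del: iter_field.simps)
      moreover have "\<epsilon> ^ (2 * k + 2) = (\<epsilon>\<^sup>2) ^ k * \<epsilon>\<^sup>2" by (simp only: power_add power_mult)
      ultimately show "2 * (?v (2 * k + 2) x / fact (2 * k + 2) * \<epsilon> ^ (2 * k + 2)) =
          \<epsilon>\<^sup>2 * (s * c) * (2 / fact (2 * k + 2) * (\<epsilon>\<^sup>2) ^ k * ev (iter_field q (2 * k + 1)) (\<epsilon>\<^sup>2) (s\<^sup>2))"
        by (simp only:) (simp del: fact_Suc iter_field.simps)
    qed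
    also have "(\<Sum>k<Suc N. 2 / fact (2 * k + 2) * (\<epsilon>\<^sup>2) ^ k * ev (iter_field q (2 * k + 1)) (\<epsilon>\<^sup>2) (s\<^sup>2))
        = ev (defect (Suc N) q) (\<epsilon>\<^sup>2) (s\<^sup>2) + 4 * pi"
      unfolding defect_def by (simp del: fact_Suc iter_field.simps sum.lessThan_Suc)
    also have "ev (defect (Suc N) q) (\<epsilon>\<^sup>2) (s\<^sup>2) = \<epsilon> ^ (2 * K) * (4 * pi * \<sigma> + \<epsilon>\<^sup>2 * ev R (\<epsilon>\<^sup>2) (s\<^sup>2))"
      unfolding q by (simp add: power_mult)
    finally have T0: "?T \<epsilon> + ?T (- \<epsilon>) = 2 * x + \<epsilon>\<^sup>2 * (s * c) *
        (\<epsilon> ^ (2 * K) * (4 * pi * \<sigma> + \<epsilon>\<^sup>2 * ev R (\<epsilon>\<^sup>2) (s\<^sup>2)) + 4 * pi)" .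
    have T: "?T \<epsilon> + ?T (- \<epsilon>) - 2 * x - 4 * pi * \<epsilon>\<^sup>2 * s * c * (1 + \<sigma> * \<epsilon> ^ (2 * K))
        = \<epsilon> ^ (2 * K + 4) * s * (c * ev R (\<epsilon>\<^sup>2) (s\<^sup>2))"
    proof -
      have "\<epsilon> ^ (2 * K + 4) = \<epsilon> ^ (2 * K) * (\<epsilon>\<^sup>2 * \<epsilon>\<^sup>2)"
        by (simp add: power_add eval_nat_numeral)
      then show ?thesis unfolding T0 by (simp add: algebra_simps)
    qed
    have n': "\<epsilon> ^ n = \<epsilon> ^ (2 * K + 4) * \<epsilon>\<^sup>2" 
    proof -
      have "n = (2 * K + 4) + 2" by (simp add: n_def N)
      then show ?thesis by (simp only: power_add)
    qed
    let ?E = "\<epsilon> ^ (2 * K + 4) * s"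
    have E: "?E \<ge> 0" using \<epsilon> s by simp
    have "\<bar>c * ev R (\<epsilon>\<^sup>2) (s\<^sup>2)\<bar> \<le> \<bar>c\<bar> * C1"
      unfolding abs_mult using C1(2)[OF \<eta> s2] by (intro mult_left_mono) auto
    then have "\<bar>?E * (c * ev R (\<epsilon>\<^sup>2) (s\<^sup>2))\<bar> \<le> ?E * (\<bar>c\<bar> * C1)"
      unfolding abs_mult[of ?E] abs_of_nonneg[OF E] using E by (rule mult_left_mono)
    then have "\<bar>?p + ?m - 2 * x - 4 * pi * \<epsilon>\<^sup>2 * s * c * (1 + \<sigma> * \<epsilon> ^ (2 * K))\<bar>
        \<le> ?E * (\<bar>c\<bar> * C1) + 4 * C2 * s * \<epsilon> ^ n"
      using t1 t2 T by linarith
    also have "\<dots> = ?E * (C1 * \<bar>c\<bar> + 4 * C2 * \<epsilon>\<^sup>2)"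
      unfolding n' by (simp add: algebra_simps)
    also have "\<dots> \<le> ?E * ((C1 + 4 * C2) * (\<bar>c\<bar> + \<epsilon>\<^sup>2))"
      using E C1(1) C2(1) by (intro mult_left_mono) (auto simp: algebra_simps)
    finally show "\<bar>?p + ?m - 2 * x - 4 * pi * \<epsilon>\<^sup>2 * sin (pi * x) * cos (pi * x) * (1 + \<sigma> * \<epsilon> ^ (2 * K))\<bar>
      \<le> (C1 + 4 * C2) * \<epsilon> ^ (2 * K + 4) * sin (pi * x) * (\<bar>cos (pi * x)\<bar> + \<epsilon>\<^sup>2)"
      by (simp add: s_def c_def algebra_simps)
  qed
qed

text \<open>
  Fields that agree modulo \<open>eta ^ K\<close> have Taylor coefficients that agree modulo \<open>eta ^ K\<close>.
\<close>

lemma shift_congruence: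
  assumes d: "eta ^ K dvd q1 - q2" and K: "K \<ge> 1"
  obtains C where "C \<ge> 0"
    "\<And>\<epsilon> X1 X2 x. 0 < \<epsilon> \<Longrightarrow> \<epsilon> \<le> 1/100 \<Longrightarrow> sine_flow (ev q1 (\<epsilon>\<^sup>2)) (ev (pderiv q1) (\<epsilon>\<^sup>2)) X1 \<Longrightarrow>
      sine_flow (ev q2 (\<epsilon>\<^sup>2)) (ev (pderiv q2) (\<epsilon>\<^sup>2)) X2 \<Longrightarrow> 0 < x \<Longrightarrow> x < 1 \<Longrightarrow>
      \<bar>sine_flow.shift X1 (- \<epsilon>) x - sine_flow.shift X2 (- \<epsilon>) x\<bar> \<le> C * \<epsilon> ^ (2 * K)"
proof -
  define n where "n = 2 * K"
  have n: "n \<ge> 1" using K by (simp add: n_def)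
  obtain C1 where C1: "C1 \<ge> 0" "\<And>\<eta> t. 0 \<le> \<eta> \<Longrightarrow> \<eta> \<le> 1 \<Longrightarrow> 0 \<le> t \<Longrightarrow> t \<le> 1 \<Longrightarrow> \<bar>ev (iter_field q1 (n - 1)) \<eta> t\<bar> \<le> C1"
    using ev_bounded[of "iter_field q1 (n - 1)"] by blast
  obtain C2 where C2: "C2 \<ge> 0" "\<And>\<eta> t. 0 \<le> \<eta> \<Longrightarrow> \<eta> \<le> 1 \<Longrightarrow> 0 \<le> t \<Longrightarrow> t \<le> 1 \<Longrightarrow> \<bar>ev (iter_field q2 (n - 1)) \<eta> t\<bar> \<le> C2"
    using ev_bounded[of "iter_field q2 (n - 1)"] by blast
  have "\<forall>i. \<exists>Q. iter_field q1 i - iter_field q2 i = eta ^ K * Q"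
    using iter_field_cong[OF d] by (auto simp: dvd_def)
  then obtain Q where Q: "\<And>i. iter_field q1 i - iter_field q2 i = eta ^ K * Q i" by metis
  have "\<forall>i. \<exists>B. B \<ge> 0 \<and> (\<forall>\<eta> t. 0 \<le> \<eta> \<longrightarrow> \<eta> \<le> 1 \<longrightarrow> 0 \<le> t \<longrightarrow> t \<le> 1 \<longrightarrow> \<bar>ev (Q i) \<eta> t\<bar> \<le> B)"
    using ev_bounded by metis
  then obtain B where B: "\<And>i. B i \<ge> 0"
      "\<And>i \<eta> t. 0 \<le> \<eta> \<Longrightarrow> \<eta> \<le> 1 \<Longrightarrow> 0 \<le> t \<Longrightarrow> t \<le> 1 \<Longrightarrow> \<bar>ev (Q i) \<eta> t\<bar> \<le> B i" by metis
  define C where "C = 2 * C1 + 2 * C2 + (\<Sum>m<n. B (m - 1))"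
  show ?thesis
  proof (rule that[of C])
    show "C \<ge> 0" unfolding C_def using C1 C2 B by (intro add_nonneg_nonneg sum_nonneg) auto
    fix \<epsilon> x :: real and X1 X2
    assume \<epsilon>: "0 < \<epsilon>" "\<epsilon> \<le> 1/100" and x: "0 < x" "x < 1"
      and flow1: "sine_flow (ev q1 (\<epsilon>\<^sup>2)) (ev (pderiv q1) (\<epsilon>\<^sup>2)) X1"
      and flow2: "sine_flow (ev q2 (\<epsilon>\<^sup>2)) (ev (pderiv q2) (\<epsilon>\<^sup>2)) X2"
    have \<eta>: "0 \<le> \<epsilon>\<^sup>2" "\<epsilon>\<^sup>2 \<le> 1" using \<epsilon> by (auto simp: power_le_one)
    let ?s = "sin (pi * x)"
    have s: "0 < ?s" "?s \<le> 1" using x by (auto intro!: sin_gt_zero)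
    have s2: "0 \<le> ?s\<^sup>2" "?s\<^sup>2 \<le> 1" by (auto simp: abs_square_le_1)
    let ?T = "\<lambda>q. (\<Sum>m<n. iter_value q (\<epsilon>\<^sup>2) m x / fact m * (- \<epsilon>) ^ m)"
    have rem: "2 * C * ?s * \<epsilon> ^ n \<le> 2 * C * \<epsilon> ^ n" if "C \<ge> 0" for C :: real
    proof -
      have "(2 * C * \<epsilon> ^ n) * ?s \<le> (2 * C * \<epsilon> ^ n) * 1"
        using s that \<epsilon> by (intro mult_left_mono) auto
      then show ?thesis by (simp add: mult_ac)
    qed
    have t1: "\<bar>sine_flow.shift X1 (- \<epsilon>) x - ?T q1\<bar> \<le> 2 * C1 * \<epsilon> ^ n"
      using shift_taylor[OF flow1 x _ n, of "- \<epsilon>" C1] \<epsilon> C1(2)[OF \<eta>] rem[OF C1(1)] by simp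
    have t2: "\<bar>sine_flow.shift X2 (- \<epsilon>) x - ?T q2\<bar> \<le> 2 * C2 * \<epsilon> ^ n"
      using shift_taylor[OF flow2 x _ n, of "- \<epsilon>" C2] \<epsilon> C2(2)[OF \<eta>] rem[OF C2(1)] by simp
    have trm: "\<bar>iter_value q1 (\<epsilon>\<^sup>2) m x / fact m * (- \<epsilon>) ^ m - iter_value q2 (\<epsilon>\<^sup>2) m x / fact m * (- \<epsilon>) ^ m\<bar>
        \<le> B (m - 1) * \<epsilon> ^ n" for m
    proof (cases "m = 0")
      case True
      then show ?thesis using B \<epsilon> by (simp add: iter_value_def)
    next
      case False
      let ?k = "if even m then cos (pi * x) else 1"
      have "ev (iter_field q1 (m - 1)) (\<epsilon>\<^sup>2) (?s\<^sup>2) - ev (iter_field q2 (m - 1)) (\<epsilon>\<^sup>2) (?s\<^sup>2)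
          = \<epsilon> ^ n * ev (Q (m - 1)) (\<epsilon>\<^sup>2) (?s\<^sup>2)"
        using arg_cong[OF Q[of "m - 1"], of "\<lambda>P. ev P (\<epsilon>\<^sup>2) (?s\<^sup>2)"] by (simp add: n_def power_mult)
      moreover have "iter_value q1 (\<epsilon>\<^sup>2) m x / fact m * (- \<epsilon>) ^ m - iter_value q2 (\<epsilon>\<^sup>2) m x / fact m * (- \<epsilon>) ^ m
          = (?s * ?k) * ((- \<epsilon>) ^ m / fact m) * (ev (iter_field q1 (m - 1)) (\<epsilon>\<^sup>2) (?s\<^sup>2) - ev (iter_field q2 (m - 1)) (\<epsilon>\<^sup>2) (?s\<^sup>2))"
        using False by (simp add: iter_value_def algebra_simps diff_divide_distrib)
      ultimately have "\<bar>iter_value q1 (\<epsilon>\<^sup>2) m x / fact m * (- \<epsilon>) ^ m - iter_value q2 (\<epsilon>\<^sup>2) m x / fact m * (- \<epsilon>) ^ m\<bar>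
          = \<bar>?s * ?k\<bar> * \<bar>(- \<epsilon>) ^ m / fact m\<bar> * (\<epsilon> ^ n * \<bar>ev (Q (m - 1)) (\<epsilon>\<^sup>2) (?s\<^sup>2)\<bar>)"
        using \<epsilon> by (simp only: abs_mult) simp
      also have "\<dots> \<le> (1 * 1) * (\<epsilon> ^ n * B (m - 1))"
      proof (intro mult_mono mult_left_mono)
        show "\<bar>?s * ?k\<bar> \<le> 1" using s by (auto simp: abs_mult intro!: mult_le_one)
        have "\<epsilon> ^ m \<le> 1" using \<epsilon> by (intro power_le_one) auto
        moreover have "fact m \<ge> (1 :: real)" by (rule fact_ge_1)
        ultimately have "\<epsilon> ^ m \<le> fact m" by linarith
        then show "\<bar>(- \<epsilon>) ^ m / fact m\<bar> \<le> 1" using \<epsilon> by (simp add: power_abs divide_le_eq_1)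
        show "\<bar>ev (Q (m - 1)) (\<epsilon>\<^sup>2) (?s\<^sup>2)\<bar> \<le> B (m - 1)" using B(2)[OF \<eta> s2] .
      qed (use \<epsilon> in auto)
      finally show ?thesis by (simp add: mult.commute)
    qed
    have "\<bar>?T q1 - ?T q2\<bar> \<le> (\<Sum>m<n. B (m - 1) * \<epsilon> ^ n)"
      unfolding sum_subtractf[symmetric] by (rule order_trans[OF sum_abs sum_mono[OF trm]])
    then have "\<bar>?T q1 - ?T q2\<bar> \<le> (\<Sum>m<n. B (m - 1)) * \<epsilon> ^ n" by (simp add: sum_distrib_right)
    then have "\<bar>sine_flow.shift X1 (- \<epsilon>) x - sine_flow.shift X2 (- \<epsilon>) x\<bar>
        \<le> 2 * C1 * \<epsilon> ^ n + 2 * C2 * \<epsilon> ^ n + (\<Sum>m<n. B (m - 1)) * \<epsilon> ^ n"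
      using t1 t2 by linarith
    also have "\<dots> = C * \<epsilon> ^ (2 * K)" by (simp add: C_def n_def distrib_right)
    finally show "\<bar>sine_flow.shift X1 (- \<epsilon>) x - sine_flow.shift X2 (- \<epsilon>) x\<bar> \<le> C * \<epsilon> ^ (2 * K)" .
  qed
qed

lemma sin_double_pi: "sin (2 * pi * x) = 2 * sin (pi * x) * cos (pi * x)"
  using sin_double[of "pi * x"] by (simp add: mult.assoc)

text \<open>
  The flow \<open>Xl\<close> approximates the unstable separatrix of 0 and \<open>Xr\<close> the stable separatrix of 1.
  All inequalities bound a second difference from above by the pendulum force. Outside the bump, on the
  side on which each flow is used, there is no error term: a subsolution behind \<open>Xl\<close> was
  behind it before, and one ahead of \<open>Xr\<close> stays ahead. At the bump an error \<open>\<kappa>\<close> is allowed, also for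
  the combination that arrives along \<open>Xl\<close> and leaves along \<open>Xr\<close>.
\<close>

definition separatrices :: "real \<Rightarrow> real \<Rightarrow> (real \<Rightarrow> real) \<Rightarrow> (real \<Rightarrow> real) \<Rightarrow> bool" where
  "separatrices \<epsilon> \<kappa> Xl Xr \<longleftrightarrow>
    (\<exists>p p'. sine_flow p p' Xl) \<and> (\<exists>p p'. sine_flow p p' Xr) \<and>
    (\<forall>x. 0 < x \<longrightarrow> x < 1/2 - \<epsilon>\<^sup>2 \<longrightarrow>
      sine_flow.shift Xl \<epsilon> x + sine_flow.shift Xl (- \<epsilon>) x - 2 * x \<le> 2 * pi * \<epsilon>\<^sup>2 * sin (2 * pi * x)) \<and>
    (\<forall>x. 1/2 + \<epsilon>\<^sup>2 < x \<longrightarrow> x < 1 \<longrightarrow>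
      sine_flow.shift Xr \<epsilon> x + sine_flow.shift Xr (- \<epsilon>) x - 2 * x \<le> 2 * pi * \<epsilon>\<^sup>2 * sin (2 * pi * x)) \<and>
    (\<forall>x. 0 < x \<longrightarrow> x < 1 \<longrightarrow>
      sine_flow.shift Xl \<epsilon> x + sine_flow.shift Xl (- \<epsilon>) x - 2 * x
        \<le> 2 * pi * \<epsilon>\<^sup>2 * sin (2 * pi * x) + \<kappa>) \<and>
    (\<forall>x. 0 < x \<longrightarrow> x < 1 \<longrightarrow>
      sine_flow.shift Xr \<epsilon> x + sine_flow.shift Xl (- \<epsilon>) x - 2 * x
        \<le> 2 * pi * \<epsilon>\<^sup>2 * sin (2 * pi * x) + \<kappa>)"

text \<open>
  Both flows come from \<open>formal_strict_solution\<close>, with \<open>\<sigma> = -1\<close> on the left and \<open>\<sigma> = 1\<close> on the right.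
  The error \<open>4 * \<pi> * \<sigma> * \<epsilon> ^ (2 * K + 2) * sin (\<pi> x) * cos (\<pi> x)\<close> is then negative on both sides, since the
  cosine changes sign at \<open>1/2\<close>.
\<close>

lemma approximate_separatrices:
  assumes K: "K \<ge> 1"
  obtains \<epsilon>0 C where "0 < \<epsilon>0" "\<epsilon>0 \<le> 1/100" "C \<ge> 0"
    "\<And>\<epsilon>. 0 < \<epsilon> \<Longrightarrow> \<epsilon> \<le> \<epsilon>0 \<Longrightarrow> \<exists>Xl Xr. separatrices \<epsilon> (C * \<epsilon> ^ (2 * K)) Xl Xr"
proof -
  obtain q R where q: "\<And>\<sigma>. eta dvd q \<sigma> - cst 2" "\<And>\<sigma> \<tau>. eta ^ K dvd q \<sigma> - q \<tau>"
    "\<And>\<sigma>. defect (Suc (K + 1)) (q \<sigma>) = eta ^ K * (cst (4 * pi * \<sigma>) + eta * R \<sigma>)"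
    using formal_strict_solution[OF K] by metis
  obtain \<eta>l where \<eta>l: "0 < \<eta>l" "\<eta>l \<le> 1"
    "\<And>\<eta>. 0 < \<eta> \<Longrightarrow> \<eta> \<le> \<eta>l \<Longrightarrow> \<exists>X. sine_flow (ev (q (-1)) \<eta>) (ev (pderiv (q (-1))) \<eta>) X"
    using sine_flow_for_small_eta[OF q(1)] by metis
  obtain \<eta>r where \<eta>r: "0 < \<eta>r" "\<eta>r \<le> 1"
    "\<And>\<eta>. 0 < \<eta> \<Longrightarrow> \<eta> \<le> \<eta>r \<Longrightarrow> \<exists>X. sine_flow (ev (q 1) \<eta>) (ev (pderiv (q 1)) \<eta>) X"
    using sine_flow_for_small_eta[OF q(1)] by metis
  have "\<exists>C\<ge>0. \<forall>\<epsilon> X x. 0 < \<epsilon> \<longrightarrow> \<epsilon> \<le> 1/100 \<longrightarrow> sine_flow (ev (q \<sigma>) (\<epsilon>\<^sup>2)) (ev (pderiv (q \<sigma>)) (\<epsilon>\<^sup>2)) X \<longrightarrow>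
      0 < x \<longrightarrow> x < 1 \<longrightarrow>
      \<bar>sine_flow.shift X \<epsilon> x + sine_flow.shift X (- \<epsilon>) x - 2 * x
        - 4 * pi * \<epsilon>\<^sup>2 * sin (pi * x) * cos (pi * x) * (1 + \<sigma> * \<epsilon> ^ (2 * K))\<bar>
      \<le> C * \<epsilon> ^ (2 * K + 4) * sin (pi * x) * (\<bar>cos (pi * x)\<bar> + \<epsilon>\<^sup>2)" for \<sigma>
    by (rule shift_second_difference[OF q(3) refl, of \<sigma>]) blast
  then obtain C0 where C0: "\<And>\<sigma>. C0 \<sigma> \<ge> 0"
    "\<And>\<sigma> \<epsilon> X x. 0 < \<epsilon> \<Longrightarrow> \<epsilon> \<le> 1/100 \<Longrightarrow> sine_flow (ev (q \<sigma>) (\<epsilon>\<^sup>2)) (ev (pderiv (q \<sigma>)) (\<epsilon>\<^sup>2)) X \<Longrightarrow>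
      0 < x \<Longrightarrow> x < 1 \<Longrightarrow>
      \<bar>sine_flow.shift X \<epsilon> x + sine_flow.shift X (- \<epsilon>) x - 2 * x
        - 4 * pi * \<epsilon>\<^sup>2 * sin (pi * x) * cos (pi * x) * (1 + \<sigma> * \<epsilon> ^ (2 * K))\<bar>
      \<le> C0 \<sigma> * \<epsilon> ^ (2 * K + 4) * sin (pi * x) * (\<bar>cos (pi * x)\<bar> + \<epsilon>\<^sup>2)"
    by metis
  define D where "D = C0 1 + C0 (-1)"
  have D: "D \<ge> 0" "C0 1 \<le> D" "C0 (-1) \<le> D" using C0(1)[of 1] C0(1)[of "-1"] by (auto simp: D_def)
  obtain B where B: "B \<ge> 0"
    "\<And>\<epsilon> X1 X2 x. 0 < \<epsilon> \<Longrightarrow> \<epsilon> \<le> 1/100 \<Longrightarrow> sine_flow (ev (q (-1)) (\<epsilon>\<^sup>2)) (ev (pderiv (q (-1))) (\<epsilon>\<^sup>2)) X1 \<Longrightarrow>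
      sine_flow (ev (q 1) (\<epsilon>\<^sup>2)) (ev (pderiv (q 1)) (\<epsilon>\<^sup>2)) X2 \<Longrightarrow> 0 < x \<Longrightarrow> x < 1 \<Longrightarrow>
      \<bar>sine_flow.shift X1 (- \<epsilon>) x - sine_flow.shift X2 (- \<epsilon>) x\<bar> \<le> B * \<epsilon> ^ (2 * K)"
    by (rule shift_congruence[OF q(2) K, of "-1" 1]) blast
  define \<epsilon>0 where "\<epsilon>0 = min (min \<eta>l \<eta>r) (1 / (100 * (1 + D)))"
  have \<epsilon>0: "0 < \<epsilon>0" "\<epsilon>0 \<le> \<eta>l" "\<epsilon>0 \<le> \<eta>r" "\<epsilon>0 * D \<le> 1"
  proof -
    show "0 < \<epsilon>0" "\<epsilon>0 \<le> \<eta>l" "\<epsilon>0 \<le> \<eta>r" using \<eta>l(1) \<eta>r(1) D(1) by (auto simp: \<epsilon>0_def)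
    have "\<epsilon>0 * D \<le> 1 / (100 * (1 + D)) * D" using D by (intro mult_right_mono) (auto simp: \<epsilon>0_def)
    also have "\<dots> \<le> 1" using D by (simp add: divide_simps)
    finally show "\<epsilon>0 * D \<le> 1" .
  qed
  have \<epsilon>0': "\<epsilon>0 \<le> 1/100"
  proof -
    have "\<epsilon>0 \<le> 1 / (100 * (1 + D))" by (simp add: \<epsilon>0_def)
    also have "\<dots> \<le> 1/100" using D by (simp add: divide_simps)
    finally show ?thesis .
  qed
  show ?thesis
  proof (rule that[OF \<epsilon>0(1) \<epsilon>0', of "17 + B"])
    show "17 + B \<ge> 0" using D B by simp
    fix \<epsilon> :: real assume \<epsilon>: "0 < \<epsilon>" "\<epsilon> \<le> \<epsilon>0"
    have \<epsilon>1: "\<epsilon> \<le> 1/100" using \<epsilon> \<epsilon>0' by simp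
    have sq: "\<epsilon>\<^sup>2 \<le> \<epsilon>" "0 < \<epsilon>\<^sup>2" "\<epsilon>\<^sup>2 \<le> 1" using \<epsilon> \<epsilon>1 by (auto simp: power2_eq_square mult_le_one)
    have \<epsilon>D: "\<epsilon>\<^sup>2 * D \<le> 1/100"
    proof -
      have "\<epsilon> * D \<le> 1" using \<epsilon> \<epsilon>0 D by (meson mult_right_mono order_trans)
      then have "\<epsilon> * (\<epsilon> * D) \<le> 1/100 * 1" using \<epsilon> \<epsilon>1 D by (intro mult_mono) auto
      then show ?thesis by (simp add: power2_eq_square mult.assoc)
    qed
    obtain Xl where Xl: "sine_flow (ev (q (-1)) (\<epsilon>\<^sup>2)) (ev (pderiv (q (-1))) (\<epsilon>\<^sup>2)) Xl"
      using \<eta>l(3)[of "\<epsilon>\<^sup>2"] sq \<epsilon> \<epsilon>0 by auto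
    obtain Xr where Xr: "sine_flow (ev (q 1) (\<epsilon>\<^sup>2)) (ev (pderiv (q 1)) (\<epsilon>\<^sup>2)) Xr"
      using \<eta>r(3)[of "\<epsilon>\<^sup>2"] sq \<epsilon> \<epsilon>0 by auto
    let ?\<phi> = "\<lambda>X x. sine_flow.shift X \<epsilon> x" and ?\<psi> = "\<lambda>X x. sine_flow.shift X (- \<epsilon>) x"
    let ?g = "\<lambda>x. 2 * pi * \<epsilon>\<^sup>2 * sin (2 * pi * x)"
    have g: "?g x = 4 * pi * \<epsilon>\<^sup>2 * sin (pi * x) * cos (pi * x)" for x
      by (simp add: sin_double_pi)
    define P where "P = \<epsilon> ^ (2 * K)"
    have P: "0 < P" "P \<le> 1" using \<epsilon> \<epsilon>1 by (auto simp: P_def power_le_one)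
    have P4: "\<epsilon> ^ (2 * K + 4) = P * (\<epsilon>\<^sup>2 * \<epsilon>\<^sup>2)" by (simp add: P_def power_add eval_nat_numeral)
    have est: "\<bar>?\<phi> X x + ?\<psi> X x - 2 * x - ?g x * (1 + \<sigma> * P)\<bar>
        \<le> P * \<epsilon>\<^sup>2 * sin (pi * x) * (1/100 * (\<bar>cos (pi * x)\<bar> + \<epsilon>\<^sup>2))"
      if "sine_flow (ev (q \<sigma>) (\<epsilon>\<^sup>2)) (ev (pderiv (q \<sigma>)) (\<epsilon>\<^sup>2)) X" "C0 \<sigma> \<le> D" "0 < x" "x < 1" for \<sigma> X x
    proof -
      have s: "0 \<le> sin (pi * x)" using that by (intro sin_ge_zero) auto
      have "\<bar>?\<phi> X x + ?\<psi> X x - 2 * x - ?g x * (1 + \<sigma> * P)\<bar>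
          \<le> C0 \<sigma> * \<epsilon> ^ (2 * K + 4) * sin (pi * x) * (\<bar>cos (pi * x)\<bar> + \<epsilon>\<^sup>2)"
        unfolding g P_def using C0(2)[OF \<epsilon>(1) \<epsilon>1 that(1,3,4)] .
      also have "\<dots> = (P * \<epsilon>\<^sup>2 * sin (pi * x)) * ((\<epsilon>\<^sup>2 * C0 \<sigma>) * (\<bar>cos (pi * x)\<bar> + \<epsilon>\<^sup>2))"
        unfolding P4 by (simp add: mult_ac)
      also have "\<dots> \<le> (P * \<epsilon>\<^sup>2 * sin (pi * x)) * (1/100 * (\<bar>cos (pi * x)\<bar> + \<epsilon>\<^sup>2))"
      proof (intro mult_left_mono mult_right_mono)
        have "\<epsilon>\<^sup>2 * C0 \<sigma> \<le> \<epsilon>\<^sup>2 * D" using that(2) by (intro mult_left_mono) auto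
        then show "\<epsilon>\<^sup>2 * C0 \<sigma> \<le> 1/100" using \<epsilon>D by linarith
      qed (use P s in auto)
      finally show ?thesis .
    qed
    \<comment> \<open>Where the cosine is at least \<open>\<epsilon>\<^sup>2 / 2\<close>, the prescribed part of the error dominates the rest.\<close>
    have sgn: "?\<phi> X x + ?\<psi> X x - 2 * x \<le> ?g x"
      if f: "sine_flow (ev (q \<sigma>) (\<epsilon>\<^sup>2)) (ev (pderiv (q \<sigma>)) (\<epsilon>\<^sup>2)) X" "C0 \<sigma> \<le> D" "0 < x" "x < 1"
        and c: "\<sigma> * cos (pi * x) = - \<bar>cos (pi * x)\<bar>" "\<epsilon>\<^sup>2 / 2 \<le> \<bar>cos (pi * x)\<bar>" for \<sigma> X x
    proof -
      have s: "0 \<le> sin (pi * x)" using that by (intro sin_ge_zero) auto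
      let ?c = "\<bar>cos (pi * x)\<bar>"
      have "?g x * (1 + \<sigma> * P) = ?g x + 4 * pi * (P * \<epsilon>\<^sup>2 * sin (pi * x)) * (\<sigma> * cos (pi * x))"
        unfolding g by (simp add: algebra_simps)
      also have "\<dots> = ?g x - (P * \<epsilon>\<^sup>2 * sin (pi * x)) * (4 * pi * ?c)"
        unfolding c by simp
      finally have "?\<phi> X x + ?\<psi> X x - 2 * x \<le> ?g x - (P * \<epsilon>\<^sup>2 * sin (pi * x)) * (4 * pi * ?c)
          + P * \<epsilon>\<^sup>2 * sin (pi * x) * (1/100 * (?c + \<epsilon>\<^sup>2))"
        using est[OF f] by linarith
      also have "\<dots> \<le> ?g x"
      proof -
        have "1/100 * (?c + \<epsilon>\<^sup>2) \<le> 4 * 2 * ?c" using c(2) by simp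
        also have "\<dots> \<le> 4 * pi * ?c" using pi_ge_two by (intro mult_right_mono mult_left_mono) auto
        finally have "(P * \<epsilon>\<^sup>2 * sin (pi * x)) * (1/100 * (?c + \<epsilon>\<^sup>2)) \<le> (P * \<epsilon>\<^sup>2 * sin (pi * x)) * (4 * pi * ?c)"
          using P s by (intro mult_left_mono) auto
        then show ?thesis by linarith
      qed
      finally show ?thesis .
    qed
    have crude: "?\<phi> X x + ?\<psi> X x - 2 * x \<le> ?g x + 17 * P"
      if f: "sine_flow (ev (q \<sigma>) (\<epsilon>\<^sup>2)) (ev (pderiv (q \<sigma>)) (\<epsilon>\<^sup>2)) X" "C0 \<sigma> \<le> D" "0 < x" "x < 1"
        and \<sigma>: "\<bar>\<sigma>\<bar> = 1" for \<sigma> X x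
    proof -
      have s: "0 \<le> sin (pi * x)" using that by (intro sin_ge_zero) auto
      have Q: "P * \<epsilon>\<^sup>2 * sin (pi * x) * (1/100 * (\<bar>cos (pi * x)\<bar> + \<epsilon>\<^sup>2)) \<le> P * 1 * 1 * (1/100 * (1 + 1))"
        using P s sq by (intro mult_mono add_mono mult_nonneg_nonneg) auto
      have "\<bar>?g x * (\<sigma> * P)\<bar> \<le> (2 * 4 * 1 * 1) * (1 * P)"
        unfolding abs_mult using \<sigma> P sq pi_less_4 by (intro mult_mono mult_nonneg_nonneg) auto
      then have Z: "?g x * (\<sigma> * P) \<le> 8 * P" by (simp only: abs_le_iff) simp
      have "?\<phi> X x + ?\<psi> X x - 2 * x \<le> ?g x * (1 + \<sigma> * P)
          + P * \<epsilon>\<^sup>2 * sin (pi * x) * (1/100 * (\<bar>cos (pi * x)\<bar> + \<epsilon>\<^sup>2))"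
        using abs_le_D1[OF est[OF f]] by simp
      also have "?g x * (1 + \<sigma> * P) = ?g x + ?g x * (\<sigma> * P)" by (simp only: distrib_left mult_1_right)
      also have "?g x + ?g x * (\<sigma> * P) + P * \<epsilon>\<^sup>2 * sin (pi * x) * (1/100 * (\<bar>cos (pi * x)\<bar> + \<epsilon>\<^sup>2))
          \<le> ?g x + 8 * P + P * 1 * 1 * (1/100 * (1 + 1))"
        by (intro add_mono Q Z order_refl)
      also have "\<dots> \<le> ?g x + 17 * P" using P by simp
      finally show ?thesis .
    qed
    have cpos: "cos (pi * x) \<ge> \<epsilon>\<^sup>2 / 2" if "0 < x" "x < 1/2 - \<epsilon>\<^sup>2" for x
    proof -
      have "(1/2 - x) / 2 \<le> sin (pi * (1/2 - x))" using that sq by (intro sin_pi_ge) linarith+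
      then show ?thesis using that by (simp add: right_diff_distrib sin_diff)
    qed
    have cneg: "- cos (pi * x) \<ge> \<epsilon>\<^sup>2 / 2" if "1/2 + \<epsilon>\<^sup>2 < x" "x < 1" for x
    proof -
      have "(x - 1/2) / 2 \<le> sin (pi * (x - 1/2))" using that sq by (intro sin_pi_ge) linarith+
      then show ?thesis using that by (simp add: right_diff_distrib sin_diff)
    qed
    have 1: "?\<phi> Xl x + ?\<psi> Xl x - 2 * x \<le> ?g x" if "0 < x" "x < 1/2 - \<epsilon>\<^sup>2" for x
    proof -
      have "\<epsilon>\<^sup>2 / 2 \<le> cos (pi * x)" "0 < cos (pi * x)" using cpos[OF that] sq by linarith+
      then have "-1 * cos (pi * x) = - \<bar>cos (pi * x)\<bar>" "\<epsilon>\<^sup>2 / 2 \<le> \<bar>cos (pi * x)\<bar>" by linarith+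
      then show ?thesis using that sq(2) by (intro sgn[OF Xl D(3)]) linarith+
    qed
    have 2: "?\<phi> Xr x + ?\<psi> Xr x - 2 * x \<le> ?g x" if "1/2 + \<epsilon>\<^sup>2 < x" "x < 1" for x
    proof -
      have "\<epsilon>\<^sup>2 / 2 \<le> - cos (pi * x)" "cos (pi * x) < 0" using cneg[OF that] sq by linarith+
      then have "1 * cos (pi * x) = - \<bar>cos (pi * x)\<bar>" "\<epsilon>\<^sup>2 / 2 \<le> \<bar>cos (pi * x)\<bar>" by linarith+
      then show ?thesis using that sq(2) by (intro sgn[OF Xr D(2)]) linarith+
    qed
    have C: "17 * P \<le> (17 + B) * P"
      using P B by (intro mult_right_mono) auto
    have 3: "?\<phi> Xl x + ?\<psi> Xl x - 2 * x \<le> ?g x + (17 + B) * P" if "0 < x" "x < 1" for x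
      using crude[OF Xl D(3) that] C by simp
    have 4: "?\<phi> Xr x + ?\<psi> Xl x - 2 * x \<le> ?g x + (17 + B) * P" if "0 < x" "x < 1" for x
    proof -
      have "?\<phi> Xr x + ?\<psi> Xl x - 2 * x \<le> ?g x + 17 * P + B * P"
        using crude[OF Xr D(2) that] B(2)[OF \<epsilon>(1) \<epsilon>1 Xl Xr that] by (simp add: P_def)
      also have "\<dots> \<le> ?g x + (17 + B) * P"
        by (simp add: distrib_right)
      finally show ?thesis .
    qed
    have "separatrices \<epsilon> ((17 + B) * \<epsilon> ^ (2 * K)) Xl Xr"
      unfolding separatrices_def P_def[symmetric] using Xl Xr 1 2 3 4 by (intro conjI exI; blast)
    then show "\<exists>Xl Xr. separatrices \<epsilon> ((17 + B) * \<epsilon> ^ (2 * K)) Xl Xr" by blast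
  qed
qed

section \<open>Subsolutions kicked by a bump\<close>

lemma least_index:
  assumes "\<exists>k\<le>n. P (k::nat)"
  shows "\<exists>k\<le>n. P k \<and> (\<forall>j<k. \<not> P j)"
proof -
  obtain k where k: "k \<le> n" "P k" using assms by blast
  have "(LEAST j. P j) \<le> k" "P (LEAST j. P j)" using k(2) by (rule Least_le, rule LeastI)
  then show ?thesis using k(1) not_less_Least[of _ P] by (meson order_trans)
qed

text \<open>
  The hypothesis on the steps below 1 holds for sequences that stay ahead of the stable separatrix of
  1 by \<open>\<sigma>\<close>. Up to distance \<open>\<sigma>\<close> the saddle is approached exponentially at a rate proportional to \<open>\<epsilon>\<close>, and after that
  the lead \<open>\<sigma>\<close> suffices to cross it in one step. Beyond the saddle the force is repelling and the
  subsolution escapes at an exponential rate proportional to \<open>\<epsilon>\<close>. It then keeps a speed of at least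
  \<open>\<epsilon> / 8\<close> up to the next bump and finally jumps over that bump, whose width is only of order \<open>\<epsilon>\<^sup>2\<close>.
  Both exponential phases take \<open>O (ln (1 / \<sigma>) / \<epsilon>)\<close> steps.
\<close>

lemma subsolution_crossing_time:
  fixes y w :: "nat \<Rightarrow> real"
  assumes \<epsilon>: "0 < \<epsilon>" "\<epsilon> \<le> 1/100" and \<sigma>: "0 < \<sigma>" "\<sigma> \<le> 1"
    and mono: "mono y" and y0: "0 \<le> y 0" "y 0 < 1"
    and push: "\<And>m. y m < 1 \<Longrightarrow> y (m + 1) \<ge> y m + \<epsilon> / 4 * (1 - y m) + \<sigma>"
    and sub: "\<And>m. y (m + 2) + y m - 2 * y (m + 1) \<ge> 2 * pi * \<epsilon>\<^sup>2 * sin (2 * pi * y (m + 1)) + w (m + 1)"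
    and w0: "\<And>m. 1 \<le> y m \<Longrightarrow> y m < 3/2 - \<epsilon>\<^sup>2 \<Longrightarrow> w m = 0"
    and wb: "\<And>m. \<bar>w m\<bar> \<le> \<epsilon>\<^sup>2"
    and T: "real T \<ge> 8 * ln (1 / \<sigma>) / \<epsilon> + 2 / \<epsilon> + 7"
  shows "y T > 3/2 + \<epsilon>\<^sup>2"
proof -
  define L where "L = ln (1 / \<sigma>)"
  have L: "L \<ge> 0" "exp (- L) = \<sigma>" using \<sigma> by (auto simp: L_def ln_div exp_minus)
  define N where "N = nat \<lceil>4 * L / \<epsilon>\<rceil>"
  have "0 \<le> 4 * L / \<epsilon>" using L \<epsilon> by simp
  then have N: "4 * L / \<epsilon> \<le> real N" "real N \<le> 4 * L / \<epsilon> + 1"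
    unfolding N_def by auto
  have N': "4 * L \<le> \<epsilon> * real N" using N \<epsilon> by (simp add: field_simps)
  have sq: "\<epsilon>\<^sup>2 \<le> \<epsilon> * (1/100)" "0 < \<epsilon>\<^sup>2" using \<epsilon> by (auto simp: power2_eq_square)
  \<comment> \<open>Approach of the saddle at 1 and crossing of it.\<close>
  have "\<exists>m\<le>N + 1. y m \<ge> 1"
  proof (rule ccontr)
    assume "\<not> ?thesis"
    then have lt: "y m < 1" if "m \<le> N + 1" for m using that by force
    have "1 - y m \<le> exp (- (\<epsilon> / 4) * real m)" if "m \<le> N + 1" for m
      using that
    proof (induction m)
      case 0
      then show ?case using y0 by simp
    next
      case (Suc m)
      have "1 - y (Suc m) \<le> (1 - \<epsilon> / 4) * (1 - y m)"
        using push[OF lt[of m]] Suc.prems \<sigma> by (simp add: algebra_simps)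
      also have "\<dots> \<le> exp (- (\<epsilon> / 4)) * exp (- (\<epsilon> / 4) * real m)"
        using exp_ge_add_one_self[of "- (\<epsilon> / 4)"] Suc lt[of m] by (intro mult_mono) auto
      also have "\<dots> = exp (- (\<epsilon> / 4) * real (Suc m))"
        by (simp add: algebra_simps flip: exp_add)
      finally show ?case .
    qed
    from this[of N] have "1 - y N \<le> exp (- (\<epsilon> / 4) * real N)" by simp
    also have "\<dots> \<le> exp (- L)" using N' by simp
    finally have "1 - y N \<le> \<sigma>" using L by simp
    moreover have "\<epsilon> / 4 * (1 - y N) \<ge> 0" using lt[of N] \<epsilon> by simp
    ultimately show False using push[OF lt[of N]] lt[of "N + 1"] by simp
  qed
  from least_index[OF this] obtain n0 where n0: "n0 \<le> N + 1" "y n0 \<ge> 1" "\<And>j. j < n0 \<Longrightarrow> y j < 1"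
    by (auto simp: not_le)
  have "n0 \<noteq> 0" using n0(2) y0 by (auto intro: ccontr)
  then obtain n where n: "n0 = Suc n" by (cases n0) auto
  have yn: "y n < 1" using n0 n by simp
  have cross: "y (n + 1) - y n \<ge> \<sigma>"
  proof -
    have "\<epsilon> / 4 * (1 - y n) \<ge> 0" using yn \<epsilon> by simp
    then show ?thesis using push[OF yn] by linarith
  qed
  define z where "z j = y (n + 1 + j)" for j
  define s where "s j = y (n + 2 + j) - y (n + 1 + j)" for j
  have zs: "z (Suc j) = z j + s j" for j by (simp add: z_def s_def)
  have z1: "1 \<le> z j" for j
    using n0(2) n monoD[OF mono, of "n + 1" "n + 1 + j"] by (simp add: z_def)
  have s_rec: "s (Suc j) \<ge> s j + 2 * pi * \<epsilon>\<^sup>2 * sin (2 * pi * z (Suc j)) + w (n + 2 + j)" for j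
    using sub[of "n + 1 + j"] by (simp add: s_def z_def)
  have force: "2 * pi * \<epsilon>\<^sup>2 * sin (2 * pi * y m) + w m \<ge> \<epsilon>\<^sup>2 * (y m - 1)" if "1 \<le> y m" "y m \<le> 5/4" for m
  proof -
    have "sin (pi * (2 * (y m - 1))) \<ge> (2 * (y m - 1)) / 2" using that by (intro sin_pi_ge) auto
    moreover have "sin (pi * (2 * (y m - 1))) = sin (2 * pi * y m)"
      by (simp add: algebra_simps sin_diff)
    ultimately have "y m - 1 \<le> sin (2 * pi * y m)" by simp
    then have "1 * \<epsilon>\<^sup>2 * (y m - 1) \<le> 2 * pi * \<epsilon>\<^sup>2 * sin (2 * pi * y m)"
      using pi_ge_two that by (intro mult_mono) auto
    moreover have "w m = 0" using that sq \<epsilon> by (intro w0) linarith+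
    ultimately show ?thesis by simp
  qed
  \<comment> \<open>Escape from the saddle: the speed dominates \<open>\<epsilon>\<close> times the distance from it.\<close>
  have esc: "s j \<ge> \<sigma> \<and> s j \<ge> \<epsilon> * (z j - 1)" if "\<And>i. i \<le> j \<Longrightarrow> z i \<le> 5/4" for j
    using that
  proof (induction j)
    case 0
    have z: "1 \<le> y (n + 1)" "y (n + 1) \<le> 5/4" using 0[of 0] z1[of 0] by (auto simp: z_def)
    then have "\<epsilon>\<^sup>2 * (y (n + 1) - 1) \<ge> 0" by simp
    then have A: "y (n + 1) - y n \<le> s 0"
      using sub[of n] force[OF z] by (simp add: s_def)
    have "\<epsilon> * (z 0 - 1) \<le> 1 * (z 0 - 1)" using \<epsilon> z by (intro mult_right_mono) (auto simp: z_def)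
    also have "\<dots> \<le> y (n + 1) - y n" using yn by (simp add: z_def)
    also note A
    finally show ?case using order_trans[OF cross A] by simp
  next
    case (Suc j)
    have IH: "s j \<ge> \<sigma>" "s j \<ge> \<epsilon> * (z j - 1)" using Suc by auto
    have "\<epsilon>\<^sup>2 * (z (Suc j) - 1) \<le> 2 * pi * \<epsilon>\<^sup>2 * sin (2 * pi * z (Suc j)) + w (n + 2 + j)"
      using force[of "n + 2 + j"] z1[of "Suc j"] Suc.prems[of "Suc j"] by (simp add: z_def)
    then have r: "s (Suc j) \<ge> s j + \<epsilon>\<^sup>2 * (z (Suc j) - 1)" using s_rec[of j] by linarith
    have "\<epsilon>\<^sup>2 * (z (Suc j) - 1) \<ge> 0" using z1[of "Suc j"] by simp
    moreover have "s (Suc j) \<ge> \<epsilon> * (z (Suc j) - 1)"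
    proof -
      have "(1 - \<epsilon>) * (s j - \<epsilon> * (z j - 1)) \<ge> 0" using IH \<epsilon> by (intro mult_nonneg_nonneg) auto
      moreover have "\<epsilon>\<^sup>2 * s j \<ge> 0" using IH \<sigma> by simp
      moreover have "s j + \<epsilon>\<^sup>2 * (z (Suc j) - 1) - \<epsilon> * (z (Suc j) - 1)
          = (1 - \<epsilon>) * (s j - \<epsilon> * (z j - 1)) + \<epsilon>\<^sup>2 * s j"
        unfolding zs by (simp add: algebra_simps power2_eq_square)
      ultimately show ?thesis using r by linarith
    qed
    ultimately show ?case using IH r by (intro conjI) linarith+
  qed
  have "\<exists>j\<le>N + 1. z j > 5/4"
  proof (rule ccontr)
    assume "\<not> ?thesis"
    then have le: "z j \<le> 5/4" if "j \<le> N + 1" for j using that by force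
    have grow: "z (Suc j) - 1 \<ge> \<sigma> * exp (\<epsilon> / 4 * real j)" if "j \<le> N" for j
      using that
    proof (induction j)
      case 0
      show ?case using esc[of 0] le z1[of 0] zs[of 0] by simp
    next
      case (Suc j)
      have "s (Suc j) \<ge> \<epsilon> * (z (Suc j) - 1)" using esc[of "Suc j"] le Suc.prems by simp
      then have "z (Suc (Suc j)) - 1 \<ge> (1 + \<epsilon>) * (z (Suc j) - 1)"
        using zs[of "Suc j"] by (simp add: algebra_simps)
      moreover have "(1 + \<epsilon>) * (z (Suc j) - 1) \<ge> exp (\<epsilon> / 4) * (\<sigma> * exp (\<epsilon> / 4 * real j))"
      proof (intro mult_mono)
        have "exp (\<epsilon> / 4) \<le> 1 + 2 * (\<epsilon> / 4)" using exp_bound_lemma[of "\<epsilon> / 4"] \<epsilon> by simp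
        then show "exp (\<epsilon> / 4) \<le> 1 + \<epsilon>" using \<epsilon> by simp
        show "\<sigma> * exp (\<epsilon> / 4 * real j) \<le> z (Suc j) - 1" using Suc by simp
      qed (use \<epsilon> \<sigma> in auto)
      moreover have "exp (\<epsilon> / 4) * (\<sigma> * exp (\<epsilon> / 4 * real j)) = \<sigma> * exp (\<epsilon> / 4 * real (Suc j))"
        by (simp add: algebra_simps flip: exp_add)
      ultimately show ?case by linarith
    qed
    have "exp L \<le> exp (\<epsilon> / 4 * real N)" using N' by simp
    then have "\<sigma> * exp L \<le> \<sigma> * exp (\<epsilon> / 4 * real N)" using \<sigma> by (intro mult_left_mono) auto
    moreover have "\<sigma> * exp L = 1" using L(2) by (simp add: exp_minus field_simps)
    ultimately have "z (Suc N) - 1 \<ge> 1" using grow[of N] by simp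
    then show False using le[of "Suc N"] by simp
  qed
  from least_index[OF this] obtain j0 where j0: "j0 \<le> N + 1" "z j0 > 5/4" "\<And>j. j < j0 \<Longrightarrow> z j \<le> 5/4"
    by (auto simp: not_less)
  define m0 where "m0 = n + j0"
  have m0: "y (m0 + 1) > 5/4" using j0(2) by (simp add: z_def m0_def ac_simps)
  have in0: "y (m0 + 1) - y m0 \<ge> \<epsilon> / 8"
  proof (cases j0)
    case 0
    then show ?thesis using j0(2) yn \<epsilon> by (simp add: z_def m0_def)
  next
    case (Suc j)
    have e: "s j \<ge> \<epsilon> * (z j - 1)" using esc[of j] j0(3) Suc by auto
    have g: "z j + s j > 5/4" using j0(2) Suc zs[of j] by simp
    have "s j \<ge> \<epsilon> / 8"
    proof (cases "z j - 1 \<ge> 1/8")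
      case True
      then have "\<epsilon> * (z j - 1) \<ge> \<epsilon> * (1/8)" using \<epsilon> by (intro mult_left_mono) auto
      then show ?thesis using e by simp
    next
      case False
      then show ?thesis using g \<epsilon> by linarith
    qed
    then show ?thesis using Suc by (simp add: s_def m0_def)
  qed
  \<comment> \<open>From there on the force is nonnegative until the next bump, so the steps do not shrink.\<close>
  define M where "M = nat \<lceil>2 / \<epsilon>\<rceil>"
  have "0 \<le> 2 / \<epsilon>" using \<epsilon> by simp
  then have M: "2 / \<epsilon> \<le> real M" "real M \<le> 2 / \<epsilon> + 1"
    unfolding M_def by auto
  have speed: "y (m0 + i + 1) - y (m0 + i) \<ge> \<epsilon> / 8"
    if "\<And>i'. i' < i \<Longrightarrow> y (m0 + i' + 1) < 3/2 - \<epsilon>\<^sup>2" for i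
    using that
  proof (induction i)
    case 0
    then show ?case using in0 by simp
  next
    case (Suc i)
    have lt: "y (m0 + i + 1) < 3/2 - \<epsilon>\<^sup>2" using Suc.prems[of i] by simp
    have ge: "1 \<le> y (m0 + i + 1)" using m0 monoD[OF mono, of "m0 + 1" "m0 + i + 1"] by simp
    have "0 \<le> sin (2 * pi * (y (m0 + i + 1) - 1))"
    proof (rule sin_ge_zero)
      have "y (m0 + i + 1) \<le> 3/2" by (rule order_trans[OF less_imp_le[OF lt]]) simp
      then have "2 * (y (m0 + i + 1) - 1) \<le> 1" by simp
      then have "pi * (2 * (y (m0 + i + 1) - 1)) \<le> pi * 1" by (intro mult_left_mono) auto
      then show "2 * pi * (y (m0 + i + 1) - 1) \<le> pi" by simp
    qed (use ge in simp)
    also have "\<dots> = sin (2 * pi * y (m0 + i + 1))" by (simp add: right_diff_distrib sin_diff)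
    finally have "2 * pi * \<epsilon>\<^sup>2 * sin (2 * pi * y (m0 + i + 1)) \<ge> 0" by simp
    moreover have "w (m0 + i + 1) = 0" using w0[OF ge lt] .
    ultimately show ?case using sub[of "m0 + i"] Suc by force
  qed
  have "\<exists>i\<le>M. y (m0 + i + 1) \<ge> 3/2 - \<epsilon>\<^sup>2"
  proof (rule ccontr)
    assume "\<not> ?thesis"
    then have lt: "y (m0 + i + 1) < 3/2 - \<epsilon>\<^sup>2" if "i \<le> M" for i using that by force
    have "y (m0 + i + 1) \<ge> 5/4 + \<epsilon> / 8 * real i" if "i \<le> M" for i
      using that
    proof (induction i)
      case 0
      then show ?case using m0 by simp
    next
      case (Suc i)
      have "y (m0 + Suc i + 1) - y (m0 + Suc i) \<ge> \<epsilon> / 8" by (rule speed) (use lt Suc.prems in simp)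
      then show ?case using Suc by (simp add: algebra_simps add_divide_distrib)
    qed
    from this[of M] have "y (m0 + M + 1) \<ge> 5/4 + \<epsilon> / 8 * real M" by simp
    moreover have "\<epsilon> / 8 * real M \<ge> \<epsilon> / 8 * (2 / \<epsilon>)" using M \<epsilon> by (intro mult_left_mono) auto
    ultimately show False using lt[of M] \<epsilon> sq by simp
  qed
  from least_index[OF this] obtain i0 where i0: "i0 \<le> M" "y (m0 + i0 + 1) \<ge> 3/2 - \<epsilon>\<^sup>2"
      "\<And>i. i < i0 \<Longrightarrow> y (m0 + i + 1) < 3/2 - \<epsilon>\<^sup>2"
    by (auto simp: not_le)
  have sp: "y (m0 + i0 + 1) - y (m0 + i0) \<ge> \<epsilon> / 8" by (rule speed) (use i0 in auto)
  \<comment> \<open>One more step jumps over the bump.\<close>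
  have "2 * pi * \<epsilon>\<^sup>2 * sin (2 * pi * y (m0 + i0 + 1)) \<ge> - (8 * \<epsilon>\<^sup>2)"
  proof -
    have "\<bar>2 * pi * \<epsilon>\<^sup>2 * sin (2 * pi * y (m0 + i0 + 1))\<bar> \<le> 2 * 4 * \<epsilon>\<^sup>2 * 1"
      unfolding abs_mult using pi_less_4 by (intro mult_mono) auto
    then show ?thesis by (simp add: abs_le_iff)
  qed
  then have jump: "y (m0 + i0 + 2) > 3/2 + \<epsilon>\<^sup>2"
    using sub[of "m0 + i0"] wb[of "m0 + i0 + 1"] sp i0(2) sq \<epsilon> by (simp add: abs_le_iff)
  have "real (m0 + i0 + 2) \<le> real (2 * N + 1 + M + 2)"
    using n0(1) n j0(1) i0(1) by (simp add: m0_def)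
  also have "\<dots> \<le> real T" using T N M by (simp add: L_def)
  finally have "y (m0 + i0 + 2) \<le> y T" using monoD[OF mono] by simp
  then show ?thesis using jump by linarith
qed

text \<open>
  The subsolution arrives at \<open>\<zeta>\<close> at least as fast as \<open>Xl\<close>, gains \<open>w \<zeta>\<close> there, which is at least twice the
  error \<open>\<kappa>\<close> of the separatrices, and so leaves \<open>\<zeta>\<close> ahead of \<open>Xr\<close> by \<open>\<sigma>\<close>. The lead does not shrink on the way to
  1, because the backward time-\<open>\<epsilon>\<close> map expands there.
\<close>

lemma no_slow_subsolution:
  fixes a :: "int \<Rightarrow> real" and w :: "real \<Rightarrow> real"
  assumes \<epsilon>: "0 < \<epsilon>" "\<epsilon> \<le> 1/100"
    and sep: "separatrices \<epsilon> \<kappa> Xl Xr"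
    and \<kappa>: "\<kappa> \<le> \<epsilon> / 8" "\<kappa> \<le> \<sigma>" and \<sigma>: "0 < \<sigma>" "\<sigma> \<le> 1"
    and w0: "\<And>x. 0 < x \<Longrightarrow> x < 3/2 - \<epsilon>\<^sup>2 \<Longrightarrow> \<epsilon>\<^sup>2 < \<bar>x - 1/2\<bar> \<Longrightarrow> w x = 0"
    and wb: "\<And>x. \<bar>w x\<bar> \<le> \<epsilon>\<^sup>2"
    and \<zeta>: "\<bar>\<zeta> - 1/2\<bar> \<le> \<epsilon>\<^sup>2" "2 * \<sigma> \<le> w \<zeta>"
    and a0: "a 0 = \<zeta>" and mono: "mono a"
    and sub: "\<And>m. a (m + 1) + a (m - 1) - 2 * a m \<ge> 2 * pi * \<epsilon>\<^sup>2 * sin (2 * pi * a m) + w (a m)"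
    and unb: "\<And>L. \<exists>m. a m < L"
    and T: "real T \<ge> 8 * ln (1 / \<sigma>) / \<epsilon> + 2 / \<epsilon> + 7"
  shows "a (int T) > \<zeta> + 1"
proof -
  obtain pl pl' where "sine_flow pl pl' Xl" using sep unfolding separatrices_def by blast
  then interpret l: sine_flow pl pl' Xl .
  obtain pr pr' where "sine_flow pr pr' Xr" using sep unfolding separatrices_def by blast
  then interpret r: sine_flow pr pr' Xr .
  have left: "l.shift \<epsilon> x + l.shift (- \<epsilon>) x - 2 * x \<le> 2 * pi * \<epsilon>\<^sup>2 * sin (2 * pi * x)"
    if "0 < x" "x < 1/2 - \<epsilon>\<^sup>2" for x
    using sep that unfolding separatrices_def by blast
  have right: "r.shift \<epsilon> x + r.shift (- \<epsilon>) x - 2 * x \<le> 2 * pi * \<epsilon>\<^sup>2 * sin (2 * pi * x)"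
    if "1/2 + \<epsilon>\<^sup>2 < x" "x < 1" for x
    using sep that unfolding separatrices_def by blast
  have crude: "l.shift \<epsilon> x + l.shift (- \<epsilon>) x - 2 * x \<le> 2 * pi * \<epsilon>\<^sup>2 * sin (2 * pi * x) + \<kappa>"
    and mixed: "r.shift \<epsilon> x + l.shift (- \<epsilon>) x - 2 * x \<le> 2 * pi * \<epsilon>\<^sup>2 * sin (2 * pi * x) + \<kappa>"
    if "0 < x" "x < 1" for x
    using sep that unfolding separatrices_def by blast+
  have sq: "\<epsilon>\<^sup>2 \<le> \<epsilon> * (1/100)" "0 < \<epsilon>\<^sup>2" using \<epsilon> by (auto simp: power2_eq_square)
  have \<zeta>b: "1/2 - \<epsilon>\<^sup>2 \<le> \<zeta>" "\<zeta> \<le> 1/2 + \<epsilon>\<^sup>2" using \<zeta>(1) by (auto simp: abs_le_iff)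
  have \<zeta>01: "0 < \<zeta>" "\<zeta> < 1" using \<zeta>b sq \<epsilon> by linarith+
  \<comment> \<open>A subsolution that lags behind the unstable separatrix lags behind it at all earlier times
      and never reaches the saddle at 0.\<close>
  have lead: "a (- 1) \<le> l.shift (- \<epsilon>) \<zeta>"
  proof (rule ccontr)
    assume "\<not> ?thesis"
    then have start: "l.shift (- \<epsilon>) (a 0) < a (- 1)" using a0 by simp
    have lag: "0 < a (- int m) \<and> a (- int m) \<le> \<zeta> \<and> l.shift (- \<epsilon>) (a (- int m)) < a (- int m - 1)" for m
    proof (induction m)
      case 0
      then show ?case using start a0 \<zeta>01 by simp
    next
      case (Suc m)
      define x y z where "x = a (- int m - 1)" and "y = a (- int m)" and "z = a (- int m - 2)"
      have y: "0 < y" "y \<le> \<zeta>" "y < 1" and lagy: "l.shift (- \<epsilon>) y < x"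
        using Suc \<zeta>01 by (auto simp: x_def y_def)
      have xy: "x \<le> y" unfolding x_def y_def by (rule monoD[OF mono]) simp
      have x: "0 < x" "x < 1" using l.shift_range(1)[of "- \<epsilon>" y] lagy xy y by linarith+
      have e: "y < l.shift \<epsilon> x"
        using l.shift_strict_mono[OF l.shift_range(1) lagy x(2), of \<epsilon>] l.shift_shift(1)[OF y(1,3), of \<epsilon> "- \<epsilon>"]
          l.shift_shift(2)[OF y(1,3)] by simp
      have rec: "y + z - 2 * x \<ge> 2 * pi * \<epsilon>\<^sup>2 * sin (2 * pi * x) + w x"
      proof -
        have "- int m - 1 + 1 = - int m" "- int m - 1 - 1 = - int m - 2" by simp_all
        then show ?thesis using sub[of "- int m - 1"] unfolding x_def y_def z_def by (simp only:)
      qed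
      have "l.shift (- \<epsilon>) x < z"
      proof (cases "x < 1/2 - 5/4 * \<epsilon>")
        case True
        then have "x < 1/2 - \<epsilon>\<^sup>2" using sq \<epsilon> by linarith
        moreover from this have "w x = 0" using x sq by (intro w0) linarith+
        ultimately show ?thesis using left[OF x(1)] rec e by linarith
      next
        case False
        \<comment> \<open>The step from \<open>x\<close> is much shorter than that of the separatrix, which outweighs the bump.\<close>
        have "l.shift \<epsilon> x \<ge> x + 7/4 * \<epsilon>"
          by (rule l.shift_near_half) (use False \<epsilon> xy y \<zeta>b in linarith)+
        then show ?thesis
          using crude[OF x] rec False xy y \<zeta>b wb[of x] \<kappa>(1) sq \<epsilon> by (simp add: abs_le_iff)
      qed
      then have "0 < x \<and> x \<le> \<zeta> \<and> l.shift (- \<epsilon>) x < z" using x xy y by simp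
      moreover have "- int (Suc m) = - int m - 1" "- int m - 1 - 1 = - int m - 2" by simp_all
      ultimately show ?case unfolding x_def z_def by (simp only:)
    qed
    obtain m where m: "a m < 0" using unb by blast
    have "a (- int (nat \<bar>m\<bar>)) \<le> a m" by (rule monoD[OF mono]) simp
    then show False using lag[of "nat \<bar>m\<bar>"] m by linarith
  qed
  \<comment> \<open>The kick of the bump puts the orbit ahead of the stable separatrix.\<close>
  have kick: "a 1 \<ge> r.shift \<epsilon> \<zeta> + \<sigma>"
    using sub[of 0] mixed[OF \<zeta>01] lead \<zeta>(2) \<kappa>(2) a0 by simp
  have past: "1/2 + \<epsilon>\<^sup>2 < a (int m + 1)" for m
  proof -
    have "r.shift \<epsilon> \<zeta> \<ge> \<zeta> + 7/4 * \<epsilon>"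
      by (rule r.shift_near_half) (use \<epsilon> \<zeta>b sq in linarith)+
    moreover have "a 1 \<le> a (int m + 1)" by (rule monoD[OF mono]) simp
    ultimately show ?thesis using kick \<sigma> \<zeta>b sq \<epsilon> by linarith
  qed
  have ahead: "a (int m + 1) \<ge> r.shift \<epsilon> (a (int m)) + \<sigma>" if "a (int m) < 1" for m
    using that
  proof (induction m)
    case 0
    then show ?case using kick a0 by simp
  next
    case (Suc m)
    define p x z where "p = a (int m)" and "x = a (int m + 1)" and "z = a (int m + 2)"
    have px: "p \<le> x" unfolding p_def x_def by (rule monoD[OF mono]) simp
    have x: "x < 1" "1/2 + \<epsilon>\<^sup>2 < x" using Suc.prems past[of m] by (auto simp: x_def add.commute)
    have x0: "0 < x" using x sq by linarith
    have p: "\<zeta> \<le> p" unfolding p_def a0[symmetric] by (rule monoD[OF mono]) simp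
    have IH: "x \<ge> r.shift \<epsilon> p + \<sigma>" using Suc.IH px x by (simp add: p_def x_def)
    have inv: "r.shift \<epsilon> (r.shift (- \<epsilon>) x) = x" using r.shift_shift[OF x0 x(1)] by simp
    have le: "p \<le> r.shift (- \<epsilon>) x"
    proof (rule ccontr)
      assume "\<not> ?thesis"
      then have "r.shift \<epsilon> (r.shift (- \<epsilon>) x) < r.shift \<epsilon> p"
        using px x by (intro r.shift_strict_mono r.shift_range) auto
      then show False using IH inv \<sigma> by simp
    qed
    have "r.shift \<epsilon> (r.shift (- \<epsilon>) x) - r.shift \<epsilon> p \<le> r.shift (- \<epsilon>) x - p"
      by (rule r.shift_contracts_right[OF \<epsilon>]) (use le p \<zeta>b r.shift_range in auto)
    then have "\<sigma> \<le> r.shift (- \<epsilon>) x - p" using IH inv by simp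
    moreover have "z + p - 2 * x \<ge> 2 * pi * \<epsilon>\<^sup>2 * sin (2 * pi * x) + w x"
    proof -
      have "int m + 1 + 1 = int m + 2" "int m + 1 - 1 = int m" by simp_all
      then show ?thesis using sub[of "int m + 1"] unfolding x_def p_def z_def by (simp only:)
    qed
    moreover have "w x = 0" using x x0 \<epsilon> sq by (intro w0) linarith+
    ultimately have "z \<ge> r.shift \<epsilon> x + \<sigma>" using right[OF x(2,1)] by linarith
    moreover have "int (Suc m) = int m + 1" "int (Suc m) + 1 = int m + 2" by simp_all
    ultimately show ?case by (simp only: x_def z_def)
  qed
  have "a (int T) > 3/2 + \<epsilon>\<^sup>2"
  proof (rule subsolution_crossing_time[OF \<epsilon> \<sigma>, where y = "\<lambda>m. a (int m)" and w = "\<lambda>m. w (a (int m))"])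
    show "mono (\<lambda>m. a (int m))" using mono by (auto simp: mono_def)
    show "0 \<le> a (int 0)" "a (int 0) < 1" using a0 \<zeta>01 by auto
    show "a (int (m + 1)) \<ge> a (int m) + \<epsilon> / 4 * (1 - a (int m)) + \<sigma>" if "a (int m) < 1" for m
    proof -
      have "\<zeta> \<le> a (int m)" unfolding a0[symmetric] by (rule monoD[OF mono]) simp
      then have "r.shift \<epsilon> (a (int m)) \<ge> a (int m) + \<epsilon> / 4 * (1 - a (int m))"
        using that \<zeta>b by (intro r.shift_right_lower[OF \<epsilon>]) auto
      then show ?thesis using ahead[OF that] by (simp add: add.commute)
    qed
    show "a (int (m + 2)) + a (int m) - 2 * a (int (m + 1))
        \<ge> 2 * pi * \<epsilon>\<^sup>2 * sin (2 * pi * a (int (m + 1))) + w (a (int (m + 1)))" for m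
      using sub[of "int m + 1"] by (simp add: add.commute)
    show "w (a (int m)) = 0" if "1 \<le> a (int m)" "a (int m) < 3/2 - \<epsilon>\<^sup>2" for m
      using that sq \<epsilon> by (intro w0) (auto simp: abs_if)
  qed (use wb T in auto)
  then show ?thesis using \<zeta>b by simp
qed

section \<open>The bump and the choice of constants\<close>

lemma generated_lift_formula:
  assumes gen: "generates_lift (h_fam a v n) F"
    and dv: "\<And>x. (v n has_real_derivative d x) (at x)"
  shows "F (x, y) = (x + y, y + (1 / real n powr a * (2 * pi * sin (2 * pi * (x + y))) + d (x + y)))"
proof -
  have D1: "((\<lambda>t. h_fam a v n t x') has_real_derivative x - x') (at x)" for x x'
    unfolding h_fam_def h0_def by (auto intro!: derivative_eq_intros)
  define c where "c = 1 / real n powr a"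
  have D2: "((\<lambda>t. h_fam a v n x t) has_real_derivative
      (x' - x) + (c * (2 * pi * sin (2 * pi * x')) + d x')) (at x')" for x x'
    unfolding h_fam_def h0_def u_pot_def c_def[symmetric]
    by (auto intro!: derivative_eq_intros dv)
  show ?thesis
    using gen D1[of "x + y" x] D2[of x "x + y"] unfolding generates_lift_def c_def by simp
qed

lemma class_C_deriv:
  assumes C: "class_C k v" and k: "k \<ge> 1"
  shows "(v has_real_derivative deriv v x) (at x)" "continuous_on UNIV (deriv v)"
proof -
  have "v differentiable (at x)"
    using C k unfolding class_C_def by (metis funpow_0 less_le_trans zero_less_one)
  then show "(v has_real_derivative deriv v x) (at x)"
    by (metis DERIV_imp_deriv real_differentiable_def)
  show "continuous_on UNIV (deriv v)"
  proof (cases "k = 1")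
    case True
    then show ?thesis using C by (simp add: class_C_def)
  next
    case False
    with k have "1 < k" by simp
    then have "\<forall>x. (deriv ^^ 1) v differentiable (at x)"
      using C unfolding class_C_def by blast
    then have "\<forall>x. deriv v differentiable (at x)" by simp
    then show ?thesis
      by (simp add: continuous_at_imp_continuous_on differentiable_imp_continuous_within)
  qed
qed

lemma deriv_periodic:
  assumes dv: "\<And>x. (v has_real_derivative d x) (at x)" and per: "\<And>x. v (x + 1) = (v x :: real)"
  shows "d (x + 1) = d x"
proof -
  have "((\<lambda>t. v (t + 1)) has_real_derivative d (x + 1)) (at x)"
    using dv[of "x + 1"] by (simp only: DERIV_shift)
  then show ?thesis using dv[of x] DERIV_unique by (simp only: per)
qed

lemma abs_deriv_le_C_norm:
  assumes C: "class_C k v" and k: "k \<ge> 1" and per: "\<And>x. v (x + 1) = v x"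
  shows "\<bar>deriv v x\<bar> \<le> C_norm k v"
proof -
  obtain B where B: "\<And>x. \<bar>deriv v x\<bar> \<le> B"
    using periodic_continuous_bounded[OF class_C_deriv(2)[OF C k] deriv_periodic[OF class_C_deriv(1)[OF C k] per]]
    by metis
  have "\<bar>deriv v x\<bar> \<le> (SUP x. \<bar>(deriv ^^ 1) v x\<bar>)"
  proof -
    have "\<bar>(deriv ^^ 1) v x\<bar> \<le> (SUP x. \<bar>(deriv ^^ 1) v x\<bar>)"
      by (rule cSUP_upper) (use B in \<open>auto intro!: bdd_aboveI[of _ B]\<close>)
    then show ?thesis by simp
  qed
  also have "\<dots> \<le> C_norm k v"
    unfolding C_norm_def by (rule Max_ge, simp, rule image_eqI[where x = 1]) (use k in auto)
  finally show ?thesis .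
qed

text \<open>
  The complement of the support is open, so the derivative vanishes there too. The range reaches from
  0 to the left edge of the translated bump around \<open>3/2\<close>.
\<close>

lemma bump_vanishes_outside:
  fixes v :: "real \<Rightarrow> real"
  assumes supp: "support v \<inter> {0..1} \<subseteq> {1/2 - r..1/2 + r}" and r: "0 < r" "r \<le> 1/4"
    and dv: "\<And>x. (v has_real_derivative d x) (at x)" and per: "\<And>x. v (x + 1) = v x"
    and x: "0 \<le> x" "x < 3/2 - r" "r < \<bar>x - 1/2\<bar>"
  shows "v x = 0" "d x = 0"
proof -
  have unit: "v y = 0 \<and> d y = 0" if y: "0 \<le> y" "y \<le> 1" "r < \<bar>y - 1/2\<bar>" for y
  proof -
    have "y \<notin> {1/2 - r..1/2 + r}" using y(3) by auto
    then have out: "y \<in> - support v" using supp y(1,2) by auto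
    have op: "open (- support v)" by (simp add: support_def open_Compl)
    have zero: "v z = 0" if "z \<in> - support v" for z
      using that closure_subset[of "{x. v x \<noteq> 0}"] by (auto simp: support_def)
    have "(v has_real_derivative 0) (at y)"
      by (rule has_field_derivative_transform_within_open[OF DERIV_const op out]) (simp add: zero)
    then show ?thesis using dv[of y] DERIV_unique zero[OF out] by blast
  qed
  show "v x = 0" "d x = 0"
  proof -
    have "v x = 0 \<and> d x = 0"
    proof (cases "x \<le> 1")
      case False
      then have "r < \<bar>(x - 1) - 1/2\<bar>" "0 \<le> x - 1" "x - 1 \<le> 1" using x r by (auto simp: abs_if)
      then show ?thesis using unit[of "x - 1"] per[of "x - 1"] deriv_periodic[OF dv per, of "x - 1"] by simp
    qed (use unit x in auto)
    then show "v x = 0" "d x = 0" by auto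
  qed
qed

text \<open>
  The bump rises from 0 at the integers to its maximum within one period. By the mean value theorem
  its derivative is at least the maximum somewhere, and this point lies in the support.
\<close>

lemma bump_has_steep_point:
  fixes v :: "real \<Rightarrow> real"
  assumes supp: "support v \<inter> {0..1} \<subseteq> {1/2 - r..1/2 + r}" and r: "0 < r" "r \<le> 1/4"
    and dv: "\<And>x. (v has_real_derivative d x) (at x)" and per: "\<And>x. v (x + 1) = v x"
    and m: "v x0 = m" "m > 0"
  obtains \<zeta> where "\<bar>\<zeta> - 1/2\<bar> \<le> r" "d \<zeta> \<ge> m"
proof -
  have "v (frac x0) = m"
    using periodic_shift_int[of v "frac x0" "\<lfloor>x0\<rfloor>"] per m(1) by (simp add: frac_def)
  then obtain x where x: "0 \<le> x" "x < 1" "v x = m" using frac_lt_1[of x0] frac_ge_0[of x0] by blast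
  have v0: "v 0 = 0" by (rule bump_vanishes_outside(1)[OF supp r dv per]) (use r in auto)
  then have xp: "0 < x" using x m by (cases "x = 0") auto
  obtain \<zeta> where \<zeta>: "0 < \<zeta>" "\<zeta> < x" "v x - v 0 = (x - 0) * d \<zeta>"
    using MVT2[OF xp, of v d] dv by auto
  have e: "m = x * d \<zeta>" using \<zeta>(3) v0 x(3) by simp
  then have dp: "d \<zeta> > 0" using m(2) xp by (simp add: zero_less_mult_iff)
  have "x * d \<zeta> \<le> 1 * d \<zeta>" using x dp by (intro mult_right_mono) auto
  then have "m \<le> d \<zeta>" using e by simp
  moreover have "\<bar>\<zeta> - 1/2\<bar> \<le> r"
  proof (rule ccontr)
    assume "\<not> ?thesis"
    then have "d \<zeta> = 0" using \<zeta> x r by (intro bump_vanishes_outside(2)[OF supp r dv per]) auto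
    then show False using dp by simp
  qed
  ultimately show ?thesis using that by blast
qed

lemma eventually_powr_small:
  assumes "p > 0" "d > 0"
  shows "\<forall>\<^sub>F n in sequentially. c * real n powr (- p) < d"
proof -
  have "((\<lambda>n. c * real n powr (- p)) \<longlongrightarrow> c * 0) sequentially"
    by (intro tendsto_mult tendsto_const tendsto_neg_powr filterlim_real_sequentially) (use assms in simp)
  then show ?thesis using assms(2) by (intro order_tendstoD(2)) auto
qed

text \<open>
  The crossing time is \<open>O (ln n) * n powr (a / 2)\<close>, and the factor \<open>n powr (- \<delta>)\<close> in the bound on the
  rotation number beats the logarithm.
\<close>

lemma eventually_crossing_faster_than_rotation:
  fixes a s \<delta> :: real
  assumes "a > 0" "\<delta> > 0"
  shows "\<forall>\<^sub>F n in sequentially.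
    (8 * ln (1 / (real n powr (- s) / 2)) / real n powr (- a / 2) + 2 / real n powr (- a / 2) + 8)
      * real n powr (- a / 2 - \<delta>) < 1"
proof -
  have 1: "((\<lambda>n. 8 * s * (ln (real n) / real n powr \<delta>) + (8 * ln 2 + 2) * real n powr (- \<delta>)
      + 8 * real n powr (- (a / 2 + \<delta>))) \<longlongrightarrow> 8 * s * 0 + (8 * ln 2 + 2) * 0 + 8 * 0) sequentially"
    by (intro tendsto_add tendsto_mult tendsto_const tendsto_neg_powr filterlim_real_sequentially lim_ln_over_power)
      (use assms in auto)
  then have "\<forall>\<^sub>F n in sequentially. 8 * s * (ln (real n) / real n powr \<delta>) + (8 * ln 2 + 2) * real n powr (- \<delta>)
      + 8 * real n powr (- (a / 2 + \<delta>)) < 1"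
    by (rule order_tendstoD) simp
  then show ?thesis
    using eventually_gt_at_top[of 0]
  proof eventually_elim
    case (elim n)
    then have n: "real n > 0" by simp
    define E where "E = real n powr (- a / 2)"
    have E: "E > 0" using n by (simp add: E_def)
    have split: "real n powr (- a / 2 - \<delta>) = E * real n powr (- \<delta>)"
      unfolding E_def powr_add[symmetric] by simp
    have l: "ln (1 / (real n powr (- s) / 2)) = ln 2 + s * ln (real n)"
      using n by (simp add: ln_div ln_powr)
    have "real n powr (- (a / 2 + \<delta>)) = E * real n powr (- \<delta>)" unfolding split[symmetric] by simp
    moreover have "ln (real n) / real n powr \<delta> = ln (real n) * real n powr (- \<delta>)"
      by (simp add: powr_minus divide_inverse)
    moreover have "(8 * (ln 2 + s * ln (real n)) / E + 2 / E + 8) * (E * real n powr (- \<delta>))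
        = 8 * s * (ln (real n) * real n powr (- \<delta>)) + (8 * ln 2 + 2) * real n powr (- \<delta>) + 8 * (E * real n powr (- \<delta>))"
      using E by (simp add: field_simps)
    ultimately show ?case using elim(1) unfolding l split E_def[symmetric] by simp
  qed
qed

theorem theorem3p1:
  fixes a s s' :: real and k :: nat and v :: "nat \<Rightarrow> real \<Rightarrow> real"
  assumes a_pos: "a > 0"
    and k_pos: "k \<ge> 1"
    and s_pos: "s > 0"
    and s'_pos: "s' > 0"
    and s'_gt: "s' > a"
    and v_nonneg: "\<And>n x. n \<ge> 1 \<Longrightarrow> v n x \<ge> 0"
    and v_Ck: "\<And>n. n \<ge> 1 \<Longrightarrow> class_C k (v n)"
    and v_per: "\<And>n x. n \<ge> 1 \<Longrightarrow> v n (x + 1) = v n x"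
    and v_supp: "\<And>n. n \<ge> 1 \<Longrightarrow>
        support (v n) \<inter> {0..1} \<subseteq> {1/2 - 1 / real n powr a .. 1/2 + 1 / real n powr a}"
    and v_max: "\<And>n. n \<ge> 1 \<Longrightarrow>
        (\<forall>x. v n x \<le> real n powr (- s)) \<and> (\<exists>x. v n x = real n powr (- s))"
    and v_norm: "(\<lambda>n. C_norm k (v n)) \<in> O(\<lambda>n. real n powr (- s'))"
  shows "\<exists>\<delta>0>0. \<forall>\<delta>. 0 < \<delta> \<and> \<delta> < \<delta>0 \<longrightarrow>
           (\<exists>N\<ge>1. \<forall>n\<ge>N. \<forall>\<omega>::real. \<omega> \<notin> \<rat> \<and> \<bar>\<omega>\<bar> < real n powr (- a / 2 - \<delta>) \<longrightarrow>
             (\<forall>f F. generates (h_fam a v n) f F \<longrightarrow>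
               \<not> (\<exists>C. invariant_circle f C \<and> has_rotation_number F C \<omega>)))"
proof (intro exI[of _ "1::real"] conjI allI impI)
  fix \<delta> :: real assume \<delta>: "0 < \<delta> \<and> \<delta> < 1"
  \<comment> \<open>The order \<open>K\<close> makes the error \<open>\<epsilon> ^ (2 * K) = n powr (- a * K)\<close> of smaller order than the kick \<open>n powr (- s)\<close>.\<close>
  define K where "K = nat \<lceil>(s + 1) / a\<rceil>"
  have "(s + 1) / a > 0" using s_pos a_pos by simp
  then have Ka: "(s + 1) / a \<le> real K" and K: "K \<ge> 1" unfolding K_def by linarith+
  have Ks: "s + 1 \<le> a * real K" using Ka a_pos by (simp add: field_simps)
  obtain \<epsilon>0 C where \<epsilon>0: "0 < \<epsilon>0" "\<epsilon>0 \<le> 1/100" and C: "C \<ge> 0"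
    and sep: "\<And>\<epsilon>. 0 < \<epsilon> \<Longrightarrow> \<epsilon> \<le> \<epsilon>0 \<Longrightarrow> \<exists>Xl Xr. separatrices \<epsilon> (C * \<epsilon> ^ (2 * K)) Xl Xr"
    by (rule approximate_separatrices[OF K]) blast
  obtain D where D: "\<forall>\<^sub>F n in sequentially. norm (C_norm k (v n)) \<le> D * norm (real n powr (- s'))"
    using landau_o.bigE[OF v_norm] by metis
  have "\<forall>\<^sub>F n in sequentially. 1 * real n powr (- (a / 2)) < min \<epsilon>0 (1 / (8 * (C + 1)))"
    by (rule eventually_powr_small) (use a_pos \<epsilon>0 C in auto)
  moreover have "\<forall>\<^sub>F n in sequentially. C * real n powr (- 1) < 1/2"
    by (rule eventually_powr_small) auto
  moreover have "\<forall>\<^sub>F n in sequentially. D * real n powr (- (s' - a)) < 1"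
    by (rule eventually_powr_small) (use s'_gt in auto)
  moreover note D eventually_crossing_faster_than_rotation[OF a_pos conjunct1[OF \<delta>], of s]
    eventually_ge_at_top[of "1::nat"]
  ultimately have "\<forall>\<^sub>F n in sequentially. \<forall>\<omega>::real. \<omega> \<notin> \<rat> \<and> \<bar>\<omega>\<bar> < real n powr (- a / 2 - \<delta>) \<longrightarrow>
             (\<forall>f F. generates (h_fam a v n) f F \<longrightarrow>
               \<not> (\<exists>C. invariant_circle f C \<and> has_rotation_number F C \<omega>))"
  proof eventually_elim
    case (elim n)
    have n: "n \<ge> 1" "real n > 0" using elim(6) by auto
    define \<epsilon> where "\<epsilon> = real n powr (- a / 2)"
    have small: "\<epsilon> < \<epsilon>0" "\<epsilon> < 1 / (8 * (C + 1))" using elim(1) by (auto simp: \<epsilon>_def)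
    have \<epsilon>: "0 < \<epsilon>" "\<epsilon> \<le> \<epsilon>0" "\<epsilon> \<le> 1/100" "\<epsilon> * (8 * (C + 1)) \<le> 1"
      using n small \<epsilon>0 C by (simp_all add: \<epsilon>_def less_divide_eq)
    have "\<epsilon>\<^sup>2 = real n powr (- a / 2 + - a / 2)" unfolding \<epsilon>_def power2_eq_square powr_add ..
    then have \<epsilon>2: "\<epsilon>\<^sup>2 = real n powr (- a)" "\<epsilon>\<^sup>2 = 1 / real n powr a"
      by (simp_all add: powr_minus_divide)
    have sq: "0 < \<epsilon>\<^sup>2" "\<epsilon>\<^sup>2 \<le> 1/4"
    proof -
      show "0 < \<epsilon>\<^sup>2" using \<epsilon> by simp
      have "\<epsilon> * \<epsilon> \<le> 1/100 * (1/100)" using \<epsilon> by (intro mult_mono) auto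
      then show "\<epsilon>\<^sup>2 \<le> 1/4" by (simp add: power2_eq_square)
    qed
    define \<sigma> where "\<sigma> = real n powr (- s) / 2"
    have "real n powr (- s) \<le> real n powr 0" using n s_pos by (intro powr_mono) auto
    then have \<sigma>: "0 < \<sigma>" "\<sigma> \<le> 1" using n by (auto simp: \<sigma>_def)
    define \<kappa> where "\<kappa> = C * \<epsilon> ^ (2 * K)"
    have \<epsilon>K: "\<epsilon> ^ (2 * K) = real n powr (- (a * real K))"
    proof -
      have "\<epsilon> ^ (2 * K) = (real n powr (- a)) ^ K" unfolding power_mult \<epsilon>2(1) ..
      also have "\<dots> = real n powr (- (a * real K))"
        using n by (simp add: powr_realpow[symmetric] powr_powr)
      finally show ?thesis .
    qed
    have \<kappa>1: "\<kappa> \<le> \<epsilon> / 8"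
    proof -
      have "\<epsilon> ^ (2 * K) \<le> \<epsilon> ^ 2" using \<epsilon> K by (intro power_decreasing) auto
      then have "\<kappa> \<le> C * (\<epsilon> * \<epsilon>)" unfolding \<kappa>_def using C by (intro mult_left_mono) (auto simp: power2_eq_square)
      also have "\<dots> \<le> (C + 1) * \<epsilon> * \<epsilon>" using C \<epsilon> by (simp add: algebra_simps)
      also have "\<dots> \<le> 1/8 * \<epsilon>" using \<epsilon> by (intro mult_right_mono) (auto simp: algebra_simps)
      finally show ?thesis by simp
    qed
    have \<kappa>2: "\<kappa> \<le> \<sigma>"
    proof -
      have "real n powr (- (a * real K)) \<le> real n powr (- (s + 1))"
        using n Ks by (intro powr_mono) auto
      also have "\<dots> = real n powr (- 1) * real n powr (- s)"
      proof -
        have "- (s + 1) = - 1 + - s" by simp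
        then show ?thesis by (simp only: powr_add)
      qed
      finally have "\<kappa> \<le> C * (real n powr (- 1) * real n powr (- s))"
        unfolding \<kappa>_def \<epsilon>K using C by (intro mult_left_mono)
      also have "\<dots> = (C * real n powr (- 1)) * real n powr (- s)" by simp
      also have "\<dots> \<le> 1/2 * real n powr (- s)" using elim(2) by (intro mult_right_mono) auto
      finally show ?thesis by (simp add: \<sigma>_def)
    qed
    define w where "w = deriv (v n)"
    have dv: "(v n has_real_derivative w x) (at x)" for x
      unfolding w_def by (rule class_C_deriv(1)[OF v_Ck[OF n(1)] k_pos])
    note per = v_per[OF n(1)]
    have supp: "support (v n) \<inter> {0..1} \<subseteq> {1/2 - \<epsilon>\<^sup>2..1/2 + \<epsilon>\<^sup>2}"
      unfolding \<epsilon>2(2) by (rule v_supp[OF n(1)])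
    have wb: "\<bar>w x\<bar> \<le> \<epsilon>\<^sup>2" for x
    proof -
      have "\<bar>w x\<bar> \<le> C_norm k (v n)"
        unfolding w_def by (rule abs_deriv_le_C_norm[OF v_Ck[OF n(1)] k_pos per])
      also have "\<dots> \<le> D * real n powr (- s')" using elim(4) by simp
      also have "\<dots> = (D * real n powr (- (s' - a))) * real n powr (- a)"
        by (simp add: mult.assoc flip: powr_add)
      also have "\<dots> \<le> 1 * real n powr (- a)" using elim(3) by (intro mult_right_mono) auto
      finally show ?thesis by (simp add: \<epsilon>2(1))
    qed
    have w0: "w x = 0" if "0 < x" "x < 3/2 - \<epsilon>\<^sup>2" "\<epsilon>\<^sup>2 < \<bar>x - 1/2\<bar>" for x
      by (rule bump_vanishes_outside(2)[OF supp sq dv per]) (use that in auto)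
    obtain x0 where "v n x0 = real n powr (- s)" using v_max[OF n(1)] by blast
    then obtain \<zeta> where \<zeta>: "\<bar>\<zeta> - 1/2\<bar> \<le> \<epsilon>\<^sup>2" "2 * \<sigma> \<le> w \<zeta>"
      using bump_has_steep_point[OF supp sq dv per, of x0 "real n powr (- s)"] n unfolding \<sigma>_def by auto
    obtain Xl Xr where sep\<epsilon>: "separatrices \<epsilon> \<kappa> Xl Xr"
      using sep[OF \<epsilon>(1,2)] unfolding \<kappa>_def by blast
    define T where "T = nat \<lceil>8 * ln (1 / \<sigma>) / \<epsilon> + 2 / \<epsilon> + 7\<rceil>"
    have "0 \<le> 8 * ln (1 / \<sigma>) / \<epsilon> + 2 / \<epsilon> + 7"
      using \<sigma> \<epsilon> by (intro add_nonneg_nonneg divide_nonneg_nonneg mult_nonneg_nonneg) auto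
    then have T: "8 * ln (1 / \<sigma>) / \<epsilon> + 2 / \<epsilon> + 7 \<le> real T" "real T \<le> 8 * ln (1 / \<sigma>) / \<epsilon> + 2 / \<epsilon> + 8"
      unfolding T_def by linarith+
    show ?case
    proof (intro allI impI notI)
      fix \<omega> f F
      assume \<omega>: "\<omega> \<notin> \<rat> \<and> \<bar>\<omega>\<bar> < real n powr (- a / 2 - \<delta>)" and gen: "generates (h_fam a v n) f F"
      assume "\<exists>C. invariant_circle f C \<and> has_rotation_number F C \<omega>"
      then obtain \<C> where \<C>: "invariant_circle f \<C>" "has_rotation_number F \<C> \<omega>" by blast
      have lift: "is_lift_of F f" and gl: "generates_lift (h_fam a v n) F"
        using gen by (auto simp: generates_def)
      define W where "W x = 2 * pi * \<epsilon>\<^sup>2 * sin (2 * pi * x) + w x" for x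
      have F: "F (x, y) = (x + y, y + W (x + y))" for x y
        unfolding generated_lift_formula[OF gl dv] W_def \<epsilon>2(2) by simp
      have Wper: "W (x + 1) = W x" for x
        using deriv_periodic[OF dv per, of x] by (simp add: W_def distrib_left sin_add)
      have "\<omega> \<noteq> 0" using \<omega> by auto
      then obtain b :: "int \<Rightarrow> real" where b: "b 0 = \<zeta>" "mono b"
          "\<And>m. b (m + 1) + b (m - 1) - 2 * b m \<ge> W (b m)" "\<And>L. \<exists>m. b m < L"
          "\<And>T. real T * \<bar>\<omega>\<bar> < 1 \<Longrightarrow> b (int T) \<le> \<zeta> + 1"
        by (rule invariant_circle_subsolution[where \<zeta> = \<zeta>, OF F Wper lift \<C>]) (rule that; assumption)
      have "b (int T) > \<zeta> + 1"
        by (rule no_slow_subsolution[OF \<epsilon>(1,3) sep\<epsilon> \<kappa>1 \<kappa>2 \<sigma> w0 wb \<zeta> b(1,2)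
              b(3)[unfolded W_def] b(4) T(1)])
      moreover have "real T * \<bar>\<omega>\<bar> < 1"
      proof -
        have "real T * \<bar>\<omega>\<bar> \<le> (8 * ln (1 / \<sigma>) / \<epsilon> + 2 / \<epsilon> + 8) * real n powr (- a / 2 - \<delta>)"
          using T(2) \<omega> by (intro mult_mono) auto
        also have "\<dots> < 1" using elim(5) by (simp add: \<sigma>_def \<epsilon>_def)
        finally show ?thesis .
      qed
      ultimately show False using b(5)[of T] by simp
    qed
  qed
  then obtain N where N: "\<And>n. n \<ge> N \<Longrightarrow> \<forall>\<omega>::real. \<omega> \<notin> \<rat> \<and> \<bar>\<omega>\<bar> < real n powr (- a / 2 - \<delta>) \<longrightarrow>
             (\<forall>f F. generates (h_fam a v n) f F \<longrightarrow>
               \<not> (\<exists>C. invariant_circle f C \<and> has_rotation_number F C \<omega>))"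
    unfolding eventually_sequentially by blast
  show "\<exists>N\<ge>1. \<forall>n\<ge>N. \<forall>\<omega>::real. \<omega> \<notin> \<rat> \<and> \<bar>\<omega>\<bar> < real n powr (- a / 2 - \<delta>) \<longrightarrow>
             (\<forall>f F. generates (h_fam a v n) f F \<longrightarrow>
               \<not> (\<exists>C. invariant_circle f C \<and> has_rotation_number F C \<omega>))"
    by (rule exI[of _ "max 1 N"]) (use N in auto)
qed simp

end
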